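(* Let $Q$ be a quiver without oriented cycles and $\theta\in\mathbb{Z}^{Q_0}$ an integer weight such that the quiver polytope $\nabla(Q,\theta)$ is non-empty, smooth, and of dimension at most four. Then the toric ideal $\mathcal{I}(Q,\theta)$ of $\nabla(Q,\theta)$ is generated in degree two.
   Context: A quiver $Q$ is a finite directed graph with vertex set $Q_0$ and arrow set $Q_1$ (multiple arrows allowed); an arrow $a$ goes from $a^-$ to $a^+$. For $\theta\in\mathbb{Z}^{Q_0}$ the quiver polytope is $$\nabla(Q,\theta)=\{x\in\mathbb{R}^{Q_1}_{\ge 0}\mid \forall v\in Q_0:\ \theta(v)=\sum_{a^+=v}x(a)-\sum_{a^-=v}x(a)\},$$ considered with the lattice $\mathbb{Z}^{Q_1}\subset\mathbb{R}^{Q_1}$. When $Q$ has no oriented cycles this is a normal lattice polytope (every lattice point of $k\nabla$ is a sum of $k$ lattice points of $\nabla$, for all $k\ge1$). Smoothness: a vertex $v$ of a normal lattice polytope $\nabla\subset\mathbb{R}^d$ is smooth if the ray generators of $\mathrm{Cone}(\nabla-v)=\{\lambda x\mid x\in\nabla-v,\ \lambda\in\mathbb{R}_{\geq 0}\}$ (the lattice points closest to the origin on its edges) form part of a $\mathbb{Z}$-basis of $\mathbb{Z}^d$; otherwise it is singular. The polytope is smooth if all its vertices are smooth (equivalently the projective toric variety $X_\nabla$ is smooth). Toric ideal: if $\nabla\subset\mathbb{R}^d$ is a normal lattice polytope with lattice points $m_1,\dots,m_k$, let $S(\nabla)=\{(m,\lambda)\in\mathbb{Z}^d\times\mathbb{Z}\mid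 \lambda\ge 0,\ m\in\lambda\nabla\}$ and let $\varphi:\mathbb{C}[t_1,\dots,t_k]\to\mathbb{C}[S(\nabla)]$ be the $\mathbb{C}$-algebra surjection $t_i\mapsto x^{(m_i,1)}$. The toric ideal is $\mathcal{I}(\nabla)=\ker\varphi$, and $\mathcal{I}(Q,\theta):=\mathcal{I}(\nabla(Q,\theta))$. "Generated in degree two" means generated by elements of degree at most two in the standard grading (or zero). *)

theory Defs
  imports
    "HOL-Analysis.Analysis"
    "HOL-Library.Poly_Mapping"
    "Graph_Theory.Digraph"
    "Graph_Theory.Arc_Walk"
begin

section \<open>Quiver polytopes\<close>

text \<open>
  A quiver is a finite digraph in the sense of the locale \<^locale>\<open>fin_digraph\<close>: loops and multiple
  arrows are allowed, and so are empty vertex and arrow sets.  The arrow \<open>a\<close> goes from \<open>tail Q a\<close>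
  (written $a^-$ in the literature) to \<open>head Q a\<close> (written $a^+$).  A \<^const>\<open>pre_digraph.cycle\<close> is
  a directed closed walk of positive length without repeated vertices; loops count as cycles.
\<close>

definition acyclic_quiver :: "('v, 'e) pre_digraph \<Rightarrow> bool" where
  "acyclic_quiver Q \<longleftrightarrow> fin_digraph Q \<and> (\<nexists>p. pre_digraph.cycle Q p)"

text \<open>
  The arrow set is a subset of a finite type, and $\mathbb{R}^{Q_1}$ is the coordinate subspace
  of \<open>real ^ 'e\<close> of vectors that vanish outside \<open>arcs Q\<close>.
\<close>

definition arrow_space :: "('v, 'e::finite) pre_digraph \<Rightarrow> (real ^ 'e) set" where
  "arrow_space Q = {x. \<forall>a. a \<notin> arcs Q \<longrightarrow> x $ a = 0}"

definition arrow_lattice :: "('v, 'e::finite) pre_digraph \<Rightarrow> (real ^ 'e) set" where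
  "arrow_lattice Q = {x \<in> arrow_space Q. \<forall>a. x $ a \<in> \<int>}"

definition quiver_polytope ::
    "('v, 'e::finite) pre_digraph \<Rightarrow> ('v \<Rightarrow> int) \<Rightarrow> (real ^ 'e) set" where
  "quiver_polytope Q \<theta> =
     {x \<in> arrow_space Q. (\<forall>a \<in> arcs Q. 0 \<le> x $ a) \<and>
        (\<forall>v \<in> verts Q. real_of_int (\<theta> v) =
            (\<Sum>a | a \<in> arcs Q \<and> head Q a = v. x $ a)
          - (\<Sum>a | a \<in> arcs Q \<and> tail Q a = v. x $ a))}"


section \<open>Smooth polytopes\<close>

text \<open>Here and below, \<open>M\<close> is the lattice with respect to which the polytope \<open>P\<close> is considered.\<close>

interpretation int_module: module "\<lambda>(k::int) (x::'a::real_vector). real_of_int k *\<^sub>R x"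
  by unfold_locales (simp_all add: algebra_simps)

definition part_of_lattice_basis :: "'a::real_vector set \<Rightarrow> 'a set \<Rightarrow> bool" where
  "part_of_lattice_basis M B \<longleftrightarrow>
     (\<exists>C. B \<subseteq> C \<and> int_module.independent C \<and> int_module.span C = M)"

definition vertex_cone :: "'a::real_vector set \<Rightarrow> 'a \<Rightarrow> 'a set" where
  "vertex_cone P v = {c *\<^sub>R (x - v) | c x. 0 \<le> c \<and> x \<in> P}"

definition ray_generators :: "'a::euclidean_space set \<Rightarrow> 'a set \<Rightarrow> 'a set" where
  "ray_generators M C =
     {u. \<exists>E. E edge_of C \<and> u \<in> (E \<inter> M) - {0} \<and> (\<forall>w \<in> (E \<inter> M) - {0}. norm u \<le> norm w)}"

definition smooth_vertex :: "'a::euclidean_space set \<Rightarrow> 'a set \<Rightarrow> 'a \<Rightarrow> bool" where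
  "smooth_vertex M P v \<longleftrightarrow> part_of_lattice_basis M (ray_generators M (vertex_cone P v))"

definition smooth_polytope :: "'a::euclidean_space set \<Rightarrow> 'a set \<Rightarrow> bool" where
  "smooth_polytope M P \<longleftrightarrow> (\<forall>v. v extreme_point_of P \<longrightarrow> smooth_vertex M P v)"


section \<open>Toric ideals\<close>

text \<open>
  Polynomials over \<open>\<complex>\<close> are finitely supported maps from monomials to coefficients, and a monomial
  is a finitely supported map from variables to exponents.  The variables $t_m$ are indexed by
  the lattice points \<open>m\<close> themselves.
\<close>

type_synonym 'a cpoly = "('a \<Rightarrow>\<^sub>0 nat) \<Rightarrow>\<^sub>0 complex"

definition poly_ring :: "'a set \<Rightarrow> 'a cpoly set" where
  "poly_ring L = {f. \<forall>\<mu> \<in> Poly_Mapping.keys f. Poly_Mapping.keys \<mu> \<subseteq> L}"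

definition degree_at_most :: "nat \<Rightarrow> 'a cpoly \<Rightarrow> bool" where
  "degree_at_most n f \<longleftrightarrow>
     (\<forall>\<mu> \<in> Poly_Mapping.keys f. (\<Sum>m \<in> Poly_Mapping.keys \<mu>. Poly_Mapping.lookup \<mu> m) \<le> n)"

text \<open>
  The algebra homomorphism that is the identity on constants and sends $t_m$ to $x^{(m,1)}$.  It is
  given the group algebra of the whole space \<open>'a \<times> int\<close> as its codomain; $\mathbb{C}[S(P)]$ is the
  subalgebra of the elements supported on $S(P)$ and contains the image of \<open>poly_ring (P \<inter> M)\<close>, so
  the kernel is not affected.
\<close>

definition toric_map :: "'a::real_vector cpoly \<Rightarrow> ('a \<times> int) \<Rightarrow>\<^sub>0 complex" where
  "toric_map f =
     (\<Sum>\<mu> \<in> Poly_Mapping.keys f. Poly_Mapping.single 0 (Poly_Mapping.lookup f \<mu>) *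
        (\<Prod>m \<in> Poly_Mapping.keys \<mu>. Poly_Mapping.single (m, 1) 1 ^ Poly_Mapping.lookup \<mu> m))"

definition toric_ideal :: "'a::real_vector set \<Rightarrow> 'a set \<Rightarrow> 'a cpoly set" where
  "toric_ideal M P = {f \<in> poly_ring (P \<inter> M). toric_map f = 0}"

definition ideal_generated_by :: "'r::comm_ring_1 set \<Rightarrow> 'r set \<Rightarrow> 'r set" where
  "ideal_generated_by R G = {\<Sum>g \<in> F. q g * g | F q. finite F \<and> F \<subseteq> G \<and> q ` F \<subseteq> R}"

definition generated_in_degree_two :: "'a set \<Rightarrow> 'a cpoly set \<Rightarrow> bool" where
  "generated_in_degree_two L I \<longleftrightarrow>
     (\<exists>G \<subseteq> poly_ring L. (\<forall>g \<in> G. degree_at_most 2 g) \<and> I = ideal_generated_by (poly_ring L) G)"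

definition quiver_toric_ideal ::
    "('v, 'e::finite) pre_digraph \<Rightarrow> ('v \<Rightarrow> int) \<Rightarrow> (real ^ 'e) cpoly set" where
  "quiver_toric_ideal Q \<theta> = toric_ideal (arrow_lattice Q) (quiver_polytope Q \<theta>)"

end

theory Submission
  imports Defs
begin

text \<open>
  A toric ideal is spanned by the differences of monomials with the same image.  Hence it is
  generated in degree two as soon as any two multisets of lattice points of the same size and sum
  are connected by exchanges that replace two points \<open>x\<close>, \<open>y\<close> by two points with the sum
  \<open>x + y\<close>.  This connectedness is what has to be shown for \<open>\<nabla>(Q, \<theta>)\<close>.

  The differences of lattice points are integer circulations on the arrows that are not forced to
  vanish, and they form a lattice of rank at most four.  The arrows are integer functionals on it.
  Every circulation contains a circulation with entries $-1, 0, 1$ and matching signs, so these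
  functionals form a regular (totally unimodular) system.  A regular system of rank at most
  four is of one of two kinds (\<open>graphic_or_tabular\<close>): either its members are differences of
  potentials, or they are up to sign the nine entries of $3 \times 3$ matrices with vanishing line
  sums.  In matroid terms the second kind is the cographic matroid of $K_{3,3}$, the only regular
  matroid of rank at most four that is not graphic.

  In the first case the lattice points are closed under rounding the potentials of a midpoint down
  and up.  Exchanging \<open>x\<close>, \<open>y\<close> for the two rounded midpoints ends with a multiset that is sorted
  and therefore determined by its size and sum (\<open>quad_connected_if_graphic\<close>).

  In the second case exchanges bring both multisets into a common unit cell of the nine entries
  (\<open>balanced_if_minimal\<close>).  The points of a cell are the $3 \times 3$ tables with entries 0 and 1
  and prescribed line sums.  Unless all line sums are 1 or all are 2, every table of the cell
  differs from all others in one of its entries (\<open>identifying_entry\<close>), so two multisets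
  with the same sum share a point.  Up to complements the cells that remain consist of the six
  permutation matrices, whose only relation is that the three even ones have the same sum as the three
  odd ones.  Exchanges realise this relation if the polytope contains a neighbouring point with
  one entry $-1$ (\<open>birkhoff_exchange\<close>).  If it contains none, then the nine entries are bounded
  below, and the polytope is the Birkhoff polytope of doubly stochastic $3 \times 3$ matrices.
  This polytope is not smooth: it has dimension four, but five edges leave the identity matrix, and
  their generators satisfy the relation just mentioned (\<open>birkhoff_not_smooth\<close>).
\<close>

section \<open>Exchanging two points of a multiset\<close>

inductive swap_step :: "'a::comm_monoid_add set \<Rightarrow> 'a multiset \<Rightarrow> 'a multiset \<Rightarrow> bool"
  for S where
  swap: "\<lbrakk>set_mset N \<subseteq> S; x \<in> S; y \<in> S; x' \<in> S; y' \<in> S; x + y = x' + y'\<rbrakk>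
    \<Longrightarrow> swap_step S (N + {#x, y#}) (N + {#x', y'#})"

abbreviation swap_equiv :: "'a::comm_monoid_add set \<Rightarrow> 'a multiset \<Rightarrow> 'a multiset \<Rightarrow> bool" where
  "swap_equiv S \<equiv> (swap_step S)\<^sup>*\<^sup>*"

definition quad_connected :: "'a::comm_monoid_add set \<Rightarrow> bool" where
  "quad_connected S \<longleftrightarrow> (\<forall>M M'. set_mset M \<subseteq> S \<and> set_mset M' \<subseteq> S \<and> size M = size M' \<and>
     sum_mset M = sum_mset M' \<longrightarrow> swap_equiv S M M')"

lemma swap_step_sym: "swap_step S M M' \<Longrightarrow> swap_step S M' M"
  by (erule swap_step.cases, simp only:, rule swap_step.swap, simp_all only:)

lemma swap_equiv_sym: "swap_equiv S M M' \<Longrightarrow> swap_equiv S M' M"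
proof (induction rule: rtranclp_induct)
  case (step L L')
  then show ?case using swap_step_sym by (metis converse_rtranclp_into_rtranclp)
qed simp

lemma swap_equiv_invariants:
  assumes "swap_equiv S M M'" "set_mset M \<subseteq> S"
  shows "set_mset M' \<subseteq> S \<and> size M' = size M \<and> sum_mset M' = sum_mset M"
  using assms
proof (induction rule: rtranclp_induct)
  case (step L L')
  from step.hyps(2) step.IH step.prems show ?case
    by cases (auto simp flip: add.assoc)
qed simp

lemma swap_equiv_add:
  assumes "swap_equiv S M M'" "set_mset N \<subseteq> S"
  shows "swap_equiv S (N + M) (N + M')"
  using assms(1)
proof (induction rule: rtranclp_induct)
  case (step L L')
  from step.hyps(2) have "swap_step S (N + L) (N + L')"
  proof cases
    case (swap N' x y x' y')
    then show ?thesis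
      using swap_step.swap[of "N + N'" S x y x' y'] assms(2) by (simp add: add.assoc)
  qed
  with step.IH show ?case by simp
qed simp

lemma swap_equiv_pair:
  assumes "set_mset N \<subseteq> S" "x \<in> S" "y \<in> S" "x' \<in> S" "y' \<in> S" "x + y = x' + y'"
  shows "swap_equiv S (N + {#x, y#}) (N + {#x', y'#})"
  using swap_step.swap[OF assms] by blast

text \<open>
  Once two multisets share a point, that point can be set aside, and the remaining multisets are
  smaller and still have equal sums.
\<close>

lemma quad_connectedI:
  fixes S :: "'a::cancel_comm_monoid_add set"
  assumes "\<And>M M'. \<lbrakk>M \<noteq> {#}; set_mset M \<subseteq> S; set_mset M' \<subseteq> S; size M = size M';
       sum_mset M = sum_mset M'\<rbrakk>
     \<Longrightarrow> \<exists>L L' x. swap_equiv S M L \<and> swap_equiv S M' L' \<and> x \<in># L \<and> x \<in># L'"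
  shows "quad_connected S"
proof -
  have "swap_equiv S M M'" if "size M = n" "set_mset M \<subseteq> S" "set_mset M' \<subseteq> S" "size M = size M'"
       "sum_mset M = sum_mset M'" for M M' n
    using that
  proof (induction n arbitrary: M M')
    case 0
    then show ?case by simp
  next
    case (Suc n)
    then have "M \<noteq> {#}" by auto
    then obtain L L' x where L: "swap_equiv S M L" "swap_equiv S M' L'" "x \<in># L" "x \<in># L'"
      using assms[of M M'] Suc.prems(2-5) by blast
    obtain K K' where K: "L = add_mset x K" "L' = add_mset x K'"
      using L(3,4) by (metis mset_add)
    note inv = swap_equiv_invariants[OF L(1)] swap_equiv_invariants[OF L(2)]
    have eq: "x + sum_mset K = x + sum_mset K'"
      using inv Suc.prems(2,3,5) unfolding K by simp
    have "swap_equiv S K K'"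
    proof (rule Suc.IH)
      show "size K = n" using inv Suc.prems(1,2) by (simp add: K)
      show "set_mset K \<subseteq> S" using inv(1) Suc.prems(2) by (simp add: K)
      show "set_mset K' \<subseteq> S" using inv(2) Suc.prems(3) by (simp add: K)
      show "size K = size K'" using inv Suc.prems(2-4) by (simp add: K)
      show "sum_mset K = sum_mset K'" using eq by simp
    qed
    then have "swap_equiv S ({#x#} + K) ({#x#} + K')"
      by (rule swap_equiv_add) (use inv(1) Suc.prems(2) in \<open>simp add: K\<close>)
    then have "swap_equiv S L L'" by (simp add: K)
    with L(1) swap_equiv_sym[OF L(2)] show ?case by (meson rtranclp_trans)
  qed
  then show ?thesis unfolding quad_connected_def by blast
qed

text \<open>
  A multiset of least total weight in its class admits no exchange that lowers the weight.  All
  normal forms below arise from this with a sum of squares as the weight.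
\<close>

lemma swap_equiv_minimal:
  fixes w :: "'a::comm_monoid_add \<Rightarrow> nat"
  assumes "set_mset M \<subseteq> S"
  obtains L where "swap_equiv S M L"
    "\<And>x y x' y'. \<lbrakk>{#x, y#} \<subseteq># L; x' \<in> S; y' \<in> S; x' + y' = x + y\<rbrakk> \<Longrightarrow> w x + w y \<le> w x' + w y'"
proof -
  let ?W = "\<lambda>L. sum_mset (image_mset w L)"
  obtain L where L: "swap_equiv S M L" "\<And>K. swap_equiv S M K \<Longrightarrow> ?W L \<le> ?W K"
    using ex_has_least_nat[of "swap_equiv S M" M ?W] by blast
  have "w x + w y \<le> w x' + w y'"
    if xy: "{#x, y#} \<subseteq># L" "x' \<in> S" "y' \<in> S" "x' + y' = x + y" for x y x' y'
  proof -
    obtain N where N: "L = N + {#x, y#}"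
      using xy(1) by (metis subset_mset.diff_add)
    have "set_mset L \<subseteq> S" using swap_equiv_invariants[OF L(1) assms] by simp
    then have "swap_equiv S L (N + {#x', y'#})"
      unfolding N by (intro swap_equiv_pair) (use xy in auto)
    then have "?W L \<le> ?W (N + {#x', y'#})"
      using L(1) by (intro L(2)) simp
    then show ?thesis by (simp add: N)
  qed
  with L(1) that show thesis by blast
qed

text \<open>
  The subgroup \<open>G\<close> is present because the parametrisation of circulations used later is
  injective only on the coordinates that a basis occupies.
\<close>

lemma quad_connected_image:
  fixes h :: "'a::ab_group_add \<Rightarrow> 'b::ab_group_add"
  assumes "quad_connected S" and add: "\<And>x y. h (x + y) = h x + h y"
    and G: "S \<subseteq> G" "0 \<in> G" "\<And>x y. x \<in> G \<Longrightarrow> y \<in> G \<Longrightarrow> x + y \<in> G" and inj: "inj_on h G"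
  shows "quad_connected ((\<lambda>x. c + h x) ` S)"
proof -
  let ?g = "\<lambda>x. c + h x"
  have h0: "h 0 = 0" using add[of 0 0] by simp
  have sum: "sum_mset (image_mset h M) = h (sum_mset M)" for M
    by (induction M) (auto simp: h0 add)
  have sumg: "sum_mset (image_mset ?g M) = sum_mset (replicate_mset (size M) c) + h (sum_mset M)" for M
    by (induction M) (auto simp: h0 add ac_simps)
  have step: "swap_equiv (?g ` S) (image_mset ?g M) (image_mset ?g M')" if "swap_equiv S M M'" for M M'
    using that
  proof (induction rule: rtranclp_induct)
    case (step L L')
    from step.hyps(2) obtain N x y x' y' where L: "L = N + {#x, y#}" "L' = N + {#x', y'#}"
      "set_mset N \<subseteq> S" "x \<in> S" "y \<in> S" "x' \<in> S" "y' \<in> S" "x + y = x' + y'"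
      by cases blast
    have "?g x + ?g y = ?g x' + ?g y'"
    proof -
      have "h x + h y = h x' + h y'" using L(8) add by metis
      then show ?thesis by (simp add: algebra_simps)
    qed
    then have "swap_equiv (?g ` S) (image_mset ?g N + {#?g x, ?g y#}) (image_mset ?g N + {#?g x', ?g y'#})"
      by (intro swap_equiv_pair) (use L in auto)
    then show ?case using step.IH by (simp add: L)
  qed simp
  show ?thesis
    unfolding quad_connected_def
  proof (intro allI impI, elim conjE)
    fix M M' assume M: "set_mset M \<subseteq> ?g ` S" "set_mset M' \<subseteq> ?g ` S" "size M = size M'"
      "sum_mset M = sum_mset M'"
    have ex: "\<exists>K. set_mset K \<subseteq> S \<and> image_mset ?g K = M" if "set_mset M \<subseteq> ?g ` S" for M
      using that
    proof (induction M)
      case (add x M)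
      then obtain K y where "set_mset K \<subseteq> S" "image_mset ?g K = M" "y \<in> S" "x = ?g y" by auto
      then show ?case by (intro exI[of _ "add_mset y K"]) auto
    qed simp
    obtain K K' where K: "set_mset K \<subseteq> S" "image_mset ?g K = M" "set_mset K' \<subseteq> S" "image_mset ?g K' = M'"
      using ex M by metis
    have sz: "size K = size K'" using M(3) K by (metis size_image_mset)
    have "h (sum_mset K) = h (sum_mset K')"
      using M(4) sumg[of K] sumg[of K'] sz by (simp add: K)
    moreover have "sum_mset N \<in> G" if "set_mset N \<subseteq> S" for N
      using that by (induction N) (use G in auto)
    ultimately have "sum_mset K = sum_mset K'" using inj K(1,3) by (simp add: inj_onD)
    then have "swap_equiv S K K'" using assms(1) K sz unfolding quad_connected_def by blast
    then show "swap_equiv (?g ` S) M M'" using step K by blast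
  qed
qed

section \<open>Quadratic generation from exchanges\<close>

definition monomial_of :: "'a multiset \<Rightarrow> ('a \<Rightarrow>\<^sub>0 nat)" where
  "monomial_of M = Abs_poly_mapping (count M)"

definition exponents :: "('a \<Rightarrow>\<^sub>0 nat) \<Rightarrow> 'a multiset" where
  "exponents \<mu> = Abs_multiset (Poly_Mapping.lookup \<mu>)"

lemma lookup_monomial_of [simp]: "Poly_Mapping.lookup (monomial_of M) = count M"
proof -
  have "finite {x. count M x \<noteq> 0}" by (simp add: not_in_iff flip: set_mset_def)
  then show ?thesis unfolding monomial_of_def by (rule lookup_Abs_poly_mapping)
qed

lemma count_exponents [simp]: "count (exponents \<mu>) = Poly_Mapping.lookup \<mu>"
proof -
  have "finite {x. 0 < Poly_Mapping.lookup \<mu> x}" using finite_lookup[of \<mu>] by simp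
  then show ?thesis unfolding exponents_def by (rule count_Abs_multiset)
qed

lemma monomial_of_exponents [simp]: "monomial_of (exponents \<mu>) = \<mu>"
  by (simp add: poly_mapping_eq_iff)

lemma exponents_monomial_of [simp]: "exponents (monomial_of M) = M"
  by (simp add: multiset_eq_iff)

lemma set_mset_exponents [simp]: "set_mset (exponents \<mu>) = Poly_Mapping.keys \<mu>"
  by (auto simp: set_mset_def in_keys_iff)

lemma keys_monomial_of [simp]: "Poly_Mapping.keys (monomial_of M) = set_mset M"
  by (metis exponents_monomial_of set_mset_exponents)

lemma monomial_of_add: "monomial_of (M + N) = monomial_of M + monomial_of N"
  by (simp add: poly_mapping_eq_iff fun_eq_iff lookup_add)

definition toric_degree :: "('a::real_vector \<Rightarrow>\<^sub>0 nat) \<Rightarrow> 'a \<times> int" where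
  "toric_degree \<mu> = (sum_mset (exponents \<mu>), int (size (exponents \<mu>)))"

lemma toric_monomial:
  "(\<Prod>m \<in> Poly_Mapping.keys \<mu>. Poly_Mapping.single (m :: 'a::real_vector, 1::int) (1::complex) ^ Poly_Mapping.lookup \<mu> m)
     = Poly_Mapping.single (toric_degree \<mu>) 1"
proof -
  have "prod_mset (image_mset (\<lambda>m. Poly_Mapping.single (m, 1::int) (1::complex)) M)
    = Poly_Mapping.single (sum_mset M, int (size M)) 1" for M :: "'a multiset"
    by (induction M) (auto simp: mult_single zero_prod_def[symmetric])
  from this[of "exponents \<mu>"] show ?thesis
    by (simp add: toric_degree_def image_prod_mset_multiplicity)
qed

lemma toric_map_eq:
  assumes "finite A" "Poly_Mapping.keys f \<subseteq> A"
  shows "toric_map f = (\<Sum>\<mu>\<in>A. Poly_Mapping.single (toric_degree \<mu>) (Poly_Mapping.lookup f \<mu>))"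
proof -
  have "toric_map f = (\<Sum>\<mu>\<in>Poly_Mapping.keys f. Poly_Mapping.single (toric_degree \<mu>) (Poly_Mapping.lookup f \<mu>))"
    unfolding toric_map_def toric_monomial by (simp add: mult_single)
  also have "\<dots> = (\<Sum>\<mu>\<in>A. Poly_Mapping.single (toric_degree \<mu>) (Poly_Mapping.lookup f \<mu>))"
    using assms by (intro sum.mono_neutral_left) (auto simp: in_keys_iff)
  finally show ?thesis .
qed

lemma toric_map_add: "toric_map (f + g) = toric_map f + toric_map g"
proof -
  let ?A = "Poly_Mapping.keys f \<union> Poly_Mapping.keys g"
  show ?thesis
    using toric_map_eq[of ?A "f + g"] toric_map_eq[of ?A f] toric_map_eq[of ?A g] keys_add[of f g]
    by (simp add: lookup_add single_add sum.distrib)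
qed

lemma toric_map_zero: "toric_map 0 = 0"
  by (simp add: toric_map_def)

lemma toric_map_sum: "toric_map (sum f A) = (\<Sum>a\<in>A. toric_map (f a))"
  by (induction A rule: infinite_finite_induct) (simp_all add: toric_map_add toric_map_zero)

lemma toric_map_single: "toric_map (Poly_Mapping.single \<mu> c) = Poly_Mapping.single (toric_degree \<mu>) c"
  by (subst toric_map_eq[of "{\<mu>}"]) auto

lemma poly_mapping_sum_singles: "f = (\<Sum>\<mu>\<in>Poly_Mapping.keys f. Poly_Mapping.single \<mu> (Poly_Mapping.lookup f \<mu>))"
  by (rule poly_mapping_eqI) (auto simp: lookup_sum lookup_single when_def in_keys_iff)

lemma poly_ring_zero: "0 \<in> poly_ring L"
  by (simp add: poly_ring_def)

lemma poly_ring_add: "f \<in> poly_ring L \<Longrightarrow> g \<in> poly_ring L \<Longrightarrow> f + g \<in> poly_ring L"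
  unfolding poly_ring_def using keys_add[of f g] by (auto dest!: subsetD)

lemma poly_ring_sum: "(\<And>a. a \<in> A \<Longrightarrow> f a \<in> poly_ring L) \<Longrightarrow> sum f A \<in> poly_ring L"
  by (induction A rule: infinite_finite_induct) (simp_all add: poly_ring_add poly_ring_zero)

lemma poly_ring_mult:
  assumes "f \<in> poly_ring L" "g \<in> poly_ring L" shows "f * g \<in> poly_ring L"
  unfolding poly_ring_def
proof (intro CollectI ballI)
  fix \<mu> assume "\<mu> \<in> Poly_Mapping.keys (f * g)"
  then obtain a b where "\<mu> = a + b" "a \<in> Poly_Mapping.keys f" "b \<in> Poly_Mapping.keys g"
    using keys_mult by blast
  then show "Poly_Mapping.keys \<mu> \<subseteq> L"
    using assms keys_add[of a b] unfolding poly_ring_def by blast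
qed

lemma poly_ring_single: "Poly_Mapping.keys \<mu> \<subseteq> L \<Longrightarrow> Poly_Mapping.single \<mu> c \<in> poly_ring L"
  by (simp add: poly_ring_def)

lemma poly_ring_uminus: "f \<in> poly_ring L \<Longrightarrow> - f \<in> poly_ring L"
  by (simp add: poly_ring_def in_keys_iff)

lemma ideal_generated_by_mult:
  "q \<in> R \<Longrightarrow> g \<in> G \<Longrightarrow> q * g \<in> ideal_generated_by R G"
  unfolding ideal_generated_by_def by (intro CollectI exI[of _ "{g}"] exI[of _ "\<lambda>_. q"]) auto

lemma ideal_generated_by_add:
  assumes "\<And>p q. p \<in> R \<Longrightarrow> q \<in> R \<Longrightarrow> p + q \<in> R" "0 \<in> R"
    and "a \<in> ideal_generated_by R G" "b \<in> ideal_generated_by R G"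
  shows "a + b \<in> ideal_generated_by R G"
proof -
  obtain F q where a: "a = (\<Sum>g \<in> F. q g * g)" "finite F" "F \<subseteq> G" "q ` F \<subseteq> R"
    using assms(3) unfolding ideal_generated_by_def by blast
  obtain F' q' where b: "b = (\<Sum>g \<in> F'. q' g * g)" "finite F'" "F' \<subseteq> G" "q' ` F' \<subseteq> R"
    using assms(4) unfolding ideal_generated_by_def by blast
  let ?p = "\<lambda>g. if g \<in> F then q g else 0" and ?p' = "\<lambda>g. if g \<in> F' then q' g else 0"
  have "a = (\<Sum>g \<in> F \<union> F'. ?p g * g)" "b = (\<Sum>g \<in> F \<union> F'. ?p' g * g)"
    unfolding a(1) b(1) using a(2) b(2) by (auto intro!: sum.mono_neutral_cong_left)
  then have "a + b = (\<Sum>g \<in> F \<union> F'. (?p g + ?p' g) * g)"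
    by (simp only: distrib_right sum.distrib)
  moreover have "(\<lambda>g. ?p g + ?p' g) ` (F \<union> F') \<subseteq> R"
    using a(4) b(4) assms(1,2) by (auto simp: image_subset_iff)
  moreover have "finite (F \<union> F')" "F \<union> F' \<subseteq> G" using a b by auto
  ultimately show ?thesis
    unfolding ideal_generated_by_def by (intro CollectI exI[of _ "F \<union> F'"] exI[of _ "\<lambda>g. ?p g + ?p' g"] conjI)
qed

text \<open>
  Modulo the quadratic binomials every monomial equals a representative of its degree that depends
  only on its image.  A polynomial in the kernel becomes a combination of representatives
  in which the coefficients of each degree add up to zero.
\<close>

lemma generated_in_degree_two_if_quad_connected:
  fixes M P :: "'a::real_vector set"
  assumes conn: "quad_connected (P \<inter> M)"
  shows "generated_in_degree_two (P \<inter> M) (toric_ideal M P)"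
proof -
  define L where "L = P \<inter> M"
  define G where "G = {Poly_Mapping.single (monomial_of {#x, y#}) 1
      - Poly_Mapping.single (monomial_of {#x', y'#}) (1::complex)
      | x y x' y'. x \<in> L \<and> y \<in> L \<and> x' \<in> L \<and> y' \<in> L \<and> x + y = x' + y'}"
  define J where "J = ideal_generated_by (poly_ring L) G"
  have J0: "0 \<in> J"
    unfolding J_def ideal_generated_by_def by (intro CollectI exI[of _ "{}"]) auto
  have Jadd: "a + b \<in> J" if "a \<in> J" "b \<in> J" for a b
    using ideal_generated_by_add[of "poly_ring L" a G b] poly_ring_add poly_ring_zero that
    unfolding J_def by blast
  have Jsum: "sum f A \<in> J" if "\<And>a. a \<in> A \<Longrightarrow> f a \<in> J" for f and A :: "'i set"
    using that by (induction A rule: infinite_finite_induct) (simp_all add: J0 Jadd)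
  have GL: "G \<subseteq> poly_ring L"
    unfolding G_def by (auto simp: diff_conv_add_uminus simp del: add_uminus_conv_diff
        intro!: poly_ring_add poly_ring_uminus poly_ring_single)
  have Gdeg: "degree_at_most 2 g" if gG: "g \<in> G" for g
  proof -
    obtain x y x' y' where g: "g = Poly_Mapping.single (monomial_of {#x, y#}) 1
      - Poly_Mapping.single (monomial_of {#x', y'#}) (1::complex)" and "x + y = x' + y'"
      using gG unfolding G_def by blast
    have deg: "sum (count {#u, v#}) (set_mset {#u, v#}) \<le> 2" for u v :: 'a
      by (simp only: size_multiset_overloaded_eq[symmetric]) simp
    show ?thesis
      unfolding degree_at_most_def g
    proof (intro ballI)
      fix \<mu> assume "\<mu> \<in> Poly_Mapping.keys (Poly_Mapping.single (monomial_of {#x, y#}) 1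
        - Poly_Mapping.single (monomial_of {#x', y'#}) (1::complex))"
      then have "\<mu> = monomial_of {#x, y#} \<or> \<mu> = monomial_of {#x', y'#}"
        using keys_diff by fastforce
      then show "sum (Poly_Mapping.lookup \<mu>) (Poly_Mapping.keys \<mu>) \<le> 2"
        by (elim disjE) (simp_all only: lookup_monomial_of keys_monomial_of deg)
    qed
  qed
  have Gker: "toric_map (q * g) = 0" if gG: "g \<in> G" for q g
  proof -
    obtain x y x' y' where g: "g = Poly_Mapping.single (monomial_of {#x, y#}) 1
      - Poly_Mapping.single (monomial_of {#x', y'#}) (1::complex)" and xy: "x + y = x' + y'"
      using gG unfolding G_def by blast
    have "toric_map (Poly_Mapping.single \<mu> c * g) = 0" for \<mu> c
    proof -
      have "Poly_Mapping.single \<mu> c * g =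
        Poly_Mapping.single (monomial_of (exponents \<mu> + {#x, y#})) c
        + Poly_Mapping.single (monomial_of (exponents \<mu> + {#x', y'#})) (- c)"
        unfolding g monomial_of_add by (simp add: right_diff_distrib mult_single single_uminus)
      moreover have "toric_degree (monomial_of (exponents \<mu> + {#x, y#}))
          = toric_degree (monomial_of (exponents \<mu> + {#x', y'#}))"
        unfolding toric_degree_def exponents_monomial_of
        using xy by (simp add: add.assoc[symmetric])
      ultimately show ?thesis
        by (simp only: toric_map_add toric_map_single flip: single_add) simp
    qed
    then have "toric_map (\<Sum>\<mu>\<in>Poly_Mapping.keys q. Poly_Mapping.single \<mu> (Poly_Mapping.lookup q \<mu>) * g) = 0"
      by (simp add: toric_map_sum)
    then show ?thesis
      by (simp only: flip: sum_distrib_right poly_mapping_sum_singles)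
  qed
  have "J \<subseteq> toric_ideal M P"
  proof
    fix f assume "f \<in> J"
    then obtain F q where f: "f = (\<Sum>g \<in> F. q g * g)" "finite F" "F \<subseteq> G" "q ` F \<subseteq> poly_ring L"
      unfolding J_def ideal_generated_by_def by blast
    have "f \<in> poly_ring L"
      unfolding f(1) by (intro poly_ring_sum poly_ring_mult) (use f GL in auto)
    moreover have "toric_map f = 0"
      unfolding f(1) toric_map_sum using Gker f(3) by (intro sum.neutral) blast
    ultimately show "f \<in> toric_ideal M P" by (simp add: toric_ideal_def L_def)
  qed
  moreover have "toric_ideal M P \<subseteq> J"
  proof
    fix f assume "f \<in> toric_ideal M P"
    then have fL: "f \<in> poly_ring L" and f0: "toric_map f = 0"
      by (auto simp: toric_ideal_def L_def)
    let ?s = "\<lambda>K. Poly_Mapping.single (monomial_of K)"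
    have binomial: "?s K c - ?s K' c \<in> J"
      if "swap_equiv L K K'" for K K' c
      using that
    proof (induction rule: rtranclp_induct)
      case (step K' K'')
      from step.hyps(2) have "?s K' c - ?s K'' c \<in> J"
      proof cases
        case (swap N x y x' y')
        have "?s N c * (?s {#x, y#} 1 - ?s {#x', y'#} 1) \<in> J"
          unfolding J_def
        proof (rule ideal_generated_by_mult)
          show "?s N c \<in> poly_ring L" using swap by (intro poly_ring_single) simp
          show "?s {#x, y#} 1 - ?s {#x', y'#} 1 \<in> G" using swap unfolding G_def by blast
        qed
        then show ?thesis
          unfolding swap monomial_of_add by (simp add: right_diff_distrib mult_single)
      qed
      from Jadd[OF step.IH this] show ?case by simp
    qed (simp add: J0)
    define r where "r k = (SOME K. set_mset K \<subseteq> L \<and> toric_degree (monomial_of K) = k)" for k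
    let ?K = "Poly_Mapping.keys f" and ?c = "Poly_Mapping.lookup f"
    have "Poly_Mapping.single \<mu> c - ?s (r (toric_degree \<mu>)) c \<in> J" if "\<mu> \<in> ?K" for \<mu> c
    proof -
      have L: "set_mset (exponents \<mu>) \<subseteq> L"
        using fL that by (auto simp: poly_ring_def)
      then have "\<exists>K. set_mset K \<subseteq> L \<and> toric_degree (monomial_of K) = toric_degree \<mu>"
        by (intro exI[of _ "exponents \<mu>"]) simp
      from someI_ex[OF this] have "set_mset (r (toric_degree \<mu>)) \<subseteq> L"
        "toric_degree (monomial_of (r (toric_degree \<mu>))) = toric_degree \<mu>"
        unfolding r_def by auto
      then have "swap_equiv L (exponents \<mu>) (r (toric_degree \<mu>))"
        using conn L unfolding quad_connected_def L_def[symmetric] by (simp add: toric_degree_def)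
      from binomial[OF this] show ?thesis by simp
    qed
    then have "(\<Sum>\<mu>\<in>?K. Poly_Mapping.single \<mu> (?c \<mu>) - ?s (r (toric_degree \<mu>)) (?c \<mu>)) \<in> J"
      by (rule Jsum)
    moreover have "(\<Sum>\<mu>\<in>?K. ?s (r (toric_degree \<mu>)) (?c \<mu>)) = 0"
    proof -
      have "(\<Sum>\<mu>\<in>{\<mu>\<in>?K. toric_degree \<mu> = k}. ?c \<mu>) = 0" for k
      proof -
        have "0 = Poly_Mapping.lookup (toric_map f) k" by (simp add: f0)
        also have "\<dots> = (\<Sum>\<mu>\<in>?K. ?c \<mu> when toric_degree \<mu> = k)"
          by (simp add: toric_map_eq[of ?K f] lookup_sum lookup_single)
        also have "\<dots> = (\<Sum>\<mu>\<in>{\<mu>\<in>?K. toric_degree \<mu> = k}. ?c \<mu>)"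
          by (simp add: when_def sum.If_cases Int_def)
        finally show ?thesis by simp
      qed
      then have "(\<Sum>\<mu>\<in>{\<mu>\<in>?K. toric_degree \<mu> = k}. ?s (r (toric_degree \<mu>)) (?c \<mu>)) = 0" for k
      proof -
        have "(\<Sum>\<mu>\<in>{\<mu>\<in>?K. toric_degree \<mu> = k}. ?s (r (toric_degree \<mu>)) (?c \<mu>))
          = (\<Sum>\<mu>\<in>{\<mu>\<in>?K. toric_degree \<mu> = k}. ?s (r k) (?c \<mu>))"
          by (intro sum.cong) auto
        also have "\<dots> = ?s (r k) (\<Sum>\<mu>\<in>{\<mu>\<in>?K. toric_degree \<mu> = k}. ?c \<mu>)"
        proof -
          have "(\<Sum>\<mu>\<in>A. ?s (r k) (?c \<mu>)) = ?s (r k) (\<Sum>\<mu>\<in>A. ?c \<mu>)" for A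
            by (induction A rule: infinite_finite_induct) (simp_all add: single_add)
          then show ?thesis .
        qed
        finally show ?thesis using \<open>\<And>k. (\<Sum>\<mu>\<in>{\<mu>\<in>?K. toric_degree \<mu> = k}. ?c \<mu>) = 0\<close> by simp
      qed
      then show ?thesis
        by (subst sum.image_gen[OF finite_keys, where g = toric_degree]) simp
    qed
    ultimately show "f \<in> J"
      using poly_mapping_sum_singles[of f] by (simp add: sum_subtractf)
  qed
  ultimately show ?thesis
    unfolding generated_in_degree_two_def L_def[symmetric] using GL Gdeg J_def by blast
qed

section \<open>Regular systems of integer functionals of rank four\<close>

text \<open>
  The last assumption is the form of total unimodularity that circulations provide directly: every
  lattice vector contains a vector with values $-1, 0, 1$ whose signs agree with it.
\<close>

locale regular_functionals =
  fixes F :: "('l::ab_group_add \<Rightarrow> int) set"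
  assumes add: "f \<in> F \<Longrightarrow> f (x + y) = f x + f y"
    and neg: "f \<in> F \<Longrightarrow> (\<lambda>x. - f x) \<in> F"
    and conformal: "z \<noteq> 0 \<Longrightarrow> \<exists>y. y \<noteq> 0 \<and>
      (\<forall>f\<in>F. f y \<in> {-1, 0, 1} \<and> (f z = 0 \<longrightarrow> f y = 0) \<and> 0 \<le> f y * f z)"
begin

definition coords :: "('l \<Rightarrow> int) \<Rightarrow> ('l \<Rightarrow> int) \<Rightarrow> ('l \<Rightarrow> int) \<Rightarrow> ('l \<Rightarrow> int) \<Rightarrow> bool" where
  "coords a b c d \<longleftrightarrow> (\<forall>f\<in>{a, b, c, d}. \<forall>x y. f (x + y) = f x + f y) \<and>
     (\<forall>i j k l. \<exists>x. a x = i \<and> b x = j \<and> c x = k \<and> d x = l) \<and>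
     (\<forall>x. a x = 0 \<and> b x = 0 \<and> c x = 0 \<and> d x = 0 \<longrightarrow> x = 0)"

definition frame :: "('l \<Rightarrow> int) \<Rightarrow> ('l \<Rightarrow> int) \<Rightarrow> ('l \<Rightarrow> int) \<Rightarrow> ('l \<Rightarrow> int) \<Rightarrow> bool" where
  "frame a b c d \<longleftrightarrow> {a, b, c, d} \<subseteq> F \<and> coords a b c d"

text \<open>
  A frame identifies the functionals with vectors of $\mathbb{Z}^4$; this predicate is membership of
  $(p, q, r, s)$ in the set of vectors that corresponds to \<open>F\<close>.
\<close>

definition comb :: "('l \<Rightarrow> int) \<Rightarrow> ('l \<Rightarrow> int) \<Rightarrow> ('l \<Rightarrow> int) \<Rightarrow> ('l \<Rightarrow> int) \<Rightarrow> int \<Rightarrow> int \<Rightarrow> int \<Rightarrow> int \<Rightarrow> bool" where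
  "comb a b c d p q r s \<longleftrightarrow> (\<lambda>x. p * a x + q * b x + r * c x + s * d x) \<in> F"

text \<open>
  The potentials \<open>p\<close>, \<open>q\<close>, \<open>r\<close>, \<open>s\<close> and the zero potential belong to the five vertices of a
  graph whose arrows are the members of \<open>F\<close>.  The potentials themselves need not be in \<open>F\<close>.
\<close>

definition graphic :: bool where
  "graphic \<longleftrightarrow> (\<exists>p q r s. coords p q r s \<and>
     (\<forall>h\<in>F. \<exists>f\<in>{\<lambda>_. 0, p, q, r, s}. \<exists>g\<in>{\<lambda>_. 0, p, q, r, s}. \<forall>x. h x = f x - g x))"

text \<open>
  The nine entries of a $3 \times 3$ matrix with vanishing line sums; no other functionals occur
  up to sign.
\<close>

definition table :: "(nat \<Rightarrow> nat \<Rightarrow> 'l \<Rightarrow> int) \<Rightarrow> bool" where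
  "table T \<longleftrightarrow> (\<forall>i<3. \<forall>j<3. T i j \<in> F) \<and>
     (\<forall>x. \<forall>i<3. T i 0 x + T i 1 x + T i 2 x = 0) \<and>
     (\<forall>x. \<forall>j<3. T 0 j x + T 1 j x + T 2 j x = 0) \<and>
     (\<forall>x. (\<forall>i<3. \<forall>j<3. T i j x = 0) \<longrightarrow> x = 0) \<and>
     (\<forall>h\<in>F. (\<forall>x. h x = 0) \<or> (\<exists>i<3. \<exists>j<3. (\<forall>x. h x = T i j x) \<or> (\<forall>x. h x = - T i j x)))"

definition tabular :: bool where
  "tabular \<longleftrightarrow> (\<exists>T. table T)"

lemma tableD:
  assumes "table T"
  shows "i < 3 \<Longrightarrow> j < 3 \<Longrightarrow> T i j \<in> F"
    and "i < 3 \<Longrightarrow> T i 0 z + T i 1 z + T i 2 z = 0"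
    and "j < 3 \<Longrightarrow> T 0 j z + T 1 j z + T 2 j z = 0"
    and "h \<in> F \<Longrightarrow> (\<forall>z. h z = 0) \<or> (\<exists>i<3. \<exists>j<3. (\<forall>z. h z = T i j z) \<or> (\<forall>z. h z = - T i j z))"
proof -
  note t = assms[unfolded table_def]
  show "i < 3 \<Longrightarrow> j < 3 \<Longrightarrow> T i j \<in> F" by (rule t[THEN conjunct1, rule_format])
  show "i < 3 \<Longrightarrow> T i 0 z + T i 1 z + T i 2 z = 0" by (rule t[THEN conjunct2, THEN conjunct1, rule_format])
  show "j < 3 \<Longrightarrow> T 0 j z + T 1 j z + T 2 j z = 0"
    by (rule t[THEN conjunct2, THEN conjunct2, THEN conjunct1, rule_format])
  show "h \<in> F \<Longrightarrow> (\<forall>z. h z = 0) \<or> (\<exists>i<3. \<exists>j<3. (\<forall>z. h z = T i j z) \<or> (\<forall>z. h z = - T i j z))"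
    by (rule t[THEN conjunct2, THEN conjunct2, THEN conjunct2, THEN conjunct2, THEN bspec])
qed

lemma in_F_cong: "f \<in> F \<Longrightarrow> (\<And>x. f x = g x) \<Longrightarrow> g \<in> F"
  by (metis ext)

lemma combI: "f \<in> F \<Longrightarrow> (\<And>x. f x = p * a x + q * b x + r * c x + s * d x) \<Longrightarrow> comb a b c d p q r s"
  unfolding comb_def by (erule in_F_cong)

lemma comb_neg: "comb a b c d p q r s \<Longrightarrow> comb a b c d (-p) (-q) (-r) (-s)"
  unfolding comb_def by (drule neg, erule in_F_cong) (simp add: algebra_simps)

lemma additive_int: 
  fixes \<phi> :: "int \<Rightarrow> int"
  assumes "\<And>m n. \<phi> (m + n) = \<phi> m + \<phi> n"
  shows "\<phi> k = k * \<phi> 1"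
proof (induction k rule: int_induct[where k = 0])
  case base
  show ?case using assms[of 0 0] by simp
next
  case (step1 i)
  then show ?case using assms[of i 1] by (simp add: algebra_simps)
next
  case (step2 i)
  then show ?case using assms[of "i - 1" 1] by (simp add: algebra_simps)
qed

lemma coords_linear:
  assumes "coords a b c d" and h: "\<And>x y. h (x + y) = h x + h y"
  obtains p q r s :: int where "\<And>x. h x = p * a x + q * b x + r * c x + s * d x"
proof -
  have add': "a (x + y) = a x + a y" "b (x + y) = b x + b y" "c (x + y) = c x + c y" "d (x + y) = d x + d y"
    for x y using assms(1) unfolding coords_def by auto
  have ex: "\<exists>x. a x = i \<and> b x = j \<and> c x = k \<and> d x = l" for i j k l
    using assms(1) unfolding coords_def by blast
  have inj: "x = y" if "a x = a y" "b x = b y" "c x = c y" "d x = d y" for x y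
  proof -
    have "a (x - y) = 0" "b (x - y) = 0" "c (x - y) = 0" "d (x - y) = 0"
      using that add'[of "x - y" y] by auto
    then have "x - y = 0" using assms(1) unfolding coords_def by blast
    then show ?thesis by simp
  qed
  define e where "e i j k l = (SOME x. a x = i \<and> b x = j \<and> c x = k \<and> d x = l)" for i j k l
  have e: "a (e i j k l) = i" "b (e i j k l) = j" "c (e i j k l) = k" "d (e i j k l) = l" for i j k l
    using someI_ex[OF ex[of i j k l]] unfolding e_def by auto
  have e_add: "h (e (i + i') (j + j') (k + k') (l + l')) = h (e i j k l) + h (e i' j' k' l')" for i i' j j' k k' l l'
  proof -
    have "e (i + i') (j + j') (k + k') (l + l') = e i j k l + e i' j' k' l'"
      by (rule inj) (simp_all add: e add')
    then show ?thesis by (simp add: h)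
  qed
  have "h x = h (e 1 0 0 0) * a x + h (e 0 1 0 0) * b x + h (e 0 0 1 0) * c x + h (e 0 0 0 1) * d x" for x
  proof -
    have "x = e (a x) (b x) (c x) (d x)" by (rule inj) (simp_all add: e)
    then have "h x = h (e (a x) (b x) (c x) (d x))" by simp
    also have "\<dots> = h (e (a x) 0 0 0) + h (e 0 (b x) 0 0) + h (e 0 0 (c x) 0) + h (e 0 0 0 (d x))"
      using e_add[of "a x" 0 "b x" 0 "c x" 0 0 "d x"] e_add[of "a x" 0 "b x" 0 0 "c x" 0 0]
        e_add[of "a x" 0 0 "b x" 0 0 0 0] by simp
    also have "h (e (a x) 0 0 0) = a x * h (e 1 0 0 0)"
      by (rule additive_int) (use e_add[of _ _ 0 0 0 0 0 0] in simp)
    also have "h (e 0 (b x) 0 0) = b x * h (e 0 1 0 0)"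
      by (rule additive_int) (use e_add[of 0 0 _ _ 0 0 0 0] in simp)
    also have "h (e 0 0 (c x) 0) = c x * h (e 0 0 1 0)"
      by (rule additive_int) (use e_add[of 0 0 0 0 _ _ 0 0] in simp)
    also have "h (e 0 0 0 (d x)) = d x * h (e 0 0 0 1)"
      by (rule additive_int) (use e_add[of 0 0 0 0 0 0 _ _] in simp)
    finally show ?thesis by (simp add: mult.commute)
  qed
  then show thesis by (rule that)
qed

text \<open>
  The vector \<open>z\<close> with coordinates \<open>(i, j, k, l)\<close> spans the common zero set of the functionals that
  vanish on it, so the vector that regularity provides is a nonzero multiple of \<open>z\<close>.  As its values
  are at most 1 in modulus, so are those of \<open>z\<close>.  All forbidden configurations below are
  found by exhibiting such a vector with a value of modulus 2.
\<close>

lemma frame_test: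
  assumes fr: "frame a b c d" and nz: "i \<noteq> 0 \<or> j \<noteq> 0 \<or> k \<noteq> 0 \<or> l \<noteq> 0"
    and line: "\<And>i' j' k' l'. (\<And>p q r s. comb a b c d p q r s \<Longrightarrow> p * i + q * j + r * k + s * l = 0
           \<Longrightarrow> p * i' + q * j' + r * k' + s * l' = 0)
         \<Longrightarrow> \<exists>t. i' = t * i \<and> j' = t * j \<and> k' = t * k \<and> l' = t * l"
    and pqrs: "comb a b c d p q r s"
  shows "\<bar>p * i + q * j + r * k + s * l\<bar> \<le> 1"
proof -
  have F0: "f 0 = 0" if "f \<in> F" for f using add[OF that, of 0 0] by simp
  have abcd: "a \<in> F" "b \<in> F" "c \<in> F" "d \<in> F" and co: "coords a b c d"
    using fr unfolding frame_def by auto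
  obtain z where z: "a z = i" "b z = j" "c z = k" "d z = l"
    using co unfolding coords_def by meson
  have "z \<noteq> 0" using nz z F0 abcd by auto
  then obtain y where y: "y \<noteq> 0" "\<And>f. f \<in> F \<Longrightarrow> f y \<in> {-1, 0, 1}" "\<And>f. f \<in> F \<Longrightarrow> f z = 0 \<Longrightarrow> f y = 0"
    using conformal by meson
  have "\<exists>t. a y = t * i \<and> b y = t * j \<and> c y = t * k \<and> d y = t * l"
  proof (rule line)
    fix p q r s assume "comb a b c d p q r s" "p * i + q * j + r * k + s * l = 0"
    then show "p * a y + q * b y + r * c y + s * d y = 0"
      using y(3)[of "\<lambda>x. p * a x + q * b x + r * c x + s * d x"] z unfolding comb_def by simp
  qed
  then obtain t where t: "a y = t * i" "b y = t * j" "c y = t * k" "d y = t * l" by blast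
  have "t \<noteq> 0"
  proof
    assume "t = 0"
    then have "a y = 0 \<and> b y = 0 \<and> c y = 0 \<and> d y = 0" using t by simp
    then show False using co y(1) unfolding coords_def by blast
  qed
  have "p * a y + q * b y + r * c y + s * d y = t * (p * i + q * j + r * k + s * l)"
    by (simp add: t algebra_simps)
  moreover have "\<bar>p * a y + q * b y + r * c y + s * d y\<bar> \<le> 1"
    using y(2) pqrs unfolding comb_def by fastforce
  ultimately have "\<bar>t\<bar> * \<bar>p * i + q * j + r * k + s * l\<bar> \<le> 1" by (simp add: abs_mult)
  moreover have "\<bar>p * i + q * j + r * k + s * l\<bar> \<le> \<bar>t\<bar> * \<bar>p * i + q * j + r * k + s * l\<bar>"
    using \<open>t \<noteq> 0\<close> mult_right_mono[of 1 "\<bar>t\<bar>" "\<bar>p * i + q * j + r * k + s * l\<bar>"] by simp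
  ultimately show ?thesis by (rule order_trans[rotated])
qed

lemma frame_test3:
  assumes "frame a b c d" "comb a b c d p q r s"
    and "comb a b c d p1 q1 r1 s1" "comb a b c d p2 q2 r2 s2" "comb a b c d p3 q3 r3 s3"
    and "p1 * i + q1 * j + r1 * k + s1 * l = 0" "p2 * i + q2 * j + r2 * k + s2 * l = 0"
      "p3 * i + q3 * j + r3 * k + s3 * l = 0"
    and "i \<noteq> 0 \<or> j \<noteq> 0 \<or> k \<noteq> 0 \<or> l \<noteq> 0"
    and "\<And>i' j' k' l'. p1 * i' + q1 * j' + r1 * k' + s1 * l' = 0 \<Longrightarrow>
      p2 * i' + q2 * j' + r2 * k' + s2 * l' = 0 \<Longrightarrow> p3 * i' + q3 * j' + r3 * k' + s3 * l' = 0 \<Longrightarrow>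
      \<exists>t. i' = t * i \<and> j' = t * j \<and> k' = t * k \<and> l' = t * l"
  shows "\<bar>p * i + q * j + r * k + s * l\<bar> \<le> 1"
  using assms by (intro frame_test[OF assms(1,9) _ assms(2)]) blast

lemma frame_units:
  assumes "frame a b c d"
  shows "comb a b c d 1 0 0 0" "comb a b c d 0 1 0 0" "comb a b c d 0 0 1 0" "comb a b c d 0 0 0 1"
  using assms unfolding frame_def comb_def by auto

lemma comb_unit_bound:
  assumes "frame a b c d" "comb a b c d p q r s"
  shows "\<bar>p\<bar> \<le> 1" "\<bar>q\<bar> \<le> 1" "\<bar>r\<bar> \<le> 1" "\<bar>s\<bar> \<le> 1"
proof -
  note u = frame_units[OF assms(1)]
  show "\<bar>p\<bar> \<le> 1"
    using frame_test3[OF assms u(2,3,4), of 1 0 0 0] by simp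
  show "\<bar>q\<bar> \<le> 1"
    using frame_test3[OF assms u(1,3,4), of 0 1 0 0] by simp
  show "\<bar>r\<bar> \<le> 1"
    using frame_test3[OF assms u(1,2,4), of 0 0 1 0] by simp
  show "\<bar>s\<bar> \<le> 1"
    using frame_test3[OF assms u(1,2,3), of 0 0 0 1] by simp
qed

lemma frame_expand:
  assumes "frame a b c d" "h \<in> F"
  obtains p q r s where "comb a b c d p q r s" "\<And>x. h x = p * a x + q * b x + r * c x + s * d x"
proof -
  obtain p q r s where "\<And>x. h x = p * a x + q * b x + r * c x + s * d x"
    using coords_linear[of a b c d h] assms add unfolding frame_def by metis
  with combI[OF assms(2)] that show thesis by blast
qed

lemma frame_swap12: "frame a b c d \<Longrightarrow> frame b a c d"
  unfolding frame_def coords_def by (auto; metis)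

lemma frame_rotate: "frame a b c d \<Longrightarrow> frame b c d a"
  unfolding frame_def coords_def by (auto; metis)

lemma frame_swaps:
  assumes "frame a b c d"
  shows "frame b a c d" "frame c b a d" "frame d b c a" "frame a c b d" "frame a d c b" "frame a b d c"
  using assms by (meson frame_swap12 frame_rotate)+

lemma comb_swaps:
  "comb b a c d q p r s = comb a b c d p q r s"
  "comb c b a d r q p s = comb a b c d p q r s"
  "comb d b c a s q r p = comb a b c d p q r s"
  "comb a c b d p r q s = comb a b c d p q r s"
  "comb a d c b p s r q = comb a b c d p q r s"
  "comb a b d c p q s r = comb a b c d p q r s"
  unfolding comb_def by (simp_all only: ac_simps)

lemma frame_sign:
  assumes "frame a b c d" "t = 1 \<or> t = -1"
  shows "frame (\<lambda>x. t * a x) b c d"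
proof -
  have "(\<lambda>x. t * a x) \<in> F"
    using assms neg[of a] unfolding frame_def by auto
  moreover have "coords (\<lambda>x. t * a x) b c d"
    unfolding coords_def
  proof (intro conjI allI)
    fix i j k l
    obtain x where "a x = t * i" "b x = j" "c x = k" "d x = l"
      using assms unfolding frame_def coords_def by meson
    then have "t * a x = i \<and> b x = j \<and> c x = k \<and> d x = l"
      using assms(2) by auto
    then show "\<exists>x. t * a x = i \<and> b x = j \<and> c x = k \<and> d x = l" by blast
  qed (use assms in \<open>auto simp: frame_def coords_def algebra_simps\<close>)
  ultimately show ?thesis using assms unfolding frame_def by auto
qed

lemma frame_signs:
  assumes "frame a b c d" "t = 1 \<or> t = -1"
  shows "frame (\<lambda>x. t * a x) b c d" "frame a (\<lambda>x. t * b x) c d"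
    "frame a b (\<lambda>x. t * c x) d" "frame a b c (\<lambda>x. t * d x)"
  using frame_sign[OF assms] frame_swaps(1)[OF frame_sign[OF frame_swaps(1)[OF assms(1)] assms(2)]]
    frame_swaps(2)[OF frame_sign[OF frame_swaps(2)[OF assms(1)] assms(2)]]
    frame_swaps(3)[OF frame_sign[OF frame_swaps(3)[OF assms(1)] assms(2)]]
  by simp_all

lemma comb_signs:
  "comb (\<lambda>x. t * a x) b c d p q r s = comb a b c d (t * p) q r s"
   "comb a (\<lambda>x. t * b x) c d p q r s = comb a b c d p (t * q) r s"
   "comb a b (\<lambda>x. t * c x) d p q r s = comb a b c d p q (t * r) s"
   "comb a b c (\<lambda>x. t * d x) p q r s = comb a b c d p q r (t * s)"
proof -
  have "m * (t * y) = t * m * y" for m y :: int by simp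
  then show "comb (\<lambda>x. t * a x) b c d p q r s = comb a b c d (t * p) q r s"
   "comb a (\<lambda>x. t * b x) c d p q r s = comb a b c d p (t * q) r s"
   "comb a b (\<lambda>x. t * c x) d p q r s = comb a b c d p q (t * r) s"
   "comb a b c (\<lambda>x. t * d x) p q r s = comb a b c d p q r (t * s)"
    unfolding comb_def by (simp_all only:)
qed

lemma frame_pivot:
  assumes "frame a b c d" "comb a b c d 1 1 0 0"
  shows "frame (\<lambda>x. a x + b x) b c d"
proof -
  have "(\<lambda>x. a x + b x) \<in> F" using assms(2) unfolding comb_def by simp
  moreover have "coords (\<lambda>x. a x + b x) b c d"
    unfolding coords_def
  proof (intro conjI allI)
    fix i j k l
    obtain x where "a x = i - j" "b x = j" "c x = k" "d x = l"
      using assms unfolding frame_def coords_def by meson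
    then have "a x + b x = i \<and> b x = j \<and> c x = k \<and> d x = l" by simp
    then show "\<exists>x. a x + b x = i \<and> b x = j \<and> c x = k \<and> d x = l" by blast
  qed (use assms in \<open>auto simp: frame_def coords_def algebra_simps\<close>)
  ultimately show ?thesis using assms unfolding frame_def by auto
qed

lemma comb_pivot: "comb (\<lambda>x. a x + b x) b c d p q r s = comb a b c d p (p + q) r s"
  unfolding comb_def by (simp add: algebra_simps)

text \<open>
  The members of \<open>F\<close> are sums of consecutive frame elements; partial sums of the frame are
  potentials for them.
\<close>

lemma graphic_if_intervals:
  assumes fr: "frame a b c d"
    and ival: "\<And>p q r s. comb a b c d p q r s \<Longrightarrow>
      ({p, q, r, s} \<subseteq> {0, 1} \<or> {p, q, r, s} \<subseteq> {0, -1}) \<and> (p \<noteq> 0 \<and> r \<noteq> 0 \<longrightarrow> q \<noteq> 0) \<and>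
      (q \<noteq> 0 \<and> s \<noteq> 0 \<longrightarrow> r \<noteq> 0) \<and> (p \<noteq> 0 \<and> s \<noteq> 0 \<longrightarrow> q \<noteq> 0 \<and> r \<noteq> 0)"
  shows graphic
proof -
  let ?p = a and ?q = "\<lambda>x. a x + b x" and ?r = "\<lambda>x. a x + b x + c x" and ?s = "\<lambda>x. a x + b x + c x + d x"
  have "coords ?p ?q ?r ?s"
    unfolding coords_def
  proof (intro conjI allI)
    fix i j k l
    obtain x where "a x = i" "b x = j - i" "c x = k - j" "d x = l - k"
      using fr unfolding frame_def coords_def by meson
    then have "?p x = i \<and> ?q x = j \<and> ?r x = k \<and> ?s x = l" by simp
    then show "\<exists>x. ?p x = i \<and> ?q x = j \<and> ?r x = k \<and> ?s x = l" by blast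
  qed (use fr in \<open>auto simp: frame_def coords_def algebra_simps\<close>)
  moreover have "\<exists>f\<in>{\<lambda>_. 0, ?p, ?q, ?r, ?s}. \<exists>g\<in>{\<lambda>_. 0, ?p, ?q, ?r, ?s}. \<forall>x. h x = f x - g x" if hF: "h \<in> F" for h
  proof -
    obtain p q r s where "comb a b c d p q r s" and h: "\<And>x. h x = p * a x + q * b x + r * c x + s * d x"
      using frame_expand[OF fr hF] by metis
    from ival[OF this(1)] have "p = 0 \<or> p = 1 \<or> p = -1" "q = 0 \<or> q = 1 \<or> q = -1"
      "r = 0 \<or> r = 1 \<or> r = -1" "s = 0 \<or> s = 1 \<or> s = -1" by auto
    with ival[OF \<open>comb a b c d p q r s\<close>] show ?thesis
      by (elim disjE; simp add: h)
  qed
  ultimately show ?thesis unfolding graphic_def by blast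
qed

end

section \<open>Systems with a functional of full support\<close>

lemma five_complete3:
  fixes x y z :: nat
  assumes "distinct [x, y, z]" "{x, y, z} \<subseteq> {..<5}"
  obtains v w where "distinct [x, y, z, v, w]" "{x, y, z, v, w} = {..<5}"
proof -
  have "card ({..<5} - {x, y, z}) = 2" using assms by (subst card_Diff_subset) auto
  then obtain v w where vw: "{..<5} - {x, y, z} = {v, w}" "v \<noteq> w" by (auto simp: card_2_iff)
  then have "v \<in> {..<5} - {x, y, z}" "w \<in> {..<5} - {x, y, z}" by simp_all
  moreover have "{..<5} = {x, y, z} \<union> ({..<5} - {x, y, z})" using assms(2) by auto
  then have "{x, y, z, v, w} = {..<5}" unfolding vw(1) by (simp add: insert_commute)
  moreover have "distinct [x, y, z, v, w]" using calculation(1,2) assms(1) vw(2) by auto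
  ultimately show thesis by (intro that)
qed

text \<open>
  A graph on five vertices of maximal degree two without triangles is a union of paths or contains
  a cycle of length four or five.  Unless it contains a 4-cycle, it embeds in a pentagon.
\<close>

lemma five_vertex_graph:
  fixes E :: "nat \<Rightarrow> nat \<Rightarrow> bool"
  assumes sym: "\<And>i j. E i j \<Longrightarrow> E j i"
    and tri: "\<And>i j k. distinct [i, j, k] \<Longrightarrow> {i, j, k} \<subseteq> {..<5} \<Longrightarrow> E i j \<Longrightarrow> E j k \<Longrightarrow> \<not> E i k"
    and claw: "\<And>i j k l. distinct [i, j, k, l] \<Longrightarrow> {i, j, k, l} \<subseteq> {..<5} \<Longrightarrow> E i j \<Longrightarrow> E i k \<Longrightarrow> \<not> E i l"
  obtains (pentagon) i j k l m where "distinct [i, j, k, l, m]" "{i, j, k, l, m} = {..<5}"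
      "\<not> E i k" "\<not> E j l" "\<not> E k m" "\<not> E i l" "\<not> E j m"
    | (square) i j k l m where "distinct [i, j, k, l, m]" "{i, j, k, l, m} = {..<5}"
      "E i j" "E j k" "E k l" "E i l"
proof -
  show thesis
  proof (cases "\<exists>x y z. distinct [x, y, z] \<and> {x, y, z} \<subseteq> {..<5} \<and> E x y \<and> E y z")
    case True
    then obtain x y z where xyz: "distinct [x, y, z]" "{x, y, z} \<subseteq> {..<5}" "E x y" "E y z" by blast
    obtain v w where vw: "distinct [x, y, z, v, w]" "{x, y, z, v, w} = {..<5}"
      using five_complete3[OF xyz(1,2)] by blast
    have sub: "x < 5" "y < 5" "z < 5" "v < 5" "w < 5" using vw(2) by auto
    have "\<not> E x z" using tri[of x y z] xyz by blast
    moreover have "\<not> E y v" using claw[of y x z v] xyz sub vw sym by auto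
    moreover have "\<not> E y w" using claw[of y x z w] xyz sub vw sym by auto
    moreover have "\<not> (E x v \<and> E x w)" using claw[of x y v w] xyz sub vw sym by auto
    moreover have "\<not> (E z v \<and> E z w)" using claw[of z y v w] xyz sub vw sym by auto
    ultimately consider "E z v" "E x v" | "E z w" "E x w"
      | "\<not> E x z" "\<not> E y v" "\<not> E y w" "\<not> E x w" "\<not> E z v"
      | "\<not> E x z" "\<not> E y v" "\<not> E y w" "\<not> E x v" "\<not> E z w" by blast
    then show thesis
    proof cases
      case 1
      then show ?thesis using square[of x y z v w] vw xyz by blast
    next
      case 2
      then show ?thesis using square[of x y z w v] vw xyz by auto
    next
      case 3
      have "distinct [x, y, z, w, v]" "{x, y, z, w, v} = {..<5}" using vw by auto
      with 3 show ?thesis using pentagon[of x y z w v] by blast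
    next
      case 4
      with vw show ?thesis using pentagon[of x y z v w] by blast
    qed
  next
    case False
    then have match: "\<not> E y z" if "E x y" "distinct [x, y, z]" "{x, y, z} \<subseteq> {..<5}" for x y z
      using that by blast
    show thesis
    proof (cases "\<exists>x y. x \<noteq> y \<and> x < 5 \<and> y < 5 \<and> E x y")
      case True
      then obtain x y where xy: "x \<noteq> y" "x < 5" "y < 5" "E x y" by blast
      have "card ({..<5} - {x, y}) = 3" using xy by (subst card_Diff_subset) auto
      then obtain u v w where uvw: "{..<5} - {x, y} = {u, v, w}" "u \<noteq> v" "u \<noteq> w" "v \<noteq> w"
        by (auto simp: card_3_iff)
      then have mem: "u \<in> {..<5} - {x, y}" "v \<in> {..<5} - {x, y}" "w \<in> {..<5} - {x, y}" by auto
      have "{..<5} = {x, y} \<union> ({..<5} - {x, y})" using xy by auto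
      then have all: "{x, y, u, v, w} = {..<5}" unfolding uvw(1) by (simp add: insert_commute)
      have no: "\<not> E x t" "\<not> E y t" if "t \<in> {u, v, w}" for t
      proof -
        have t: "t < 5" "t \<noteq> x" "t \<noteq> y" using that uvw(1) by auto
        show "\<not> E y t" using match[of x y t] xy t by simp
        show "\<not> E x t" using match[of y x t] xy t sym[OF xy(4)] by simp
      qed
      have lt: "u < 5" "v < 5" "w < 5" using mem by auto
      have "\<not> (E u v \<and> E u w)" using match[of v u w] sym[of u v] uvw(2-4) lt by auto
      moreover have "\<not> (E u v \<and> E v w)" using match[of u v w] uvw(2-4) lt by auto
      moreover have "\<not> (E u w \<and> E v w)" using match[of u w v] sym[of v w] uvw(2-4) lt by auto
      ultimately consider (1) "\<not> E u w" "\<not> E v w" | (2) "\<not> E u v" "\<not> E u w" | (3) "\<not> E u v" "\<not> E v w"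
        by blast
      then show thesis
      proof cases
        case 1
        have "distinct [x, y, u, v, w]" "{x, y, u, v, w} = {..<5}" using xy(1) uvw(2-4) mem all by auto
        then show ?thesis by (rule pentagon) (use 1 no in auto)
      next
        case 2
        have "distinct [x, y, v, w, u]" "{x, y, v, w, u} = {..<5}" using xy(1) uvw(2-4) mem all by auto
        then show ?thesis by (rule pentagon) (use 2 no sym in auto)
      next
        case 3
        have "distinct [x, y, u, w, v]" "{x, y, u, w, v} = {..<5}" using xy(1) uvw(2-4) mem all by auto
        then show ?thesis by (rule pentagon) (use 3 no sym in auto)
      qed
    next
      case False
      then have no: "\<not> E x y" if "x \<noteq> y" "x < 5" "y < 5" for x y using that by blast
      have "{0, 1, 2, 3, 4} = {..<5::nat}" by auto
      then show ?thesis by (intro pentagon[of 0 1 2 3 4]) (simp_all add: no)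
    qed
  qed
qed

context regular_functionals
begin

text \<open>
  Five functionals with sum zero, any four of which form a frame.  This is the symmetric description
  of a frame whose sum lies in \<open>F\<close>.
\<close>

definition five_frame :: "(nat \<Rightarrow> 'l \<Rightarrow> int) \<Rightarrow> bool" where
  "five_frame u \<longleftrightarrow> (\<forall>i<5. u i \<in> F) \<and> (\<forall>x. (\<Sum>i<5. u i x) = 0) \<and>
     (\<forall>v. (\<Sum>i<5. v i) = 0 \<longrightarrow> (\<exists>x. \<forall>i<5. u i x = v i)) \<and> (\<forall>x. (\<forall>i<5. u i x = 0) \<longrightarrow> x = 0)"

lemma five_frame_exists:
  assumes fr: "frame a b c d" and sum: "comb a b c d 1 1 1 1"
  shows "five_frame (\<lambda>i. [a, b, c, d, \<lambda>x. - (a x + b x + c x + d x)] ! i)" (is "five_frame ?u")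
proof -
  have less5: "(\<forall>i<5. P i) \<longleftrightarrow> P 0 \<and> P 1 \<and> P 2 \<and> P 3 \<and> P (4::nat)" for P
    by (auto simp: less_Suc_eq numeral_eq_Suc)
  have sum5: "(\<Sum>i<5. v i) = v 0 + v 1 + v 2 + v 3 + v (4::nat)" for v :: "nat \<Rightarrow> int"
    by (simp add: numeral_eq_Suc)
  have "(\<lambda>x. - (a x + b x + c x + d x)) \<in> F" using neg sum unfolding comb_def by fastforce
  then have "\<forall>i<5. ?u i \<in> F" using fr unfolding less5 frame_def by simp
  moreover have "\<forall>x. (\<Sum>i<5. ?u i x) = 0" unfolding sum5 by simp
  moreover have "\<exists>x. \<forall>i<5. ?u i x = v i" if v: "(\<Sum>i<5. v i) = 0" for v :: "nat \<Rightarrow> int"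
  proof -
    obtain x where "a x = v 0" "b x = v 1" "c x = v 2" "d x = v 3"
      using fr unfolding frame_def coords_def by meson
    then have "\<forall>i<5. ?u i x = v i" using v unfolding less5 sum5 by simp
    then show ?thesis by blast
  qed
  moreover have "\<forall>x. (\<forall>i<5. ?u i x = 0) \<longrightarrow> x = 0"
    using fr unfolding less5 frame_def coords_def by simp
  ultimately show ?thesis unfolding five_frame_def by blast
qed

lemma five_frameD:
  assumes ff: "five_frame u" and dist: "distinct [i, j, k, l, m]" and all: "{i, j, k, l, m} = {..<5}"
  shows "frame (u i) (u j) (u k) (u l)" and "u m x = - (u i x + u j x + u k x + u l x)"
proof -
  have sum5: "(\<Sum>n<5. v n) = v i + v j + v k + v l + v m" for v :: "nat \<Rightarrow> int"
    unfolding all[symmetric] using dist by simp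
  have less5: "(\<forall>n<5. P n) \<longleftrightarrow> P i \<and> P j \<and> P k \<and> P l \<and> P m" for P
    using all by (metis (no_types, lifting) insert_iff lessThan_iff singletonD)
  have *: "\<forall>n<5. u n \<in> F" "\<forall>x. (\<Sum>n<5. u n x) = 0" "\<And>v :: nat \<Rightarrow> int. (\<Sum>n<5. v n) = 0 \<Longrightarrow> \<exists>x. \<forall>n<5. u n x = v n"
    "\<And>x. (\<forall>n<5. u n x = 0) \<Longrightarrow> x = 0"
    using ff unfolding five_frame_def by fast+
  show m: "u m x = - (u i x + u j x + u k x + u l x)" for x using *(2) unfolding sum5 by (smt (verit))
  have "coords (u i) (u j) (u k) (u l)"
    unfolding coords_def
  proof (intro conjI allI)
    fix p q r s :: int
    define v where "v = (\<lambda>n. if n = i then p else if n = j then q else if n = k then r else if n = l then s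
      else - (p + q + r + s))"
    have v: "v i = p" "v j = q" "v k = r" "v l = s" "v m = - (p + q + r + s)"
      using dist unfolding v_def by auto
    have "(\<Sum>n<5. v n) = 0" unfolding sum5 v by simp
    from *(3)[OF this] show "\<exists>x. u i x = p \<and> u j x = q \<and> u k x = r \<and> u l x = s"
      unfolding less5 v by blast
  next
    show "u i x = 0 \<and> u j x = 0 \<and> u k x = 0 \<and> u l x = 0 \<longrightarrow> x = 0" for x
      using *(4)[of x] unfolding less5 m by simp
  next
    show "\<forall>f\<in>{u i, u j, u k, u l}. \<forall>x y. f (x + y) = f x + f y"
      using *(1) add unfolding less5 by auto
  qed
  then show "frame (u i) (u j) (u k) (u l)"
    using *(1) unfolding less5 frame_def by simp
qed

text \<open>
  The vectors with values $1$ and $-1$ on two members of a five-frame and $0$ on the others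
  are test vectors.  Hence a member of \<open>F\<close> takes at most two values, which are adjacent, as a
  labelling of the five members, and is up to sign the sum of at most two of them.
\<close>

lemma full_support_coeffs:
  assumes fr: "frame a b c d" and sum: "comb a b c d 1 1 1 1" and pqrs: "comb a b c d p q r s"
  shows "{p, q, r, s} \<subseteq> {0, 1} \<or> {p, q, r, s} \<subseteq> {0, -1}"
proof -
  note u = frame_units[OF fr] sum
  note t = frame_test3[OF fr pqrs]
  have "\<bar>p - q\<bar> \<le> 1" using t[OF u(3,4,5), of 1 "-1" 0 0] by simp
  moreover have "\<bar>p - r\<bar> \<le> 1" using t[OF u(2,4,5), of 1 0 "-1" 0] by simp
  moreover have "\<bar>p - s\<bar> \<le> 1" using t[OF u(2,3,5), of 1 0 0 "-1"] by simp
  moreover have "\<bar>q - r\<bar> \<le> 1" using t[OF u(1,4,5), of 0 1 "-1" 0] by simp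
  moreover have "\<bar>q - s\<bar> \<le> 1" using t[OF u(1,3,5), of 0 1 0 "-1"] by simp
  moreover have "\<bar>r - s\<bar> \<le> 1" using t[OF u(1,2,5), of 0 0 1 "-1"] by simp
  moreover have "p = -1 \<or> p = 0 \<or> p = 1" "q = -1 \<or> q = 0 \<or> q = 1"
    "r = -1 \<or> r = 0 \<or> r = 1" "s = -1 \<or> s = 0 \<or> s = 1"
    using comb_unit_bound[OF fr pqrs] by arith+
  ultimately show ?thesis by (elim disjE; simp)
qed

lemma no_triangle:
  assumes fr: "frame a b c d" and "comb a b c d 0 1 1 0" "comb a b c d 1 0 1 0" "comb a b c d 1 1 0 0"
  shows False
proof -
  have "\<bar>1 * 1 + 1 * 1 + 0 * (-1) + 0 * (0::int)\<bar> \<le> 1"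
    by (rule frame_test3[OF fr assms(4) assms(2,3) frame_units(4)[OF fr]]) presburger+
  then show False by simp
qed

lemma no_claw:
  assumes fr: "frame a b c d" and "comb a b c d 1 1 0 0" "comb a b c d 1 0 1 0" "comb a b c d 1 0 0 1"
    and sum: "comb a b c d 1 1 1 1"
  shows False
proof -
  have "\<bar>1 * 1 + 1 * (-1) + 1 * (-1) + 1 * (-1::int)\<bar> \<le> 1"
    by (rule frame_test3[OF fr sum assms(2-4)]) presburger+
  then show False by simp
qed

text \<open>
  Apart from single members of the five-frame, \<open>F\<close> consists of sums of two of them and is recorded
  by a graph on five vertices.  Test vectors exclude triangles and claws.  If this graph
  embeds in a pentagon, then the cyclic order of the pentagon displays \<open>F\<close> as intervals; if
  it is a square, then its edges are the remaining entries of a $3 \times 3$ table.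
\<close>

lemma graphic_or_tabular_full_support:
  assumes fr: "frame a b c d" and sum: "comb a b c d 1 1 1 1"
  shows "graphic \<or> tabular"
proof -
  define u where "u = (\<lambda>i. [a, b, c, d, \<lambda>x. - (a x + b x + c x + d x)] ! i)"
  have ff: "five_frame u" unfolding u_def by (rule five_frame_exists[OF fr sum])
  define E where "E i j \<longleftrightarrow> (\<lambda>x. u i x + u j x) \<in> F" for i j
  have sym: "E i j \<Longrightarrow> E j i" for i j unfolding E_def by (simp add: add.commute)
  have compl: "E i j" if "(\<lambda>x. u k x + u l x + u m x) \<in> F \<or> (\<lambda>x. - u k x - u l x - u m x) \<in> F"
    and dist: "distinct [i, k, l, m, j]" "{i, k, l, m, j} = {..<5}" for i j k l m
  proof -
    have "u i x + u j x = - (u k x + u l x + u m x)" for x using five_frameD(2)[OF ff dist, of x] by simp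
    then show ?thesis using that(1) neg unfolding E_def by fastforce
  qed
  have fr5: "frame (u i) (u j) (u k) (u l)" "comb (u i) (u j) (u k) (u l) 1 1 1 1"
    "comb (u i) (u j) (u k) (u l) 1 1 0 0 = E i j" "comb (u i) (u j) (u k) (u l) 1 0 1 0 = E i k"
    "comb (u i) (u j) (u k) (u l) 1 0 0 1 = E i l" "comb (u i) (u j) (u k) (u l) 0 1 1 0 = E j k"
    "comb (u i) (u j) (u k) (u l) 0 1 0 1 = E j l" "comb (u i) (u j) (u k) (u l) 0 0 1 1 = E k l"
    "comb (u i) (u j) (u k) (u l) 0 1 1 1 = E i m" "comb (u i) (u j) (u k) (u l) 1 0 1 1 = E j m"
    "comb (u i) (u j) (u k) (u l) 1 1 0 1 = E k m" "comb (u i) (u j) (u k) (u l) 1 1 1 0 = E l m"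
    if "distinct [i, j, k, l, m]" "{i, j, k, l, m} = {..<5}" for i j k l m
  proof -
    show "frame (u i) (u j) (u k) (u l)" by (rule five_frameD(1)[OF ff that])
    have um: "u m x = - (u i x + u j x + u k x + u l x)" for x by (rule five_frameD(2)[OF ff that])
    have "m < 5" using that by blast
    then have "u m \<in> F" using ff unfolding five_frame_def by fast
    from neg[OF this] show "comb (u i) (u j) (u k) (u l) 1 1 1 1" 
      by (rule combI) (simp add: um)
    have negiff: "(\<lambda>x. - f x) \<in> F \<longleftrightarrow> f \<in> F" for f using neg[of f] neg[of "\<lambda>x. - f x"] by auto
    show "comb (u i) (u j) (u k) (u l) 0 1 1 1 = E i m" "comb (u i) (u j) (u k) (u l) 1 0 1 1 = E j m"
     "comb (u i) (u j) (u k) (u l) 1 1 0 1 = E k m" "comb (u i) (u j) (u k) (u l) 1 1 1 0 = E l m"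
      unfolding E_def comb_def um
      using negiff[of "\<lambda>x. u j x + u k x + u l x"] negiff[of "\<lambda>x. u i x + u k x + u l x"]
        negiff[of "\<lambda>x. u i x + u j x + u l x"] negiff[of "\<lambda>x. u i x + u j x + u k x"]
      by (simp_all add: algebra_simps)
  qed (simp_all add: comb_def E_def)
  have tri: "\<not> E i k" if "distinct [i, j, k]" "{i, j, k} \<subseteq> {..<5}" "E i j" "E j k" for i j k
  proof
    assume "E i k"
    note that' = that
    obtain l m where "distinct [i, j, k, l, m]" "{i, j, k, l, m} = {..<5}" using five_complete3[OF that'(1,2)] by blast
    note f = fr5[OF this]
    show False by (rule no_triangle[OF f(1)]) (use f(3,4,6) that \<open>E i k\<close> in blast)+
  qed
  have claw: "\<not> E i l" if "distinct [i, j, k, l]" "{i, j, k, l} \<subseteq> {..<5}" "E i j" "E i k" for i j k l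
  proof
    assume "E i l"
    have "card ({..<5} - {i, j, k, l}) = 1" using that(1,2) by (subst card_Diff_subset) auto
    then obtain m where "{..<5} - {i, j, k, l} = {m}" by (auto simp: card_1_singleton_iff)
    with that(1,2) have "distinct [i, j, k, l, m]" "{i, j, k, l, m} = {..<5}" by auto
    note f = fr5[OF this]
    show False by (rule no_claw[OF f(1)]) (use f(2,3,4,5) that \<open>E i l\<close> in blast)+
  qed
  show ?thesis
  proof (rule five_vertex_graph[of E, OF sym tri claw])
    fix i j k l m
    assume dist: "distinct [i, j, k, l, m]" "{i, j, k, l, m} = {..<5}"
      and no: "\<not> E i k" "\<not> E j l" "\<not> E k m" "\<not> E i l" "\<not> E j m"
    note f = fr5[OF dist]
    have graphic
    proof (rule graphic_if_intervals[OF f(1)])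
      fix p q r s assume pqrs: "comb (u i) (u j) (u k) (u l) p q r s"
      note neg = comb_neg[OF pqrs] and co = full_support_coeffs[OF f(1,2) pqrs]
      have "\<not> (p \<noteq> 0 \<and> r \<noteq> 0 \<and> q = 0)"
        using pqrs neg co no f(4,10) by auto
      moreover have "\<not> (q \<noteq> 0 \<and> s \<noteq> 0 \<and> r = 0)"
        using pqrs neg co no f(7,11) by auto
      moreover have "\<not> (p \<noteq> 0 \<and> s \<noteq> 0 \<and> q = 0 \<and> r = 0)"
        using pqrs neg co no f(5) by auto
      ultimately show "({p, q, r, s} \<subseteq> {0, 1} \<or> {p, q, r, s} \<subseteq> {0, -1}) \<and> (p \<noteq> 0 \<and> r \<noteq> 0 \<longrightarrow> q \<noteq> 0) \<and>
          (q \<noteq> 0 \<and> s \<noteq> 0 \<longrightarrow> r \<noteq> 0) \<and> (p \<noteq> 0 \<and> s \<noteq> 0 \<longrightarrow> q \<noteq> 0 \<and> r \<noteq> 0)"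
        using co by blast
    qed
    then show ?thesis by blast
  next
    fix i j k l m
    assume dist: "distinct [i, j, k, l, m]" "{i, j, k, l, m} = {..<5}"
      and sq: "E i j" "E j k" "E k l" "E i l"
    note f = fr5[OF dist]
    have sub: "i < 5" "j < 5" "k < 5" "l < 5" "m < 5" using dist(2) by auto
    have no: "\<not> E i k" "\<not> E j l" "\<not> E i m" "\<not> E j m" "\<not> E k m" "\<not> E l m"
      using tri[of i j k] tri[of j k l] claw[of i j l m] claw[of j i k m] claw[of k j l m] claw[of l i k m]
        sq sym dist(1) sub by auto
    define T where "T = (\<lambda>n n'. [[u i, u j, \<lambda>x. - (u i x + u j x)], [u l, u k, \<lambda>x. - (u k x + u l x)],
       [\<lambda>x. - (u i x + u l x), \<lambda>x. - (u j x + u k x), \<lambda>x. u i x + u j x + u k x + u l x]] ! n ! n')"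
    have less3: "(\<forall>n<3. P n) \<longleftrightarrow> P 0 \<and> P 1 \<and> P (2::nat)" "(\<exists>n<3. P n) \<longleftrightarrow> P 0 \<or> P 1 \<or> P (2::nat)" for P
      by (auto simp: less_Suc_eq numeral_eq_Suc)
    have T: "T 0 0 = u i" "T 0 1 = u j" "T 0 2 = (\<lambda>x. - (u i x + u j x))"
       "T 1 0 = u l" "T 1 1 = u k" "T 1 2 = (\<lambda>x. - (u k x + u l x))"
       "T 2 0 = (\<lambda>x. - (u i x + u l x))" "T 2 1 = (\<lambda>x. - (u j x + u k x))" "T 2 2 = (\<lambda>x. u i x + u j x + u k x + u l x)"
      unfolding T_def by simp_all
    have "tabular"
      unfolding tabular_def table_def
    proof (intro exI[of _ T] conjI)
      show "\<forall>n<3. \<forall>n'<3. T n n' \<in> F"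
        using f(1,2) sq neg[of "\<lambda>x. u i x + u j x"] neg[of "\<lambda>x. u k x + u l x"]
          neg[of "\<lambda>x. u i x + u l x"] neg[of "\<lambda>x. u j x + u k x"]
        unfolding less3 T frame_def comb_def E_def by simp
      show "\<forall>x. \<forall>n<3. T n 0 x + T n 1 x + T n 2 x = 0"
        unfolding less3 T by simp
      show "\<forall>x. \<forall>n<3. T 0 n x + T 1 n x + T 2 n x = 0"
        unfolding less3 T by simp
      show "\<forall>x. (\<forall>n<3. \<forall>n'<3. T n n' x = 0) \<longrightarrow> x = 0"
        using f(1) unfolding less3 T frame_def coords_def by blast
      show "\<forall>h\<in>F. (\<forall>x. h x = 0) \<or> (\<exists>n<3. \<exists>n'<3. (\<forall>x. h x = T n n' x) \<or> (\<forall>x. h x = - T n n' x))"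
      proof
        fix h assume "h \<in> F"
        then obtain p q r s where pqrs: "comb (u i) (u j) (u k) (u l) p q r s"
          and h: "\<And>x. h x = p * u i x + q * u j x + r * u k x + s * u l x"
          using frame_expand[OF f(1)] by metis
        note neg = comb_neg[OF pqrs]
        have co: "{p, q, r, s} \<subseteq> {0, 1} \<or> {p, q, r, s} \<subseteq> {0, -1}"
          by (rule full_support_coeffs[OF f(1,2) pqrs])
        have no': "\<not> (p \<noteq> 0 \<and> r \<noteq> 0 \<and> (q = 0 \<or> s = 0))" "\<not> (q \<noteq> 0 \<and> s \<noteq> 0 \<and> (p = 0 \<or> r = 0))"
          using pqrs neg co no f(4,7,9-12) by auto
        show "(\<forall>x. h x = 0) \<or> (\<exists>n<3. \<exists>n'<3. (\<forall>x. h x = T n n' x) \<or> (\<forall>x. h x = - T n n' x))"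
          using co
        proof
          assume "{p, q, r, s} \<subseteq> {0, 1}"
          then have "p = 0 \<or> p = 1" "q = 0 \<or> q = 1" "r = 0 \<or> r = 1" "s = 0 \<or> s = 1" by auto
          with no' show ?thesis unfolding less3 T h by (elim disjE; simp)
        next
          assume "{p, q, r, s} \<subseteq> {0, -1}"
          then have "p = 0 \<or> p = -1" "q = 0 \<or> q = -1" "r = 0 \<or> r = -1" "s = 0 \<or> s = -1" by auto
          with no' show ?thesis unfolding less3 T h by (elim disjE; simp)
        qed
      qed
    qed
    then show ?thesis by blast
  qed
qed

end

section \<open>Classification of regular systems of rank four\<close>

context regular_functionals
begin

lemma sign_cases: "\<bar>p\<bar> \<le> 1 \<Longrightarrow> p \<noteq> 0 \<Longrightarrow> p = 1 \<or> p = (-1::int)"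
  by arith

lemma graphic_or_tabular_support4:
  assumes fr: "frame a b c d" and pqrs: "comb a b c d p q r s"
    and nz: "p \<noteq> 0" "q \<noteq> 0" "r \<noteq> 0" "s \<noteq> 0"
  shows "graphic \<or> tabular"
proof -
  note bd = comb_unit_bound[OF fr pqrs]
  have s: "p = 1 \<or> p = -1" "q = 1 \<or> q = -1" "r = 1 \<or> r = -1" "s = 1 \<or> s = -1"
    using nz bd by (auto dest: sign_cases)
  have "frame (\<lambda>x. p * a x) (\<lambda>x. q * b x) (\<lambda>x. r * c x) (\<lambda>x. s * d x)"
    by (rule frame_signs(1)[OF frame_signs(2)[OF frame_signs(3)[OF frame_signs(4)[OF fr s(4)] s(3)] s(2)] s(1)])
  moreover have "comb (\<lambda>x. p * a x) (\<lambda>x. q * b x) (\<lambda>x. r * c x) (\<lambda>x. s * d x) 1 1 1 1"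
    using pqrs by (simp add: comb_signs)
  ultimately show ?thesis by (rule graphic_or_tabular_full_support)
qed

text \<open>
  Replacing \<open>a\<close> by the second functional makes the first one have full support.
\<close>

lemma graphic_or_tabular_pivot3:
  assumes fr: "frame a b c d" and f: "comb a b c d 1 1 1 0" and g: "comb a b c d p 0 0 s"
    and nz: "p \<noteq> 0" "s \<noteq> 0"
  shows "graphic \<or> tabular"
proof -
  note bd = comb_unit_bound[OF fr g]
  \<comment> \<open>This sign makes the second functional equal to \<open>a + t * d\<close> up to sign.\<close>
  define t where "t = p * s"
  have t: "t = 1 \<or> t = -1" and ps: "p = 1 \<and> s = t \<or> p = -1 \<and> s = -t"
  proof -
    have "p = 1 \<or> p = -1" "s = 1 \<or> s = -1" using nz bd by (auto dest: sign_cases)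
    then show "t = 1 \<or> t = -1" "p = 1 \<and> s = t \<or> p = -1 \<and> s = -t"
      unfolding t_def by (elim disjE; simp)+
  qed
  let ?d = "\<lambda>x. t * d x"
  have fr': "frame a ?d c b" by (rule frame_swaps(5)[OF frame_signs(4)[OF fr t]])
  have g': "comb a ?d c b 1 1 0 0"
  proof -
    have "comb a b c d 1 0 0 t" using ps g comb_neg[OF g] by auto
    then have "comb a b c ?d 1 0 0 1" using t by (auto simp: comb_signs)
    then show ?thesis by (simp only: comb_swaps(5))
  qed
  have "comb a ?d c b 1 0 1 1"
    using f by (simp add: comb_swaps(5)[of a b c] comb_signs)
  then have "comb (\<lambda>x. a x + ?d x) ?d c b 1 (-1) 1 1"
    by (simp add: comb_pivot)
  with frame_pivot[OF fr' g'] show ?thesis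
    by (rule graphic_or_tabular_support4) auto
qed

text \<open>
  All functionals that do not fit the order \<open>c\<close>, \<open>a\<close>, \<open>b\<close>, \<open>d\<close> are excluded by a
  test vector or lead to full support after a pivot.
\<close>

lemma graphic_or_tabular_two_triples:
  assumes fr: "frame a b c d" and f: "comb a b c d 1 1 1 0" and g: "comb a b c d 1 1 0 1"
  shows "graphic \<or> tabular"
proof (rule ccontr)
  assume ng: "\<not> (graphic \<or> tabular)"
  note u = frame_units[OF fr]
  have graphic
  proof (rule graphic_if_intervals[of c a b d])
    show "frame c a b d" by (rule frame_swaps(4)[OF frame_swaps(2)[OF fr]])
    fix r p q s assume "comb c a b d r p q s"
    then have h: "comb a b c d p q r s" unfolding comb_def by (simp add: ac_simps)
    note t = frame_test3[OF fr h]
    have "\<bar>p - q\<bar> \<le> 1" using t[OF f u(3,4), of 1 "-1" 0 0] by simp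
    moreover have "\<bar>p - r\<bar> \<le> 1" using t[OF f u(2,4), of 1 0 "-1" 0] by simp
    moreover have "\<bar>q - r\<bar> \<le> 1" using t[OF f u(1,4), of 0 1 "-1" 0] by simp
    moreover have "\<bar>p - s\<bar> \<le> 1" using t[OF g u(2,3), of 1 0 0 "-1"] by simp
    moreover have "\<bar>q - s\<bar> \<le> 1" using t[OF g u(1,3), of 0 1 0 "-1"] by simp
    moreover have "\<bar>p - r - s\<bar> \<le> 1" using t[OF f g u(2), of 1 0 "-1" "-1"] by simp
    moreover have "\<bar>q - r - s\<bar> \<le> 1" using t[OF f g u(1), of 0 1 "-1" "-1"] by simp
    moreover have "\<not> (p \<noteq> 0 \<and> q \<noteq> 0 \<and> r \<noteq> 0 \<and> s \<noteq> 0 \<and> \<not> (p = q \<and> q = r \<and> r = s))"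
      using graphic_or_tabular_support4[OF fr h] ng by blast
    moreover have "\<not> (q = 0 \<and> r = 0 \<and> p \<noteq> 0 \<and> s \<noteq> 0)"
      using graphic_or_tabular_pivot3[OF fr f, of p s] h ng by blast
    moreover have "\<not> (p = 0 \<and> r = 0 \<and> q \<noteq> 0 \<and> s \<noteq> 0)"
      using graphic_or_tabular_pivot3[OF frame_swaps(1)[OF fr], of q s] f h ng
      by (auto simp: comb_swaps(1))
    moreover have "\<not> (p = 0 \<and> q = 0 \<and> r \<noteq> 0 \<and> s \<noteq> 0)"
      using graphic_or_tabular_pivot3[OF frame_swaps(2)[OF fr], of r s] f h ng
      by (auto simp: comb_swaps(2))
    moreover have "\<not> (q = 0 \<and> s = 0 \<and> p \<noteq> 0 \<and> r \<noteq> 0)"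
      using graphic_or_tabular_pivot3[OF frame_swaps(6)[OF fr], of p r] g h ng
      by (auto simp: comb_swaps(6))
    moreover have "\<not> (p = 0 \<and> s = 0 \<and> q \<noteq> 0 \<and> r \<noteq> 0)"
      using graphic_or_tabular_pivot3[OF frame_swaps(1)[OF frame_swaps(6)[OF fr]], of q r] g h ng
      by (auto simp: comb_swaps(1,6))
    moreover have "p = -1 \<or> p = 0 \<or> p = 1" "q = -1 \<or> q = 0 \<or> q = 1"
      "r = -1 \<or> r = 0 \<or> r = 1" "s = -1 \<or> s = 0 \<or> s = 1"
      using comb_unit_bound[OF fr h] by arith+
    ultimately show "({r, p, q, s} \<subseteq> {0, 1} \<or> {r, p, q, s} \<subseteq> {0, -1}) \<and> (r \<noteq> 0 \<and> q \<noteq> 0 \<longrightarrow> p \<noteq> 0) \<and>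
      (p \<noteq> 0 \<and> s \<noteq> 0 \<longrightarrow> q \<noteq> 0) \<and> (r \<noteq> 0 \<and> s \<noteq> 0 \<longrightarrow> p \<noteq> 0 \<and> q \<noteq> 0)"
      by (elim disjE; simp)
  qed
  with ng show False by blast
qed

lemma graphic_or_tabular_one_triple:
  assumes fr: "frame a b c d" and f: "comb a b c d 1 1 1 0" and no: "\<not> comb a b c d 1 0 1 0"
  shows "graphic \<or> tabular"
proof (rule ccontr)
  assume ng: "\<not> (graphic \<or> tabular)"
  note u = frame_units[OF fr]
  have two: False if h: "comb a b c d 1 1 0 s" and s: "s = 1 \<or> s = -1" 
    and fr: "frame a b c d" and f: "comb a b c d 1 1 1 0" for a b c d s
  proof -
    have "comb a b c (\<lambda>x. s * d x) 1 1 1 0" "comb a b c (\<lambda>x. s * d x) 1 1 0 1"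
      using f h s by (auto simp: comb_signs)
    with frame_signs(4)[OF fr s] ng show False
      using graphic_or_tabular_two_triples by blast
  qed
  have graphic
  proof (rule graphic_if_intervals[OF fr])
    fix p q r s assume h: "comb a b c d p q r s"
    note t = frame_test3[OF fr h] and n = comb_neg[OF h]
    have d: "\<bar>p - q\<bar> \<le> 1" using t[OF f u(3,4), of 1 "-1" 0 0] by simp
    moreover have d2: "\<bar>p - r\<bar> \<le> 1" using t[OF f u(2,4), of 1 0 "-1" 0] by simp
    moreover have d3: "\<bar>q - r\<bar> \<le> 1" using t[OF f u(1,4), of 0 1 "-1" 0] by simp
    moreover have "\<not> (p \<noteq> 0 \<and> q \<noteq> 0 \<and> r \<noteq> 0 \<and> s \<noteq> 0)"
      using graphic_or_tabular_support4[OF fr h] ng by blast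
    moreover have "\<not> (q = 0 \<and> r = 0 \<and> p \<noteq> 0 \<and> s \<noteq> 0)"
      using graphic_or_tabular_pivot3[OF fr f, of p s] h ng by blast
    moreover have "\<not> (p = 0 \<and> r = 0 \<and> q \<noteq> 0 \<and> s \<noteq> 0)"
      using graphic_or_tabular_pivot3[OF frame_swaps(1)[OF fr], of q s] f h ng
      by (auto simp: comb_swaps(1))
    moreover have "\<not> (p = 0 \<and> q = 0 \<and> r \<noteq> 0 \<and> s \<noteq> 0)"
      using graphic_or_tabular_pivot3[OF frame_swaps(2)[OF fr], of r s] f h ng
      by (auto simp: comb_swaps(2))
    moreover have val: "p = -1 \<or> p = 0 \<or> p = 1" "q = -1 \<or> q = 0 \<or> q = 1"
      "r = -1 \<or> r = 0 \<or> r = 1" "s = -1 \<or> s = 0 \<or> s = 1"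
      using comb_unit_bound[OF fr h] by arith+
    moreover have "\<not> (p = 1 \<and> q = 1 \<and> r = 0 \<and> (s = 1 \<or> s = -1))"
       "\<not> (p = -1 \<and> q = -1 \<and> r = 0 \<and> (s = 1 \<or> s = -1))"
      using two[OF _ _ fr f, of s] two[OF _ _ fr f, of "-s"] h n by auto
    moreover have "\<not> (p = 1 \<and> r = 1 \<and> q = 0 \<and> (s = 1 \<or> s = -1))"
       "\<not> (p = -1 \<and> r = -1 \<and> q = 0 \<and> (s = 1 \<or> s = -1))"
      using two[OF _ _ frame_swaps(4)[OF fr], of s] two[OF _ _ frame_swaps(4)[OF fr], of "-s"] h n f
      by (auto simp: comb_swaps(4))
    moreover have "\<not> (r = 1 \<and> q = 1 \<and> p = 0 \<and> (s = 1 \<or> s = -1))"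
       "\<not> (r = -1 \<and> q = -1 \<and> p = 0 \<and> (s = 1 \<or> s = -1))"
      using two[OF _ _ frame_swaps(2)[OF fr], of s] two[OF _ _ frame_swaps(2)[OF fr], of "-s"] h n f
      by (auto simp: comb_swaps(2))
    moreover have "\<not> (p = 1 \<and> r = 1 \<and> q = 0 \<and> s = 0)" "\<not> (p = -1 \<and> r = -1 \<and> q = 0 \<and> s = 0)"
      using h n no by auto
    ultimately show "({p, q, r, s} \<subseteq> {0, 1} \<or> {p, q, r, s} \<subseteq> {0, -1}) \<and> (p \<noteq> 0 \<and> r \<noteq> 0 \<longrightarrow> q \<noteq> 0) \<and>
      (q \<noteq> 0 \<and> s \<noteq> 0 \<longrightarrow> r \<noteq> 0) \<and> (p \<noteq> 0 \<and> s \<noteq> 0 \<longrightarrow> q \<noteq> 0 \<and> r \<noteq> 0)"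
      by (elim disjE; simp)
  qed
  with ng show False by blast
qed

text \<open>
  Not all three pairs inside the support can occur, so one of the three elements can be placed
  between the other two.
\<close>

lemma graphic_or_tabular_support3:
  assumes fr: "frame a b c d" and pqr: "comb a b c d p q r 0" and nz: "p \<noteq> 0" "q \<noteq> 0" "r \<noteq> 0"
  shows "graphic \<or> tabular"
proof -
  have s: "p = 1 \<or> p = -1" "q = 1 \<or> q = -1" "r = 1 \<or> r = -1"
    using nz comb_unit_bound[OF fr pqr] by (auto dest: sign_cases)
  let ?a = "\<lambda>x. p * a x" and ?b = "\<lambda>x. q * b x" and ?c = "\<lambda>x. r * c x"
  have fr': "frame ?a ?b ?c d"
    by (rule frame_signs(1)[OF frame_signs(2)[OF frame_signs(3)[OF fr s(3)] s(2)] s(1)])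
  have f: "comb ?a ?b ?c d 1 1 1 0" using pqr by (simp add: comb_signs)
  have "\<not> (comb ?a ?b ?c d 0 1 1 0 \<and> comb ?a ?b ?c d 1 0 1 0 \<and> comb ?a ?b ?c d 1 1 0 0)"
    using no_triangle[OF fr'] by blast
  then consider "\<not> comb ?a ?b ?c d 1 0 1 0" | "\<not> comb ?b ?a ?c d 1 0 1 0" | "\<not> comb ?a ?c ?b d 1 0 1 0"
    by (auto simp: comb_swaps(1)[of ?b ?a] comb_swaps(4)[of ?a ?c])
  then show ?thesis
  proof cases
    case 1
    with fr' f show ?thesis by (rule graphic_or_tabular_one_triple)
  next
    case 2
    show ?thesis
      by (rule graphic_or_tabular_one_triple[OF frame_swaps(1)[OF fr'] _ 2]) (use f in \<open>simp only: comb_swaps(1)\<close>)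
  next
    case 3
    show ?thesis
      by (rule graphic_or_tabular_one_triple[OF frame_swaps(4)[OF fr'] _ 3]) (use f in \<open>simp only: comb_swaps(4)\<close>)
  qed
qed

text \<open>
  Replacing the shared element by the first functional gives the second one support three.
\<close>

lemma graphic_or_tabular_path:
  assumes fr: "frame a b c d" and f: "comb a b c d p q 0 0" and g: "comb a b c d p' 0 r 0"
    and nz: "p \<noteq> 0" "q \<noteq> 0" "p' \<noteq> 0" "r \<noteq> 0"
  shows "graphic \<or> tabular"
proof -
  have s: "p = 1 \<or> p = -1" "q = 1 \<or> q = -1" "p' = 1 \<or> p' = -1" "r = 1 \<or> r = -1"
    using nz comb_unit_bound[OF fr f] comb_unit_bound[OF fr g] by (auto dest: sign_cases)
  let ?a = "\<lambda>x. p * a x" and ?b = "\<lambda>x. q * b x"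
  have fr': "frame ?a ?b c d" by (rule frame_signs(1)[OF frame_signs(2)[OF fr s(2)] s(1)])
  have f': "comb ?a ?b c d 1 1 0 0" using f by (simp add: comb_signs)
  have g': "comb ?a ?b c d (p * p') 0 r 0" using g s(1) by (auto simp: comb_signs)
  have "comb (\<lambda>x. ?a x + ?b x) ?b c d (p * p') (- (p * p')) r 0"
    using g' by (simp add: comb_pivot)
  then show ?thesis
    by (rule graphic_or_tabular_support3[OF frame_pivot[OF fr' f']]) (use nz in auto)
qed

lemma graphic_if_matching:
  assumes fr: "frame a b c d"
    and H: "\<And>p q r s. comb a b c d p q r s \<Longrightarrow> (r = 0 \<and> s = 0) \<or> (p = 0 \<and> q = 0)"
  shows graphic
proof -
  have sign: "\<exists>t. (t = 1 \<or> t = -1) \<and> (\<forall>p q. comb a b c d p q 0 0 \<longrightarrow> p \<noteq> 0 \<longrightarrow> q \<noteq> 0 \<longrightarrow> p = t * q)"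
    if fr: "frame a b c d" for a b c d
  proof (cases "\<exists>p q. comb a b c d p q 0 0 \<and> p \<noteq> 0 \<and> q \<noteq> 0")
    case True
    then obtain p q where pq: "comb a b c d p q 0 0" "p \<noteq> 0" "q \<noteq> 0" by blast
    have s: "p = 1 \<or> p = -1" "q = 1 \<or> q = -1"
      using pq(2,3) comb_unit_bound[OF fr pq(1)] by (auto dest: sign_cases)
    have "p' = (p * q) * q'" if h: "comb a b c d p' q' 0 0" "p' \<noteq> 0" "q' \<noteq> 0" for p' q'
    proof -
      have s': "p' = 1 \<or> p' = -1" "q' = 1 \<or> q' = -1"
        using h(2,3) comb_unit_bound[OF fr h(1)] by (auto dest: sign_cases)
      have "\<bar>p' * q + q' * (-p) + 0 * 0 + 0 * (0::int)\<bar> \<le> 1"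
      proof (rule frame_test3[OF fr h(1) pq(1) frame_units(3,4)[OF fr]])
        fix i j k l :: int assume "p * i + q * j + 0 * k + 0 * l = 0" "0 * i + 0 * j + 1 * k + 0 * l = 0"
          "0 * i + 0 * j + 0 * k + 1 * l = 0"
        then show "\<exists>t. i = t * q \<and> j = t * - p \<and> k = t * 0 \<and> l = t * 0"
          using s by (intro exI[of _ "q * i"]) auto
      qed (use pq in simp_all)
      then show ?thesis using s s' by auto
    qed
    then show ?thesis using s by (intro exI[of _ "p * q"]) auto
  qed auto
  obtain t where t: "t = 1 \<or> t = -1" "\<And>p q. comb a b c d p q 0 0 \<Longrightarrow> p \<noteq> 0 \<Longrightarrow> q \<noteq> 0 \<Longrightarrow> p = t * q"
    using sign[OF fr] by fast
  have fr': "frame c d a b"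
    by (rule frame_rotate[OF frame_rotate[OF fr]])
  have sw: "comb c d a b r s p q = comb a b c d p q r s" for p q r s
    unfolding comb_def by (simp add: ac_simps)
  obtain t' where t': "t' = 1 \<or> t' = -1" "\<And>p q. comb a b c d 0 0 p q \<Longrightarrow> p \<noteq> 0 \<Longrightarrow> q \<noteq> 0 \<Longrightarrow> p = t' * q"
    using sign[OF fr'] unfolding sw by fast
  show graphic
  proof (rule graphic_if_intervals)
    show "frame a (\<lambda>x. t * b x) c (\<lambda>x. t' * d x)" by (rule frame_signs(2)[OF frame_signs(4)[OF fr t'(1)] t(1)])
    fix p q r s assume "comb a (\<lambda>x. t * b x) c (\<lambda>x. t' * d x) p q r s"
    then have h: "comb a b c d p (t * q) r (t' * s)" by (simp add: comb_signs)
    have nzt: "t \<noteq> 0" "t' \<noteq> 0" "t * t = 1" "t' * t' = 1" using t(1) t'(1) by auto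
    have val: "\<bar>p\<bar> \<le> 1" "\<bar>t * q\<bar> \<le> 1" "\<bar>r\<bar> \<le> 1" "\<bar>t' * s\<bar> \<le> 1" using comb_unit_bound[OF fr h] by auto
    then have val: "\<bar>p\<bar> \<le> 1" "\<bar>q\<bar> \<le> 1" "\<bar>r\<bar> \<le> 1" "\<bar>s\<bar> \<le> 1" using t(1) t'(1) by auto
    from H[OF h] nzt have "(r = 0 \<and> s = 0) \<or> (p = 0 \<and> q = 0)" by simp
    then show "({p, q, r, s} \<subseteq> {0, 1} \<or> {p, q, r, s} \<subseteq> {0, -1}) \<and> (p \<noteq> 0 \<and> r \<noteq> 0 \<longrightarrow> q \<noteq> 0) \<and>
      (q \<noteq> 0 \<and> s \<noteq> 0 \<longrightarrow> r \<noteq> 0) \<and> (p \<noteq> 0 \<and> s \<noteq> 0 \<longrightarrow> q \<noteq> 0 \<and> r \<noteq> 0)"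
    proof
      assume z: "r = 0 \<and> s = 0"
      then have "p \<noteq> 0 \<Longrightarrow> q \<noteq> 0 \<Longrightarrow> p = t * (t * q)" using t(2)[of p "t * q"] h nzt by simp
      then have "p \<noteq> 0 \<Longrightarrow> q \<noteq> 0 \<Longrightarrow> p = q" using nzt by (simp flip: mult.assoc)
      then show ?thesis using z sign_cases[OF val(1)] sign_cases[OF val(2)] by auto
    next
      assume z: "p = 0 \<and> q = 0"
      then have "r \<noteq> 0 \<Longrightarrow> s \<noteq> 0 \<Longrightarrow> r = t' * (t' * s)" using t'(2)[of r "t' * s"] h nzt by simp
      then have "r \<noteq> 0 \<Longrightarrow> s \<noteq> 0 \<Longrightarrow> r = s" using nzt by (simp flip: mult.assoc)
      then show ?thesis using z sign_cases[OF val(3)] sign_cases[OF val(4)] by auto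
    qed
  qed
qed

text \<open>
  A functional of support three or four, or two functionals of support two that share an element, are
  covered by the previous lemmas.  What remains is a matching of the four frame elements.
\<close>

theorem graphic_or_tabular:
  assumes fr: "frame a b c d"
  shows "graphic \<or> tabular"
proof (rule ccontr)
  assume ng: "\<not> (graphic \<or> tabular)"
  have supp: "(p = 0 \<and> q = 0) \<or> (p = 0 \<and> r = 0) \<or> (p = 0 \<and> s = 0) \<or> (q = 0 \<and> r = 0) \<or> (q = 0 \<and> s = 0) \<or> (r = 0 \<and> s = 0)"
    if h: "comb a b c d p q r s" for p q r s
  proof -
    have "\<not> (p \<noteq> 0 \<and> q \<noteq> 0 \<and> r \<noteq> 0 \<and> s \<noteq> 0)" using graphic_or_tabular_support4[OF fr h] ng by blast
    moreover have "\<not> (p \<noteq> 0 \<and> q \<noteq> 0 \<and> r \<noteq> 0 \<and> s = 0)"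
      using graphic_or_tabular_support3[OF fr, of p q r] h ng by blast
    moreover have "\<not> (p \<noteq> 0 \<and> q \<noteq> 0 \<and> s \<noteq> 0 \<and> r = 0)"
      using graphic_or_tabular_support3[OF frame_swaps(6)[OF fr], of p q s] h ng by (auto simp: comb_swaps)
    moreover have "\<not> (p \<noteq> 0 \<and> s \<noteq> 0 \<and> r \<noteq> 0 \<and> q = 0)"
      using graphic_or_tabular_support3[OF frame_swaps(5)[OF fr], of p s r] h ng by (auto simp: comb_swaps)
    moreover have "\<not> (s \<noteq> 0 \<and> q \<noteq> 0 \<and> r \<noteq> 0 \<and> p = 0)"
      using graphic_or_tabular_support3[OF frame_swaps(3)[OF fr], of s q r] h ng by (auto simp: comb_swaps)
    ultimately show ?thesis by blast
  qed
  define Q where "Q f g \<longleftrightarrow> (\<exists>p q. (\<lambda>x. p * f x + q * g x) \<in> F \<and> p \<noteq> 0 \<and> q \<noteq> 0)" for f g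
  have Q_sym: "Q f g \<longleftrightarrow> Q g f" for f g
    unfolding Q_def by (subst add.commute) blast
  have path: "\<not> (Q a b \<and> Q a c)" if fr: "frame a b c d" for a b c d
  proof
    assume "Q a b \<and> Q a c"
    then obtain p q p' r where "comb a b c d p q 0 0" "comb a b c d p' 0 r 0" "p \<noteq> 0" "q \<noteq> 0" "p' \<noteq> 0" "r \<noteq> 0"
      unfolding Q_def comb_def by auto
    from graphic_or_tabular_path[OF fr this] ng show False by simp
  qed
  have matching: "Q a c \<or> Q a d \<or> Q b c \<or> Q b d" if fr: "frame a b c d" and
    supp: "\<And>p q r s. comb a b c d p q r s \<Longrightarrow> (p = 0 \<and> q = 0) \<or> (p = 0 \<and> r = 0) \<or> (p = 0 \<and> s = 0)
      \<or> (q = 0 \<and> r = 0) \<or> (q = 0 \<and> s = 0) \<or> (r = 0 \<and> s = 0)" for a b c d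
  proof (rule ccontr)
    assume no: "\<not> ?thesis"
    have "(r = 0 \<and> s = 0) \<or> (p = 0 \<and> q = 0)" if h: "comb a b c d p q r s" for p q r s
    proof (rule ccontr)
      assume "\<not> ?thesis"
      have n: "p = 0 \<or> r = 0" if "comb a b c d p 0 r 0" for p r
        using no that unfolding Q_def comb_def by simp
      have n2: "p = 0 \<or> s = 0" if "comb a b c d p 0 0 s" for p s
        using no that unfolding Q_def comb_def by simp
      have n3: "q = 0 \<or> r = 0" if "comb a b c d 0 q r 0" for q r
        using no that unfolding Q_def comb_def by simp
      have n4: "q = 0 \<or> s = 0" if "comb a b c d 0 q 0 s" for q s
        using no that unfolding Q_def comb_def by simp
      show False
        using supp[OF h] h n[of p r] n2[of p s] n3[of q r] n4[of q s] \<open>\<not> ((r = 0 \<and> s = 0) \<or> (p = 0 \<and> q = 0))\<close>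
        by auto
    qed
    with graphic_if_matching[OF fr] ng show False by blast
  qed
  have "Q a c \<or> Q a d \<or> Q b c \<or> Q b d" by (rule matching[OF fr supp])
  moreover have "Q a b \<or> Q a d \<or> Q c b \<or> Q c d"
    by (rule matching[OF frame_swaps(4)[OF fr]]) (use supp in \<open>auto simp: comb_swaps(4)\<close>)
  moreover have "Q a c \<or> Q a b \<or> Q d c \<or> Q d b"
    by (rule matching[OF frame_swaps(5)[OF fr]]) (use supp in \<open>auto simp: comb_swaps(5)\<close>)
  moreover have "\<not> (Q a b \<and> Q a c)" "\<not> (Q a b \<and> Q a d)" "\<not> (Q a c \<and> Q a d)"
    using path[OF fr] path[OF frame_swaps(6)[OF fr]] path[OF frame_swaps(6)[OF frame_swaps(4)[OF fr]]] by auto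
  moreover have "\<not> (Q b a \<and> Q b c)" "\<not> (Q b a \<and> Q b d)"
    using path[OF frame_swaps(1)[OF fr]] path[OF frame_swaps(6)[OF frame_swaps(1)[OF fr]]] by auto
  moreover have "\<not> (Q b c \<and> Q b d)" by (rule path[OF frame_rotate[OF fr]])
  moreover have "\<not> (Q c a \<and> Q c b)" "\<not> (Q c d \<and> Q c b)" "\<not> (Q c a \<and> Q c d)"
    using path[OF frame_swaps(4)[OF frame_swaps(2)[OF fr]]] path[OF frame_swaps(5)[OF frame_swaps(4)[OF frame_swaps(2)[OF fr]]]]
      path[OF frame_swaps(6)[OF frame_swaps(4)[OF frame_swaps(2)[OF fr]]]] by simp_all
  moreover have "\<not> (Q d b \<and> Q d c)" "\<not> (Q d a \<and> Q d c)" "\<not> (Q d a \<and> Q d b)"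
    using path[OF frame_swaps(3)[OF fr]] path[OF frame_swaps(5)[OF frame_swaps(3)[OF fr]]]
      path[OF frame_swaps(6)[OF frame_swaps(5)[OF frame_swaps(3)[OF fr]]]] by simp_all
  moreover note Q_sym[of a b] Q_sym[of a c] Q_sym[of a d] Q_sym[of b c] Q_sym[of b d] Q_sym[of c d]
  ultimately show False by argo
qed

end

section \<open>Sorting in the graphic case\<close>

text \<open>
  The sum of two numbers is unchanged by rounding, and rounding brings them to distance at most 1,
  which minimises their sum of squares.
\<close>

lemma div2_difference_balanced:
  fixes a a' b b' :: int
  defines "A \<equiv> a + a'" and "B \<equiv> b + b'"
  shows "(A div 2 - B div 2)\<^sup>2 + ((A - A div 2) - (B - B div 2))\<^sup>2 \<le> (a - b)\<^sup>2 + (a' - b')\<^sup>2"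
    and "\<bar>(a - b) - (a' - b')\<bar> \<ge> 2 \<Longrightarrow>
      (A div 2 - B div 2)\<^sup>2 + ((A - A div 2) - (B - B div 2))\<^sup>2 < (a - b)\<^sup>2 + (a' - b')\<^sup>2"
proof -
  define d d' where "d = (a - b) - (a' - b')" and "d' = 2 * (A div 2 - B div 2) - (A - B)"
  have e: "2 * ((a - b)\<^sup>2 + (a' - b')\<^sup>2) = (A - B)\<^sup>2 + d\<^sup>2"
    unfolding A_def B_def d_def by algebra
  have e': "2 * ((A div 2 - B div 2)\<^sup>2 + ((A - A div 2) - (B - B div 2))\<^sup>2) = (A - B)\<^sup>2 + d'\<^sup>2"
    unfolding d'_def by algebra
  have "\<bar>d'\<bar> \<le> 1" "d = 0 \<Longrightarrow> d' = 0" unfolding d_def d'_def A_def B_def by presburger+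
  then have "\<bar>d'\<bar> \<le> \<bar>d\<bar>" "\<bar>d\<bar> \<ge> 2 \<Longrightarrow> \<bar>d'\<bar> < \<bar>d\<bar>" by arith+
  then have "d'\<^sup>2 \<le> d\<^sup>2" "\<bar>d\<bar> \<ge> 2 \<Longrightarrow> d'\<^sup>2 < d\<^sup>2"
    using abs_le_square_iff[of d' d] abs_le_square_iff[of d d'] by auto
  note sq = this
  have half: "2 * X = S + D \<Longrightarrow> 2 * Y = S + D' \<Longrightarrow> D' \<le> D \<Longrightarrow> Y \<le> X"
    "2 * X = S + D \<Longrightarrow> 2 * Y = S + D' \<Longrightarrow> D' < D \<Longrightarrow> Y < X" for X Y S D D' :: int by linarith+
  show "(A div 2 - B div 2)\<^sup>2 + ((A - A div 2) - (B - B div 2))\<^sup>2 \<le> (a - b)\<^sup>2 + (a' - b')\<^sup>2"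
    by (rule half(1)[OF e e' sq(1)])
  assume "\<bar>(a - b) - (a' - b')\<bar> \<ge> 2"
  then have "d'\<^sup>2 < d\<^sup>2" by (intro sq(2)) (simp add: d_def)
  then show "(A div 2 - B div 2)\<^sup>2 + ((A - A div 2) - (B - B div 2))\<^sup>2 < (a - b)\<^sup>2 + (a' - b')\<^sup>2"
    by (rule half(2)[OF e e'])
qed

lemma additive_sum_mset:
  fixes f :: "'l::ab_group_add \<Rightarrow> int"
  assumes "\<And>x y. f (x + y) = f x + f y"
  shows "f (sum_mset M) = (\<Sum>x\<in>#M. f x)"
proof (induction M)
  case empty
  show ?case using assms[of 0 0] by simp
qed (simp add: assms)

text \<open>
  The sum exceeds \<open>size L * v\<close> by the number of elements with value \<open>v + 1\<close>, which is less than
  \<open>size L\<close>.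
\<close>

lemma sum_mset_two_values:
  fixes f :: "'a \<Rightarrow> int"
  assumes "x \<in># L" "f x = v" "\<And>y. y \<in># L \<Longrightarrow> v \<le> f y \<and> f y \<le> v + 1"
  shows "v = (\<Sum>y\<in>#L. f y) div int (size L)"
proof -
  obtain K where K: "L = add_mset x K" using assms(1) by (metis mset_add)
  have "int (size K) * v \<le> (\<Sum>y\<in>#K. f y) \<and> (\<Sum>y\<in>#K. f y) \<le> int (size K) * (v + 1)"
    using assms(3) unfolding K
  proof (induction K)
    case (add y K)
    have "v \<le> f y \<and> f y \<le> v + 1" using add.prems by simp
    moreover have "int (size K) * v \<le> (\<Sum>y\<in>#K. f y) \<and> (\<Sum>y\<in>#K. f y) \<le> int (size K) * (v + 1)"
      using add.prems by (intro add.IH) auto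
    ultimately show ?case by (simp add: algebra_simps)
  qed simp
  then have "0 \<le> (\<Sum>y\<in>#L. f y) - int (size L) * v" "(\<Sum>y\<in>#L. f y) - int (size L) * v < int (size L)"
    using assms(2) by (simp_all add: K algebra_simps)
  then show ?thesis
    by (metis add.commute add_diff_cancel_left' diff_add_cancel int_div_pos_eq mult.commute)
qed

context regular_functionals
begin

definition solutions :: "(('l \<Rightarrow> int) \<times> int) set \<Rightarrow> 'l set" where
  "solutions K = {x. \<forall>(f, c)\<in>K. c \<le> f x}"

text \<open>
  The weight is the sum of the squares of all potential differences.  When no exchange of two points for
  their rounded midpoints lowers it, any two points are comparable and differ by at most 1
  in every potential.  The least point is then determined by size and sum.
\<close>

lemma quad_connected_if_graphic:
  assumes graphic and K: "K \<subseteq> F \<times> UNIV"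
  shows "quad_connected (solutions K)"
proof -
  obtain p q r s where co: "coords p q r s" and
    diff: "\<And>h. h \<in> F \<Longrightarrow> \<exists>f\<in>{\<lambda>_. 0, p, q, r, s}. \<exists>g\<in>{\<lambda>_. 0, p, q, r, s}. \<forall>x. h x = f x - g x"
    using assms(1) unfolding graphic_def by blast
  define U where "U = {\<lambda>_. 0, p, q, r, s}"
  have finU: "finite U" unfolding U_def by simp
  have addU: "f (x + y) = f x + f y" if "f \<in> U" for f x y
    using that co unfolding U_def coords_def by auto
  have surj: "\<exists>x. p x = i \<and> q x = j \<and> r x = k \<and> s x = l" for i j k l
    using co unfolding coords_def by blast
  have inj: "x = y" if "\<And>f. f \<in> U \<Longrightarrow> f x = f y" for x y
  proof -
    have "f (x - y) = 0" if "f \<in> U" for f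
      using addU[OF that, of "x - y" y] \<open>\<And>f. f \<in> U \<Longrightarrow> f x = f y\<close>[OF that] by simp
    then have "p (x - y) = 0 \<and> q (x - y) = 0 \<and> r (x - y) = 0 \<and> s (x - y) = 0"
      unfolding U_def by simp
    then have "x - y = 0" using co unfolding coords_def by blast
    then show ?thesis by simp
  qed
  have mid: "\<exists>x' y'. x' + y' = x + y \<and> (\<forall>f\<in>U. f x' = (f x + f y) div 2 \<and> f y' = f x + f y - (f x + f y) div 2)"
    for x y
  proof -
    obtain x' where x': "p x' = (p x + p y) div 2" "q x' = (q x + q y) div 2" "r x' = (r x + r y) div 2"
      "s x' = (s x + s y) div 2" using surj by blast
    have 1: "f x' = (f x + f y) div 2" if "f \<in> U" for f using that x' unfolding U_def by auto
    have "f (x + y - x') = f x + f y - (f x + f y) div 2" if "f \<in> U" for f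
      using addU[OF that, of "x + y - x'" x'] addU[OF that, of x y] 1[OF that] by simp
    moreover have "x' + (x + y - x') = x + y" by simp
    ultimately show ?thesis using 1 by blast
  qed
  define w where "w x = (\<Sum>(f, g)\<in>U \<times> U. nat ((f x - g x)\<^sup>2))" for x
  have sorted: "(\<forall>f\<in>U. f x \<le> f y \<and> f y \<le> f x + 1) \<or> (\<forall>f\<in>U. f y \<le> f x \<and> f x \<le> f y + 1)"
    if min: "\<And>x' y'. x' \<in> solutions K \<Longrightarrow> y' \<in> solutions K \<Longrightarrow> x' + y' = x + y \<Longrightarrow> w x + w y \<le> w x' + w y'"
      and xy: "x \<in> solutions K" "y \<in> solutions K" for x y
  proof -
    obtain x' y' where xy': "x' + y' = x + y" "\<And>f. f \<in> U \<Longrightarrow> f x' = (f x + f y) div 2"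
      "\<And>f. f \<in> U \<Longrightarrow> f y' = f x + f y - (f x + f y) div 2" using mid by metis
    have "c \<le> h x' \<and> c \<le> h y'" if "(h, c) \<in> K" for h c
    proof -
      have "h \<in> F" using that K by auto
      then obtain f g where fg: "f \<in> U" "g \<in> U" "\<And>x. h x = f x - g x" using diff unfolding U_def by metis
      have "c \<le> f x - g x" "c \<le> f y - g y" using that xy fg(3) unfolding solutions_def by auto
      then show ?thesis unfolding fg(3) xy'(2)[OF fg(1)] xy'(2)[OF fg(2)] xy'(3)[OF fg(1)] xy'(3)[OF fg(2)]
        by presburger
    qed
    then have in_S: "x' \<in> solutions K" "y' \<in> solutions K" unfolding solutions_def by auto
    have le: "w x + w y \<le> w x' + w y'" by (rule min[OF in_S xy'(1)])
    have *: "nat ((f x' - g x')\<^sup>2) + nat ((f y' - g y')\<^sup>2) \<le> nat ((f x - g x)\<^sup>2) + nat ((f y - g y)\<^sup>2)"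
      "\<bar>(f x - g x) - (f y - g y)\<bar> \<ge> 2 \<Longrightarrow>
       nat ((f x' - g x')\<^sup>2) + nat ((f y' - g y')\<^sup>2) < nat ((f x - g x)\<^sup>2) + nat ((f y - g y)\<^sup>2)"
      if "f \<in> U" "g \<in> U" for f g
    proof -
      note b = div2_difference_balanced[where a = "f x" and a' = "f y" and b = "g x" and b' = "g y",
          folded xy'(2)[OF that(1)] xy'(2)[OF that(2)]]
      have y': "f y' = f x + f y - f x'" "g y' = g x + g y - g x'" using xy'(2,3) that by auto
      have N: "nat (m\<^sup>2) + nat (n\<^sup>2) = nat (m\<^sup>2 + n\<^sup>2)" for m n :: int by (simp add: nat_add_distrib)
      show "nat ((f x' - g x')\<^sup>2) + nat ((f y' - g y')\<^sup>2) \<le> nat ((f x - g x)\<^sup>2) + nat ((f y - g y)\<^sup>2)"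
        unfolding N using b(1) y' by (intro nat_mono) simp
      assume "\<bar>(f x - g x) - (f y - g y)\<bar> \<ge> 2"
      from b(2)[OF this] y'
      have "(f x' - g x')\<^sup>2 + (f y' - g y')\<^sup>2 < (f x - g x)\<^sup>2 + (f y - g y)\<^sup>2" by simp
      moreover have "0 \<le> (f x' - g x')\<^sup>2 + (f y' - g y')\<^sup>2" by simp
      ultimately show "nat ((f x' - g x')\<^sup>2) + nat ((f y' - g y')\<^sup>2) < nat ((f x - g x)\<^sup>2) + nat ((f y - g y)\<^sup>2)"
        unfolding N by linarith
    qed
    have close: "\<bar>(f x - g x) - (f y - g y)\<bar> \<le> 1" if "f \<in> U" "g \<in> U" for f g
    proof (rule ccontr)
      assume "\<not> ?thesis"
      then have ge2: "\<bar>(f x - g x) - (f y - g y)\<bar> \<ge> 2" by simp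
      have "(\<Sum>(f, g)\<in>U \<times> U. nat ((f x' - g x')\<^sup>2) + nat ((f y' - g y')\<^sup>2))
        < (\<Sum>(f, g)\<in>U \<times> U. nat ((f x - g x)\<^sup>2) + nat ((f y - g y)\<^sup>2))"
      proof (rule sum_strict_mono_ex1)
        show "\<exists>a\<in>U \<times> U. (case a of (f, g) \<Rightarrow> nat ((f x' - g x')\<^sup>2) + nat ((f y' - g y')\<^sup>2))
            < (case a of (f, g) \<Rightarrow> nat ((f x - g x)\<^sup>2) + nat ((f y - g y)\<^sup>2))"
          using *(2)[OF that ge2] that by (intro bexI[of _ "(f, g)"]) auto
      qed (use finU *(1) in auto)
      with le show False unfolding w_def by (simp add: sum.distrib case_prod_unfold)
    qed
    have "(\<lambda>_. 0) \<in> U" unfolding U_def by simp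
    from close[OF _ this] have one: "\<bar>f x - f y\<bar> \<le> 1" if "f \<in> U" for f using that by simp
    show ?thesis
    proof (rule ccontr)
      assume "\<not> ?thesis"
      then obtain f g where "f \<in> U" "g \<in> U" "\<not> (f x \<le> f y \<and> f y \<le> f x + 1)" "\<not> (g y \<le> g x \<and> g x \<le> g y + 1)"
        by blast
      with one[of f] one[of g] close[of f g] show False by arith
    qed
  qed
  have least: "\<exists>x. x \<in># L \<and> (\<forall>f\<in>U. f x = f (sum_mset L) div int (size L))"
    if L: "set_mset L \<subseteq> solutions K" "L \<noteq> {#}" and
     min: "\<And>x y x' y'. \<lbrakk>{#x, y#} \<subseteq># L; x' \<in> solutions K; y' \<in> solutions K; x' + y' = x + y\<rbrakk>
        \<Longrightarrow> w x + w y \<le> w x' + w y'" for L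
  proof -
    obtain x where x: "x \<in># L" "\<And>y. y \<in># L \<Longrightarrow> (\<Sum>f\<in>U. f x) \<le> (\<Sum>f\<in>U. f y)"
      using ex_min_if_finite[of "(\<lambda>x. \<Sum>f\<in>U. f x) ` set_mset L"] L(2) by (auto simp: not_less)
    have "f x \<le> f y \<and> f y \<le> f x + 1" if "y \<in># L" "f \<in> U" for y f
    proof (cases "y = x")
      case False
      then have "{#x, y#} \<subseteq># L" using x(1) that(1)
        by (metis insert_subset_eq_iff mset_subset_eq_single insert_DiffM insert_noteq_member)
      then have "(\<forall>f\<in>U. f x \<le> f y \<and> f y \<le> f x + 1) \<or> (\<forall>f\<in>U. f y \<le> f x \<and> f x \<le> f y + 1)"
        using sorted[of x y] min[of x y] L(1) x(1) that(1) by blast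
      then show ?thesis
      proof
        assume *: "\<forall>f\<in>U. f y \<le> f x \<and> f x \<le> f y + 1"
        have "f y = f x"
        proof (rule ccontr)
          assume "f y \<noteq> f x"
          with * that(2) have "f y < f x" by fastforce
          with * that(2) finU have "(\<Sum>f\<in>U. f y) < (\<Sum>f\<in>U. f x)" by (intro sum_strict_mono_ex1) auto
          with x(2)[OF that(1)] show False by simp
        qed
        then show ?thesis by simp
      qed (use that in blast)
    qed simp
    then have "f x = f (sum_mset L) div int (size L)" if "f \<in> U" for f
      using sum_mset_two_values[OF x(1), of f "f x"] that additive_sum_mset[of f L] addU by simp
    with x(1) show ?thesis by blast
  qed
  show ?thesis
  proof (rule quad_connectedI)
    fix M M' assume M: "M \<noteq> {#}" "set_mset M \<subseteq> solutions K" "set_mset M' \<subseteq> solutions K"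
      "size M = size M'" "sum_mset M = sum_mset M'"
    obtain L where L: "swap_equiv (solutions K) M L"
      "\<And>x y x' y'. \<lbrakk>{#x, y#} \<subseteq># L; x' \<in> solutions K; y' \<in> solutions K; x' + y' = x + y\<rbrakk> \<Longrightarrow> w x + w y \<le> w x' + w y'"
      using swap_equiv_minimal[OF M(2), of w] by metis
    obtain L' where L': "swap_equiv (solutions K) M' L'"
      "\<And>x y x' y'. \<lbrakk>{#x, y#} \<subseteq># L'; x' \<in> solutions K; y' \<in> solutions K; x' + y' = x + y\<rbrakk> \<Longrightarrow> w x + w y \<le> w x' + w y'"
      using swap_equiv_minimal[OF M(3), of w] by metis
    note inv = swap_equiv_invariants[OF L(1) M(2)] swap_equiv_invariants[OF L'(1) M(3)]
    have ne: "L \<noteq> {#}" "L' \<noteq> {#}" using inv M(1,4) by auto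
    obtain x where x: "x \<in># L" "\<forall>f\<in>U. f x = f (sum_mset L) div int (size L)"
      using least[of L] inv ne L(2) by blast
    obtain x' where x': "x' \<in># L'" "\<forall>f\<in>U. f x' = f (sum_mset L') div int (size L')"
      using least[of L'] inv ne L'(2) by blast
    have "f x = f x'" if "f \<in> U" for f using x(2) x'(2) inv M(4,5) that by auto
    then have "x = x'" by (rule inj)
    with L(1) L'(1) x x' show "\<exists>L L' x. swap_equiv (solutions K) M L \<and> swap_equiv (solutions K) M' L' \<and> x \<in># L \<and> x \<in># L'"
      by blast
  qed
qed

end

section \<open>Binary tables of size three\<close>

lemma less3:
  "(\<forall>i<3. P i) \<longleftrightarrow> P 0 \<and> P 1 \<and> P (2::nat)" "(\<exists>i<3. P i) \<longleftrightarrow> P 0 \<or> P 1 \<or> P (2::nat)"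
  by (auto simp: less_Suc_eq numeral_eq_Suc)

text \<open>
  The four entries at the intersections of two rows and two columns alternate, so that flipping them
  preserves the line sums.
\<close>

definition rectangle :: "bool \<Rightarrow> bool \<Rightarrow> bool \<Rightarrow> bool \<Rightarrow> bool" where
  "rectangle a b c d \<longleftrightarrow> a = d \<and> b = c \<and> a \<noteq> b"

definition same_count :: "bool \<Rightarrow> bool \<Rightarrow> bool \<Rightarrow> bool \<Rightarrow> bool \<Rightarrow> bool \<Rightarrow> bool" where
  "same_count a b c a' b' c' \<longleftrightarrow> (a \<and> b \<and> c \<longleftrightarrow> a' \<and> b' \<and> c') \<and> (a \<or> b \<or> c \<longleftrightarrow> a' \<or> b' \<or> c') \<and>
    (a \<and> b \<or> a \<and> c \<or> b \<and> c \<longleftrightarrow> a' \<and> b' \<or> a' \<and> c' \<or> b' \<and> c')"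

text \<open>
  Two tables with the same line sums differ by alternating cycles.  If every alternating rectangle uses
  the entry \<open>a\<close>, then so does every alternating cycle of length six, and equality at \<open>a\<close> forces
  equality everywhere.
\<close>

lemma identifying_entry_bool:
  assumes "\<not> rectangle b c e f" "\<not> rectangle b c h i" "\<not> rectangle d e g h" "\<not> rectangle d f g i" "\<not> rectangle e f h i"
    and "same_count a b c a' b' c'" "same_count d e f d' e' f'" "same_count g h i g' h' i'"
      "same_count a d g a' d' g'" "same_count b e h b' e' h'" "same_count c f i c' f' i'" "a = a'"
  shows "b = b' \<and> c = c' \<and> d = d' \<and> e = e' \<and> f = f' \<and> g = g' \<and> h = h' \<and> i = i'"
  using assms unfolding rectangle_def same_count_def by sat

definition one_of :: "bool \<Rightarrow> bool \<Rightarrow> bool \<Rightarrow> bool" where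
  "one_of a b c \<longleftrightarrow> (a \<or> b \<or> c) \<and> \<not> (a \<and> b) \<and> \<not> (a \<and> c) \<and> \<not> (b \<and> c)"

lemma rectangles_through_common_entry:
  assumes "\<not> (one_of a b c \<and> one_of d e f \<and> one_of g h i \<and> one_of a d g \<and> one_of b e h \<and> one_of c f i)"
    and "\<not> (one_of (\<not> a) (\<not> b) (\<not> c) \<and> one_of (\<not> d) (\<not> e) (\<not> f) \<and> one_of (\<not> g) (\<not> h) (\<not> i) \<and>
      one_of (\<not> a) (\<not> d) (\<not> g) \<and> one_of (\<not> b) (\<not> e) (\<not> h) \<and> one_of (\<not> c) (\<not> f) (\<not> i))"
  shows
    "\<not> rectangle b c e f \<and> \<not> rectangle b c h i \<and> \<not> rectangle d e g h \<and> \<not> rectangle d f g i \<and> \<not> rectangle e f h i \<or>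
     \<not> rectangle a c d f \<and> \<not> rectangle a c g i \<and> \<not> rectangle e d h g \<and> \<not> rectangle e f h i \<and> \<not> rectangle d f g i \<or>
     \<not> rectangle b a e d \<and> \<not> rectangle b a h g \<and> \<not> rectangle f e i h \<and> \<not> rectangle f d i g \<and> \<not> rectangle e d h g \<or>
     \<not> rectangle e f b c \<and> \<not> rectangle e f h i \<and> \<not> rectangle a b g h \<and> \<not> rectangle a c g i \<and> \<not> rectangle b c h i \<or>
     \<not> rectangle d f a c \<and> \<not> rectangle d f g i \<and> \<not> rectangle b a h g \<and> \<not> rectangle b c h i \<and> \<not> rectangle a c g i \<or>
     \<not> rectangle e d b a \<and> \<not> rectangle e d h g \<and> \<not> rectangle c b i h \<and> \<not> rectangle c a i g \<and> \<not> rectangle b a h g \<or>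
     \<not> rectangle h i e f \<and> \<not> rectangle h i b c \<and> \<not> rectangle d e a b \<and> \<not> rectangle d f a c \<and> \<not> rectangle e f b c \<or>
     \<not> rectangle g i d f \<and> \<not> rectangle g i a c \<and> \<not> rectangle e d b a \<and> \<not> rectangle e f b c \<and> \<not> rectangle d f a c \<or>
     \<not> rectangle h g e d \<and> \<not> rectangle h g b a \<and> \<not> rectangle f e c b \<and> \<not> rectangle f d c a \<and> \<not> rectangle e d b a"
  using assms unfolding rectangle_def one_of_def by argo

lemma identifying_entry:
  fixes t :: "nat \<Rightarrow> nat \<Rightarrow> int"
  assumes t: "\<forall>i<3. \<forall>j<3. t i j \<in> {0, 1}"
    and no1: "\<not> ((\<forall>i<3. t i 0 + t i 1 + t i 2 = 1) \<and> (\<forall>j<3. t 0 j + t 1 j + t 2 j = 1))"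
    and no2: "\<not> ((\<forall>i<3. t i 0 + t i 1 + t i 2 = 2) \<and> (\<forall>j<3. t 0 j + t 1 j + t 2 j = 2))"
  shows "\<exists>i<3. \<exists>j<3. \<forall>t'. (\<forall>i<3. \<forall>j<3. t' i j \<in> {0, 1}) \<longrightarrow>
     (\<forall>i<3. t' i 0 + t' i 1 + t' i 2 = t i 0 + t i 1 + t i 2) \<longrightarrow>
     (\<forall>j<3. t' 0 j + t' 1 j + t' 2 j = t 0 j + t 1 j + t 2 j) \<longrightarrow>
     t' i j = t i j \<longrightarrow> (\<forall>k<3. \<forall>l<3. t' k l = t k l)"
proof -
  define x where "x i j \<longleftrightarrow> t i j = 1" for i j
  have one: "a + b + c = 1 \<longleftrightarrow> one_of (a = 1) (b = 1) (c = 1)"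
    and two: "a + b + c = 2 \<longleftrightarrow> one_of (a \<noteq> 1) (b \<noteq> 1) (c \<noteq> 1)"
    if "a \<in> {0, 1}" "b \<in> {0, 1}" "c \<in> {0, 1}" for a b c :: int
    using that unfolding one_of_def by auto
  have same: "same_count (a' = 1) (b' = 1) (c' = 1) (a = 1) (b = 1) (c = 1)"
    if "a \<in> {0, 1}" "b \<in> {0, 1}" "c \<in> {0, 1}" "a' \<in> {0, 1}" "b' \<in> {0, 1}" "c' \<in> {0, 1}"
      "a + b + c = a' + b' + c'" for a b c a' b' c' :: int
    using that unfolding same_count_def by auto
  have t3: "t i j \<in> {0, 1}" if "i < 3" "j < 3" for i j using t that by blast
  have r1: "t i 0 + t i 1 + t i 2 = 1 \<longleftrightarrow> one_of (x i 0) (x i 1) (x i 2)"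
    "t i 0 + t i 1 + t i 2 = 2 \<longleftrightarrow> one_of (\<not> x i 0) (\<not> x i 1) (\<not> x i 2)" if "i < 3" for i
    unfolding x_def using that by (intro one two t3; simp)+
  have c1: "t 0 j + t 1 j + t 2 j = 1 \<longleftrightarrow> one_of (x 0 j) (x 1 j) (x 2 j)"
    "t 0 j + t 1 j + t 2 j = 2 \<longleftrightarrow> one_of (\<not> x 0 j) (\<not> x 1 j) (\<not> x 2 j)" if "j < 3" for j
    unfolding x_def using that by (intro one two t3; simp)+
  have lt: "0 < (3::nat)" "1 < (3::nat)" "2 < (3::nat)" by simp_all
  have no1': "\<not> (one_of (x 0 0) (x 0 1) (x 0 2) \<and> one_of (x 1 0) (x 1 1) (x 1 2) \<and> one_of (x 2 0) (x 2 1) (x 2 2)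
     \<and> one_of (x 0 0) (x 1 0) (x 2 0) \<and> one_of (x 0 1) (x 1 1) (x 2 1) \<and> one_of (x 0 2) (x 1 2) (x 2 2))"
    using no1 unfolding less3 r1(1)[OF lt(1)] r1(1)[OF lt(2)] r1(1)[OF lt(3)] c1(1)[OF lt(1)] c1(1)[OF lt(2)] c1(1)[OF lt(3)]
    by blast
  have no2': "\<not> (one_of (\<not> x 0 0) (\<not> x 0 1) (\<not> x 0 2) \<and> one_of (\<not> x 1 0) (\<not> x 1 1) (\<not> x 1 2) \<and> one_of (\<not> x 2 0) (\<not> x 2 1) (\<not> x 2 2)
     \<and> one_of (\<not> x 0 0) (\<not> x 1 0) (\<not> x 2 0) \<and> one_of (\<not> x 0 1) (\<not> x 1 1) (\<not> x 2 1) \<and> one_of (\<not> x 0 2) (\<not> x 1 2) (\<not> x 2 2))"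
    using no2 unfolding less3 r1(2)[OF lt(1)] r1(2)[OF lt(2)] r1(2)[OF lt(3)] c1(2)[OF lt(1)] c1(2)[OF lt(2)] c1(2)[OF lt(3)]
    by blast
  define det where "det i j \<longleftrightarrow> (\<forall>t'. (\<forall>i<3. \<forall>j<3. t' i j \<in> {0, 1}) \<longrightarrow>
     (\<forall>i<3. t' i 0 + t' i 1 + t' i 2 = t i 0 + t i 1 + t i 2) \<longrightarrow>
     (\<forall>j<3. t' 0 j + t' 1 j + t' 2 j = t 0 j + t 1 j + t 2 j) \<longrightarrow>
     t' i j = t i j \<longrightarrow> (\<forall>k<3. \<forall>l<3. t' k l = t k l))" for i j
  have det: "det i j" if ijs: "{i, i', i''} = {..<3}" "{j, j', j''} = {..<3}"
    and no: "\<not> rectangle (x i j') (x i j'') (x i' j') (x i' j'')" "\<not> rectangle (x i j') (x i j'') (x i'' j') (x i'' j'')"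
      "\<not> rectangle (x i' j) (x i' j') (x i'' j) (x i'' j')" "\<not> rectangle (x i' j) (x i' j'') (x i'' j) (x i'' j'')"
      "\<not> rectangle (x i' j') (x i' j'') (x i'' j') (x i'' j'')"
    for i i' i'' j j' j''
    unfolding det_def
  proof (intro allI impI)
    fix t' :: "nat \<Rightarrow> nat \<Rightarrow> int"
    fix k l :: nat
    assume t': "\<forall>i<3. \<forall>j<3. t' i j \<in> {0, 1}"
      and rows: "\<forall>i<3. t' i 0 + t' i 1 + t' i 2 = t i 0 + t i 1 + t i 2"
      and cols: "\<forall>j<3. t' 0 j + t' 1 j + t' 2 j = t 0 j + t 1 j + t 2 j"
      and eq: "t' i j = t i j" and kl: "k < 3" "l < 3"
    have t'3: "t' i j \<in> {0, 1}" if "i < 3" "j < 3" for i j using t' that by blast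
    have lt: "i < 3" "i' < 3" "i'' < 3" "j < 3" "j' < 3" "j'' < 3" using ijs by auto
    have card3: "card {..<3::nat} = 3" by simp
    have d: "distinct [i, i', i'']" "distinct [j, j', j'']"
      using ijs card3 card_distinct[of "[i, i', i'']"] card_distinct[of "[j, j', j'']"] by simp_all
    have sum3: "f 0 + f 1 + f 2 = f m + f m' + f m''" if "{m, m', m''} = {..<3}" "distinct [m, m', m'']"
      for f :: "nat \<Rightarrow> int" and m m' m''
    proof -
      have "f 0 + f 1 + f 2 = (\<Sum>n<3. f n)" by (simp add: numeral_eq_Suc)
      also have "\<dots> = f m + f m' + f m''" unfolding that(1)[symmetric] using that(2) by simp
      finally show ?thesis .
    qed
    have row: "same_count (t m j = 1) (t m j' = 1) (t m j'' = 1) (t' m j = 1) (t' m j' = 1) (t' m j'' = 1)" if "m < 3" for m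
    proof (rule same)
      show "t' m j + t' m j' + t' m j'' = t m j + t m j' + t m j''"
        using rows that sum3[OF ijs(2) d(2), of "t' m"] sum3[OF ijs(2) d(2), of "t m"] by metis
    qed (rule t3 t'3 that lt)+
    have col: "same_count (t i m = 1) (t i' m = 1) (t i'' m = 1) (t' i m = 1) (t' i' m = 1) (t' i'' m = 1)" if "m < 3" for m
    proof (rule same)
      show "t' i m + t' i' m + t' i'' m = t i m + t i' m + t i'' m"
        using cols that sum3[OF ijs(1) d(1), of "\<lambda>n. t' n m"] sum3[OF ijs(1) d(1), of "\<lambda>n. t n m"] by metis
    qed (rule t3 t'3 that lt)+
    have eqs: "(t i j' = 1) = (t' i j' = 1) \<and> (t i j'' = 1) = (t' i j'' = 1) \<and> (t i' j = 1) = (t' i' j = 1) \<and>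
      (t i' j' = 1) = (t' i' j' = 1) \<and> (t i' j'' = 1) = (t' i' j'' = 1) \<and> (t i'' j = 1) = (t' i'' j = 1) \<and>
      (t i'' j' = 1) = (t' i'' j' = 1) \<and> (t i'' j'' = 1) = (t' i'' j'' = 1)"
      by (rule identifying_entry_bool[OF no[unfolded x_def] row row row col col col]) (rule lt refl | simp add: eq)+
    have "(t m n = 1) = (t' m n = 1)" if "m \<in> {i, i', i''}" "n \<in> {j, j', j''}" for m n
      using that by (elim insertE emptyE; simp only: eqs eq)
    then have "(t k l = 1) = (t' k l = 1)" using kl unfolding ijs by simp
    then show "t' k l = t k l" using t3[OF kl] t'3[OF kl] by auto
  qed
  have perms: "{0, 1, 2} = {..<3::nat}" "{0, 2, 1} = {..<3::nat}" "{1, 0, 2} = {..<3::nat}" "{2, 1, 0} = {..<3::nat}"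
    by auto
  note D = det[OF perms(1) perms(1)] det[OF perms(1) perms(3)] det[OF perms(1) perms(4)]
    det[OF perms(3) perms(1)] det[OF perms(3) perms(3)] det[OF perms(3) perms(4)]
    det[OF perms(4) perms(1)] det[OF perms(4) perms(3)] det[OF perms(4) perms(4)]
  from rectangles_through_common_entry[OF no1' no2'] have "\<exists>i<3. \<exists>j<3. det i j"
  proof (elim disjE conjE, goal_cases)
    case 1
    from D(1)[OF 1] show ?case unfolding less3 by blast
  next
    case 2
    from D(2)[OF 2] show ?case unfolding less3 by blast
  next
    case 3
    from D(3)[OF 3] show ?case unfolding less3 by blast
  next
    case 4
    from D(4)[OF 4] show ?case unfolding less3 by blast
  next
    case 5
    from D(5)[OF 5] show ?case unfolding less3 by blast
  next
    case 6
    from D(6)[OF 6] show ?case unfolding less3 by blast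
  next
    case 7
    from D(7)[OF 7] show ?case unfolding less3 by blast
  next
    case 8
    from D(8)[OF 8] show ?case unfolding less3 by blast
  next
    case 9
    from D(9)[OF 9] show ?case unfolding less3 by blast
  qed
  then show ?thesis unfolding det_def .
qed

text \<open>
  The permutation matrices of the cyclic shifts \<open>j = i + k\<close> modulo 3.
\<close>

definition even_perm :: "nat \<Rightarrow> nat \<Rightarrow> nat \<Rightarrow> int" where
  "even_perm k i j = (if (j + 3 - i) mod 3 = k then 1 else 0)"

text \<open>
  The permutation matrices of the reflections \<open>j = k - i\<close> modulo 3.
\<close>

definition odd_perm :: "nat \<Rightarrow> nat \<Rightarrow> nat \<Rightarrow> int" where
  "odd_perm k i j = (if (i + j) mod 3 = k then 1 else 0)"

lemma perm_table_entries:
  fixes a b c d e f g h i :: int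
  assumes "a \<in> {0, 1}" "b \<in> {0, 1}" "c \<in> {0, 1}" "d \<in> {0, 1}" "e \<in> {0, 1}" "f \<in> {0, 1}"
    "g \<in> {0, 1}" "h \<in> {0, 1}" "i \<in> {0, 1}"
    and "a + b + c = 1" "d + e + f = 1" "g + h + i = 1" "a + d + g = 1" "b + e + h = 1" "c + f + i = 1"
  shows "(a, b, c, d, e, f, g, h, i) \<in> {(1,0,0,0,1,0,0,0,1), (0,1,0,0,0,1,1,0,0), (0,0,1,1,0,0,0,1,0),
     (1,0,0,0,0,1,0,1,0), (0,1,0,1,0,0,0,0,1), (0,0,1,0,1,0,1,0,0)}"
proof -
  have eqs: "c = 1 - a - b" "f = 1 - d - e" "g = 1 - a - d" "h = 1 - b - e" "i = a + b + d + e - 1"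
    using assms(10-15) by simp_all
  have "a = 0 \<or> a = 1" "b = 0 \<or> b = 1" "d = 0 \<or> d = 1" "e = 0 \<or> e = 1" using assms(1,2,4,5) by auto
  then show ?thesis using assms(3,6,7,8,9) unfolding eqs by (elim disjE; simp)
qed

lemma perm_table:
  fixes t :: "nat \<Rightarrow> nat \<Rightarrow> int"
  assumes t: "\<forall>i<3. \<forall>j<3. t i j \<in> {0, 1}"
    and "\<forall>i<3. t i 0 + t i 1 + t i 2 = 1" "\<forall>j<3. t 0 j + t 1 j + t 2 j = 1"
  shows "\<exists>k<3. (\<forall>i<3. \<forall>j<3. t i j = even_perm k i j) \<or> (\<forall>i<3. \<forall>j<3. t i j = odd_perm k i j)"
proof -
  have m: "(4::nat) mod 3 = 1" "(5::nat) mod 3 = 2" "Suc (Suc 0) mod 3 = 2" "(2::nat) mod 3 = 2" by simp_all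
  have "(t 0 0, t 0 1, t 0 2, t 1 0, t 1 1, t 1 2, t 2 0, t 2 1, t 2 2) \<in> {(1,0,0,0,1,0,0,0,1),
     (0,1,0,0,0,1,1,0,0), (0,0,1,1,0,0,0,1,0), (1,0,0,0,0,1,0,1,0), (0,1,0,1,0,0,0,0,1), (0,0,1,0,1,0,1,0,0)}"
    by (rule perm_table_entries) (use assms in \<open>simp_all only: less3 simp_thms\<close>)
  then show ?thesis
    unfolding less3 even_perm_def odd_perm_def
    by (simp only: insert_iff empty_iff prod.inject, elim disjE conjE; simp)
qed

section \<open>Balancing in the tabular case\<close>

text \<open>
  Conformality is transitive: \<open>b\<close> is what remains of \<open>c\<close> after removing a conformal part \<open>y\<close>, and
  \<open>a\<close> is conformal to \<open>b\<close>.
\<close>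

lemma sign_transfer:
  fixes a b c y :: int
  assumes "\<bar>b\<bar> = \<bar>c\<bar> - \<bar>y\<bar>" "0 \<le> b * c" "0 \<le> a * b" "b = 0 \<longrightarrow> a = 0"
  shows "0 \<le> a * c \<and> (c = 0 \<longrightarrow> a = 0)"
proof (cases b "0 :: int" rule: linorder_cases)
  case less
  then have "a \<le> 0" "c < 0" using assms by (auto simp: zero_le_mult_iff)
  then show ?thesis by (simp add: zero_le_mult_iff)
next
  case greater
  then have "0 \<le> a" "0 < c" using assms by (auto simp: zero_le_mult_iff)
  then show ?thesis by (simp add: zero_le_mult_iff)
qed (use assms in simp)

context regular_functionals
begin

text \<open>
  All nine entries are bounded below by the constraints \<open>K\<close>, and the six permutation matrices,
  shifted by these bounds, are solutions.
\<close>

definition birkhoff :: "(('l \<Rightarrow> int) \<times> int) set \<Rightarrow> bool" where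
  "birkhoff K \<longleftrightarrow> (\<exists>T n e o'. table T \<and> (\<forall>i<3. \<forall>j<3. (T i j, n i j) \<in> K) \<and>
     (\<forall>k<3. e k \<in> solutions K \<and> o' k \<in> solutions K \<and>
        (\<forall>i<3. \<forall>j<3. T i j (e k) - n i j = even_perm k i j \<and> T i j (o' k) - n i j = odd_perm k i j)))"

lemma F_diff: "f \<in> F \<Longrightarrow> f (x - y) = f x - f y"
  using add[of f "x - y" y] by simp

lemma F_zero: "f \<in> F \<Longrightarrow> f 0 = 0"
  using add[of f 0 0] by simp

lemma table_uminus:
  assumes "table T"
  shows "table (\<lambda>i j x. - T i j x)"
proof -
  have "(\<forall>i<3. \<forall>j<3. (\<lambda>x. - T i j x) \<in> F)" using assms neg unfolding table_def by meson
  moreover have "(\<forall>x. \<forall>i<3. - T i 0 x + - T i 1 x + - T i 2 x = 0)"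
    "(\<forall>x. \<forall>j<3. - T 0 j x + - T 1 j x + - T 2 j x = 0)"
  proof -
    have "\<forall>x. \<forall>i<3. T i 0 x + T i 1 x + T i 2 x = 0" "\<forall>x. \<forall>j<3. T 0 j x + T 1 j x + T 2 j x = 0"
      using assms unfolding table_def by fast+
    then have eq: "T i 0 x + T i 1 x + T i 2 x = 0" "T 0 i x + T 1 i x + T 2 i x = 0" if "i < 3" for i x
      using that by blast+
    have "- T i 0 x + - T i 1 x + - T i 2 x = 0" if "i < 3" for i x
      using eq(1)[OF that, of x] by linarith
    then show "\<forall>x. \<forall>i<3. - T i 0 x + - T i 1 x + - T i 2 x = 0" by blast
    have "- T 0 i x + - T 1 i x + - T 2 i x = 0" if "i < 3" for i x
      using eq(2)[OF that, of x] by linarith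
    then show "\<forall>x. \<forall>j<3. - T 0 j x + - T 1 j x + - T 2 j x = 0" by blast
  qed
  moreover have "(\<forall>x. (\<forall>i<3. \<forall>j<3. - T i j x = 0) \<longrightarrow> x = 0)"
    using assms unfolding table_def by simp
  moreover have "(\<forall>h\<in>F. (\<forall>x. h x = 0) \<or> (\<exists>i<3. \<exists>j<3. (\<forall>x. h x = - T i j x) \<or> (\<forall>x. h x = - (- T i j x))))"
  proof
    fix h assume "h \<in> F"
    then consider "\<forall>x. h x = 0" | i j where "i < 3" "j < 3" "(\<forall>x. h x = T i j x) \<or> (\<forall>x. h x = - T i j x)"
      using assms unfolding table_def by meson
    then show "(\<forall>x. h x = 0) \<or> (\<exists>i<3. \<exists>j<3. (\<forall>x. h x = - T i j x) \<or> (\<forall>x. h x = - (- T i j x)))"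
    proof cases
      case 2
      then have "(\<forall>x. h x = - T i j x) \<or> (\<forall>x. h x = - (- T i j x))" by auto
      with 2(1,2) show ?thesis by blast
    qed simp
  qed
  ultimately show ?thesis unfolding table_def by blast
qed

lemma table_inj:
  assumes "table T" "\<And>i j. i < 3 \<Longrightarrow> j < 3 \<Longrightarrow> T i j x = T i j y"
  shows "x = y"
proof -
  have "T i j (x - y) = 0" if "i < 3" "j < 3" for i j
    using assms(2)[OF that] assms(1) that F_diff[of "T i j" x y] unfolding table_def by simp
  then have "x - y = 0" using assms(1) unfolding table_def by blast
  then show ?thesis by simp
qed

text \<open>
  Regularity provides some conformal part of \<open>D\<close>.  Parts on which \<open>f0\<close> vanishes are removed
  one after the other until one with the required value remains.
\<close>

lemma conformal_part:
  assumes T: "table T" and f0: "f0 \<in> F" "f0 D \<noteq> 0"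
  obtains z where "f0 z \<noteq> 0" "\<And>f. f \<in> F \<Longrightarrow> f z \<in> {-1, 0, 1} \<and> 0 \<le> f z * f D \<and> (f D = 0 \<longrightarrow> f z = 0)"
proof -
  have "\<exists>z. f0 z \<noteq> 0 \<and> (\<forall>f\<in>F. f z \<in> {-1, 0, 1} \<and> 0 \<le> f z * f D \<and> (f D = 0 \<longrightarrow> f z = 0))"
    using f0(2)
  proof (induction "\<Sum>i<3. \<Sum>j<3. nat \<bar>T i j D\<bar>" arbitrary: D rule: less_induct)
    case less
    have "D \<noteq> 0" using less.prems F_zero[OF f0(1)] by auto
    then obtain y where y: "y \<noteq> 0" "\<forall>f\<in>F. f y \<in> {-1, 0, 1} \<and> (f D = 0 \<longrightarrow> f y = 0) \<and> 0 \<le> f y * f D"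
      using conformal by blast
    show ?case
    proof (cases "f0 y = 0")
      case False
      with y(2) show ?thesis by blast
    next
      case True
      have step: "\<bar>f (D - y)\<bar> = \<bar>f D\<bar> - \<bar>f y\<bar>" "0 \<le> f (D - y) * f D" if "f \<in> F" for f
      proof -
        have "f y \<in> {-1, 0, 1}" "f D = 0 \<longrightarrow> f y = 0" "0 \<le> f y * f D" using y(2) that by auto
        then show "\<bar>f (D - y)\<bar> = \<bar>f D\<bar> - \<bar>f y\<bar>" "0 \<le> f (D - y) * f D"
          unfolding F_diff[OF that] by (auto simp: zero_le_mult_iff)
      qed
      have TF: "T i j \<in> F" if "i < 3" "j < 3" for i j using T that unfolding table_def by meson
      obtain i j where ij: "i < 3" "j < 3" "T i j y \<noteq> 0"
        using T y(1) unfolding table_def by blast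
      have le: "nat \<bar>T i j (D - y)\<bar> \<le> nat \<bar>T i j D\<bar>" if "i < 3" "j < 3" for i j
        using step(1)[OF TF[OF that]] by simp
      have "(\<Sum>i<3. \<Sum>j<3. nat \<bar>T i j (D - y)\<bar>) < (\<Sum>i<3. \<Sum>j<3. nat \<bar>T i j D\<bar>)"
      proof (rule sum_strict_mono_ex1)
        show "\<forall>i\<in>{..<3}. (\<Sum>j<3. nat \<bar>T i j (D - y)\<bar>) \<le> (\<Sum>j<3. nat \<bar>T i j D\<bar>)"
          using le by (auto intro!: sum_mono)
        have "(\<Sum>j<3. nat \<bar>T i j (D - y)\<bar>) < (\<Sum>j<3. nat \<bar>T i j D\<bar>)"
        proof (rule sum_strict_mono_ex1)
          show "\<exists>j\<in>{..<3}. nat \<bar>T i j (D - y)\<bar> < nat \<bar>T i j D\<bar>"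
            using ij step(1)[OF TF[OF ij(1,2)]] by (intro bexI[of _ j]) auto
        qed (use le ij in auto)
        then show "\<exists>i\<in>{..<3}. (\<Sum>j<3. nat \<bar>T i j (D - y)\<bar>) < (\<Sum>j<3. nat \<bar>T i j D\<bar>)"
          using ij by auto
      qed simp
      moreover have "f0 (D - y) \<noteq> 0" using less.prems True by (simp add: F_diff[OF f0(1)])
      ultimately obtain z where z: "f0 z \<noteq> 0"
        "\<forall>f\<in>F. f z \<in> {-1, 0, 1} \<and> 0 \<le> f z * f (D - y) \<and> (f (D - y) = 0 \<longrightarrow> f z = 0)"
        using less.hyps[of "D - y"] by blast
      have "0 \<le> f z * f D \<and> (f D = 0 \<longrightarrow> f z = 0)" if "f \<in> F" for f
      proof -
        have "0 \<le> f z * f (D - y)" "f (D - y) = 0 \<longrightarrow> f z = 0" using z(2) that by auto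
        then show ?thesis by (rule sign_transfer[OF step[OF that]])
      qed
      with z show ?thesis by blast
    qed
  qed
  then obtain z where "f0 z \<noteq> 0" "\<forall>f\<in>F. f z \<in> {-1, 0, 1} \<and> 0 \<le> f z * f D \<and> (f D = 0 \<longrightarrow> f z = 0)"
    by (elim exE conjE)
  then show thesis by (intro that[of z]) simp_all
qed

text \<open>
  Moving a conformal part of the difference from one point to the other keeps both points between the
  original ones.  It lowers the sum of squares if an entry of the difference has modulus at least 2
  where the part is nonzero.
\<close>

lemma balanced_if_minimal:
  assumes T: "table T" and K: "K \<subseteq> F \<times> UNIV" and xy: "x \<in> solutions K" "y \<in> solutions K"
    and min: "\<And>x' y'. \<lbrakk>x' \<in> solutions K; y' \<in> solutions K; x' + y' = x + y\<rbrakk> \<Longrightarrow>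
       (\<Sum>i<3. \<Sum>j<3. nat ((T i j x)\<^sup>2)) + (\<Sum>i<3. \<Sum>j<3. nat ((T i j y)\<^sup>2))
       \<le> (\<Sum>i<3. \<Sum>j<3. nat ((T i j x')\<^sup>2)) + (\<Sum>i<3. \<Sum>j<3. nat ((T i j y')\<^sup>2))"
    and ij: "i < 3" "j < 3"
  shows "\<bar>T i j x - T i j y\<bar> \<le> 1"
proof (rule ccontr)
  assume big: "\<not> ?thesis"
  have TF: "T i j \<in> F" if "i < 3" "j < 3" for i j using T that unfolding table_def by meson
  have "T i j (x - y) \<noteq> 0" using big by (simp add: F_diff[OF TF[OF ij]])
  from conformal_part[OF T TF[OF ij] this] obtain z where z: "T i j z \<noteq> 0"
    "\<And>f. f \<in> F \<Longrightarrow> f z \<in> {-1, 0, 1} \<and> 0 \<le> f z * f (x - y) \<and> (f (x - y) = 0 \<longrightarrow> f z = 0)" by metis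
  have mid: "min (f x) (f y) \<le> f (x - z)" "min (f x) (f y) \<le> f (y + z)" if "f \<in> F" for f
    using z(2)[OF that] unfolding F_diff[OF that] add[OF that] by (auto simp: zero_le_mult_iff)
  have in_S: "x - z \<in> solutions K" "y + z \<in> solutions K"
    using xy mid K unfolding solutions_def by fastforce+
  have drop: "A = B - 2 * (p - q) \<Longrightarrow> q \<le> p \<Longrightarrow> A \<le> B" for A B p q :: int by simp
  have drop': "A = B - 2 * (p - q) \<Longrightarrow> q < p \<Longrightarrow> A < B" for A B p q :: int by simp
  have sq: "(T k l (x - z))\<^sup>2 + (T k l (y + z))\<^sup>2 \<le> (T k l x)\<^sup>2 + (T k l y)\<^sup>2"
    "k = i \<and> l = j \<Longrightarrow> (T k l (x - z))\<^sup>2 + (T k l (y + z))\<^sup>2 < (T k l x)\<^sup>2 + (T k l y)\<^sup>2" if kl: "k < 3" "l < 3" for k l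
  proof -
    note F = TF[OF kl]
    define v where "v = T k l z"
    have e: "(T k l (x - z))\<^sup>2 + (T k l (y + z))\<^sup>2 = (T k l x)\<^sup>2 + (T k l y)\<^sup>2 - 2 * (v * (T k l x - T k l y) - v * v)"
      unfolding F_diff[OF F] add[OF F] v_def by algebra
    have v: "v \<in> {-1, 0, 1}" "0 \<le> v * (T k l x - T k l y)" "T k l x - T k l y = 0 \<longrightarrow> v = 0"
      using z(2)[OF F] unfolding F_diff[OF F] v_def by auto
    have "v * v \<le> v * (T k l x - T k l y)" using v by (auto simp: zero_le_mult_iff)
    then show "(T k l (x - z))\<^sup>2 + (T k l (y + z))\<^sup>2 \<le> (T k l x)\<^sup>2 + (T k l y)\<^sup>2" by (rule drop[OF e])
    assume "k = i \<and> l = j"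
    then have "v \<noteq> 0" "\<bar>T k l x - T k l y\<bar> > 1" using z(1) big unfolding v_def by auto
    then have "v * v < v * (T k l x - T k l y)" using v by (auto simp: zero_le_mult_iff)
    then show "(T k l (x - z))\<^sup>2 + (T k l (y + z))\<^sup>2 < (T k l x)\<^sup>2 + (T k l y)\<^sup>2" by (rule drop'[OF e])
  qed
  have N: "nat (m\<^sup>2) + nat (n\<^sup>2) = nat (m\<^sup>2 + n\<^sup>2)" for m n :: int by (simp add: nat_add_distrib)
  have le: "nat ((T k l (x - z))\<^sup>2) + nat ((T k l (y + z))\<^sup>2) \<le> nat ((T k l x)\<^sup>2) + nat ((T k l y)\<^sup>2)"
    if "k < 3" "l < 3" for k l unfolding N by (intro nat_mono sq(1) that)
  have less: "nat ((T i j (x - z))\<^sup>2) + nat ((T i j (y + z))\<^sup>2) < nat ((T i j x)\<^sup>2) + nat ((T i j y)\<^sup>2)"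
  proof -
    have "0 \<le> (T i j (x - z))\<^sup>2 + (T i j (y + z))\<^sup>2" by simp
    with sq(2)[OF ij] show ?thesis unfolding N by linarith
  qed
  have "(\<Sum>k<3. \<Sum>l<3. nat ((T k l (x - z))\<^sup>2) + nat ((T k l (y + z))\<^sup>2))
     < (\<Sum>k<3. \<Sum>l<3. nat ((T k l x)\<^sup>2) + nat ((T k l y)\<^sup>2))"
  proof (rule sum_strict_mono_ex1)
    show "\<forall>k\<in>{..<3}. (\<Sum>l<3. nat ((T k l (x - z))\<^sup>2) + nat ((T k l (y + z))\<^sup>2))
       \<le> (\<Sum>l<3. nat ((T k l x)\<^sup>2) + nat ((T k l y)\<^sup>2))"
      using le by (auto intro!: sum_mono)
    have "(\<Sum>l<3. nat ((T i l (x - z))\<^sup>2) + nat ((T i l (y + z))\<^sup>2)) < (\<Sum>l<3. nat ((T i l x)\<^sup>2) + nat ((T i l y)\<^sup>2))"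
      using le ij less by (intro sum_strict_mono_ex1) auto
    then show "\<exists>k\<in>{..<3}. (\<Sum>l<3. nat ((T k l (x - z))\<^sup>2) + nat ((T k l (y + z))\<^sup>2))
       < (\<Sum>l<3. nat ((T k l x)\<^sup>2) + nat ((T k l y)\<^sup>2))" using ij by auto
  qed simp
  with min[OF in_S] show False by (simp add: sum.distrib)
qed

end

section \<open>The Birkhoff cell\<close>

text \<open>
  An even and an odd permutation matrix of size 3 share exactly one entry.
\<close>

lemma perm_position:
  assumes "a < 3" "b < 3"
  obtains i j :: nat where "i < 3" "j < 3" "\<And>k. even_perm k i j = (if k = a then 1 else 0)"
    "\<And>k. odd_perm k i j = (if k = b then 1 else 0)"
proof -
  have "a = 0 \<or> a = 1 \<or> a = 2" "b = 0 \<or> b = 1 \<or> b = 2" using assms by auto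
  then have "((2 * a + 2 * b) mod 3 + 3 - (2 * b + a) mod 3) mod 3 = a"
    "((2 * b + a) mod 3 + (2 * a + 2 * b) mod 3) mod 3 = b"
    by (elim disjE; simp)+
  then show thesis
    by (intro that[of "(2 * b + a) mod 3" "(2 * a + 2 * b) mod 3"]) (auto simp: even_perm_def odd_perm_def)
qed

lemma perm_position_unique:
  fixes i j k l :: nat
  assumes "k < 3" "l < 3" "i < 3" "j < 3"
    and "(l + 3 - k) mod 3 = (j + 3 - i) mod 3" "(k + l) mod 3 = (i + j) mod 3"
  shows "k = i \<and> l = j"
proof -
  have "k = 0 \<or> k = 1 \<or> k = 2" "l = 0 \<or> l = 1 \<or> l = 2" "i = 0 \<or> i = 1 \<or> i = 2" "j = 0 \<or> j = 1 \<or> j = 2"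
    using assms(1-4) by auto
  then show ?thesis using assms(5,6) by (elim disjE; simp)
qed

lemma perm_sums:
  assumes "i < 3" "j < 3"
  shows "even_perm 0 i j + even_perm 1 i j + even_perm 2 i j = 1"
    "odd_perm 0 i j + odd_perm 1 i j + odd_perm 2 i j = 1"
proof -
  have "(if m mod 3 = 0 then 1 else 0) + (if m mod 3 = 1 then 1 else 0) + (if m mod 3 = 2 then 1 else 0) = (1::int)"
    for m :: nat
  proof -
    have "m mod 3 = 0 \<or> m mod 3 = 1 \<or> m mod 3 = 2" by arith
    then show ?thesis by auto
  qed
  then show "even_perm 0 i j + even_perm 1 i j + even_perm 2 i j = 1"
    "odd_perm 0 i j + odd_perm 1 i j + odd_perm 2 i j = 1"
    unfolding even_perm_def odd_perm_def by blast+
qed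

lemma even_perm_values:
  assumes "v = 0 \<or> v = 1"
  shows "\<exists>m<3. even_perm m i j = v"
  using assms
proof
  assume "v = 1"
  then show ?thesis by (intro exI[of _ "(j + 3 - i) mod 3"]) (simp add: even_perm_def)
next
  assume "v = 0"
  then show ?thesis
    by (intro exI[of _ "if (j + 3 - i) mod 3 = 0 then 1 else 0"]) (simp add: even_perm_def)
qed

context regular_functionals
begin

text \<open>
  If the bound at the position \<open>(i, j)\<close> is missing, let \<open>a\<close> and \<open>b\<close> be the indices of the even and the
  odd matrix through that position.  The sum of the other two even matrices minus the odd one has
  entry $-1$ at \<open>(i, j)\<close> and entries 0 and 1 elsewhere, so it is a solution.  Two exchanges through
  this point turn the even matrices into the odd ones.
\<close>

lemma birkhoff_exchange:
  assumes T: "table T" and K: "K \<subseteq> F \<times> UNIV"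
    and eo: "\<And>k. k < 3 \<Longrightarrow> e k \<in> solutions K" "\<And>k. k < 3 \<Longrightarrow> o' k \<in> solutions K"
    and te: "\<And>i j k. \<lbrakk>i < 3; j < 3; k < 3\<rbrakk> \<Longrightarrow> T i j (e k) - n i j = even_perm k i j"
    and to: "\<And>i j k. \<lbrakk>i < 3; j < 3; k < 3\<rbrakk> \<Longrightarrow> T i j (o' k) - n i j = odd_perm k i j"
  shows "birkhoff K \<or> (\<forall>N. set_mset N \<subseteq> solutions K \<longrightarrow>
    swap_equiv (solutions K) (N + {#e 0, e 1, e 2#}) (N + {#o' 0, o' 1, o' 2#}))"
proof (cases "\<forall>i<3. \<forall>j<3. (T i j, n i j) \<in> K")
  case True
  have "birkhoff K"
    unfolding birkhoff_def
    by (rule exI[of _ T], rule exI[of _ n], rule exI[of _ e], rule exI[of _ o'], intro conjI allI impI)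
      (use True T eo te to in simp_all)
  then show ?thesis by blast
next
  case False
  then obtain i j where ij: "i < 3" "j < 3" "(T i j, n i j) \<notin> K" by blast
  let ?S = "solutions K"
  have TF: "T i j \<in> F" if "i < 3" "j < 3" for i j using T that unfolding table_def by meson
  define a b where "a = (j + 3 - i) mod 3" and "b = (i + j) mod 3"
  have ab: "a < 3" "b < 3" unfolding a_def b_def by simp_all
  have complete: "\<exists>a1 a2. a1 < 3 \<and> a2 < 3 \<and> distinct [a, a1, a2] \<and> {#f a, f a1, f a2#} = {#f 0, f 1, f 2#}"
    if "a < 3" for a :: nat and f :: "nat \<Rightarrow> 'l"
  proof -
    have "a = 0 \<or> a = 1 \<or> a = 2" using that by auto
    then show ?thesis
    proof (elim disjE)
      assume "a = 0" show ?thesis by (rule exI[of _ 1], rule exI[of _ 2]) (simp add: \<open>a = 0\<close> add_mset_commute)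
    next
      assume "a = 1" show ?thesis by (rule exI[of _ 0], rule exI[of _ 2]) (simp add: \<open>a = 1\<close> add_mset_commute)
    next
      assume "a = 2" show ?thesis by (rule exI[of _ 0], rule exI[of _ 1]) (simp add: \<open>a = 2\<close> add_mset_commute)
    qed
  qed
  obtain a1 a2 where a12: "a1 < 3" "a2 < 3" "distinct [a, a1, a2]" "{#e a, e a1, e a2#} = {#e 0, e 1, e 2#}"
    using complete[OF ab(1), of e] by blast
  obtain b1 b2 where b12: "b1 < 3" "b2 < 3" "{#o' b, o' b1, o' b2#} = {#o' 0, o' 1, o' 2#}"
    using complete[OF ab(2), of o'] by blast
  have "e 0 + e 1 + e 2 = o' 0 + o' 1 + o' 2"
  proof (rule table_inj[OF T])
    fix i j :: nat assume *: "i < 3" "j < 3"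
    show "T i j (e 0 + e 1 + e 2) = T i j (o' 0 + o' 1 + o' 2)"
      using te[OF *, of 0] te[OF *, of 1] te[OF *, of 2] to[OF *, of 0] to[OF *, of 1] to[OF *, of 2] perm_sums[OF *]
      by (simp add: add[OF TF[OF *]])
  qed
  then have sum: "e a + e a1 + e a2 = o' b + o' b1 + o' b2"
    using arg_cong[OF a12(4), of sum_mset] arg_cong[OF b12(3), of sum_mset] by (simp add: add.assoc)
  \<comment> \<open>The neighbouring point with entry $-1$ at the position \<open>(i, j)\<close>.\<close>
  define z where "z = e a1 + e a2 - o' b"
  have tz: "T k l z - n k l = 1 - even_perm a k l - odd_perm b k l" if kl: "k < 3" "l < 3" for k l
  proof -
    have "even_perm a k l + even_perm a1 k l + even_perm a2 k l = 1"
    proof -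
      have "{a, a1, a2} = {0, 1, 2}" using a12(1-3) ab(1) by auto
      then have "(\<Sum>m\<in>{a, a1, a2}. even_perm m k l) = (\<Sum>m\<in>{0, 1, 2}. even_perm m k l)" by simp
      then show ?thesis using a12(3) perm_sums(1)[OF kl] by simp
    qed
    then show ?thesis
      using te[OF kl a12(1)] te[OF kl a12(2)] to[OF kl ab(2)]
      by (simp add: z_def F_diff[OF TF[OF kl]] add[OF TF[OF kl]])
  qed
  have "z \<in> ?S"
    unfolding solutions_def
  proof (clarify, rule ccontr)
    fix f c assume fc: "(f, c) \<in> K" and viol: "\<not> c \<le> f z"
    have "f \<in> F" using fc K by auto
    have sat: "c \<le> f x" if "x \<in> ?S" for x using fc that unfolding solutions_def by auto
    have "(\<forall>x. f x = 0) \<or> (\<exists>k<3. \<exists>l<3. (\<forall>x. f x = T k l x) \<or> (\<forall>x. f x = - T k l x))"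
      using T \<open>f \<in> F\<close> unfolding table_def by simp
    then consider "\<forall>x. f x = 0" | k l where "k < 3" "l < 3" "\<forall>x. f x = T k l x"
      | k l where "k < 3" "l < 3" "\<forall>x. f x = - T k l x"
      by blast
    then show False
    proof cases
      case 1
      then show False using viol sat[OF eo(1)[of 0]] by simp
    next
      case 2
      note kl = this(1,2)
      note v = even_perm_values
      have "T k l z - n k l \<noteq> 0 \<and> T k l z - n k l \<noteq> 1"
      proof
        show "T k l z - n k l \<noteq> 0"
        proof
          assume "T k l z - n k l = 0"
          obtain m where "m < 3" "even_perm m k l = 0" using v by blast
          then have "T k l (e m) = T k l z" using te[OF kl \<open>m < 3\<close>] \<open>T k l z - n k l = 0\<close> by simp
          then show False using viol sat[OF eo(1)[OF \<open>m < 3\<close>]] 2(3) by simp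
        qed
        show "T k l z - n k l \<noteq> 1"
        proof
          assume "T k l z - n k l = 1"
          obtain m where "m < 3" "even_perm m k l = 1" using v by blast
          then have "T k l (e m) = T k l z" using te[OF kl \<open>m < 3\<close>] \<open>T k l z - n k l = 1\<close> by simp
          then show False using viol sat[OF eo(1)[OF \<open>m < 3\<close>]] 2(3) by simp
        qed
      qed
      then have "even_perm a k l = 1" "odd_perm b k l = 1" and z: "T k l z = n k l - 1"
        using tz[OF kl] unfolding even_perm_def odd_perm_def by (auto split: if_splits)
      then have "(l + 3 - k) mod 3 = (j + 3 - i) mod 3" "(k + l) mod 3 = (i + j) mod 3"
        unfolding even_perm_def odd_perm_def a_def b_def by (auto split: if_splits)
      then have "k = i" "l = j" using perm_position_unique[OF kl ij(1,2)] by simp_all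
      obtain m where "m < 3" "even_perm m k l = 0" using v by blast
      then have "c \<le> n k l" using te[OF kl \<open>m < 3\<close>] sat[OF eo(1)[OF \<open>m < 3\<close>]] 2(3) by simp
      then have "c = n k l" using viol z 2(3) by simp
      moreover have "f = T k l" using 2(3) by blast
      ultimately show False using ij(3) fc \<open>k = i\<close> \<open>l = j\<close> by simp
    next
      case 3
      note kl = this(1,2)
      obtain m where m: "m < 3" "even_perm m k l = 1" using even_perm_values by blast
      have "even_perm a k l \<ge> 0" "odd_perm b k l \<ge> 0" unfolding even_perm_def odd_perm_def by simp_all
      with m have "m < 3" "T k l z \<le> T k l (e m)" using tz[OF kl] te[OF kl m(1)] by simp_all
      then show False using viol sat[OF eo(1)[of m]] 3(3) by simp
    qed
  qed
  have step: "swap_equiv ?S (N + {#e a, e a1, e a2#}) (N + {#o' b, o' b1, o' b2#})" if N: "set_mset N \<subseteq> ?S" for N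
  proof -
    have "swap_equiv ?S ((N + {#e a#}) + {#e a1, e a2#}) ((N + {#e a#}) + {#z, o' b#})"
      by (rule swap_equiv_pair) (use N eo ab a12 \<open>z \<in> ?S\<close> in \<open>simp_all add: z_def\<close>)
    moreover have "swap_equiv ?S ((N + {#o' b#}) + {#e a, z#}) ((N + {#o' b#}) + {#o' b1, o' b2#})"
      by (rule swap_equiv_pair) (use N eo ab b12 \<open>z \<in> ?S\<close> sum in \<open>simp_all add: z_def algebra_simps\<close>)
    moreover have "(N + {#e a#}) + {#z, o' b#} = (N + {#o' b#}) + {#e a, z#}"
      by (simp add: add_mset_commute)
    ultimately show ?thesis by (simp add: add_mset_commute)
  qed
  show ?thesis using step unfolding a12(4) b12(3) by blast
qed

end

lemma three_elements_of_mset: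
  assumes "x \<in># L" "y \<in># L" "z \<in># L" "distinct [x, y, z]"
  obtains N where "L = N + {#x, y, z#}"
proof -
  obtain L1 where 1: "L = add_mset x L1" using assms(1) by (metis mset_add)
  then have "y \<in># L1" using assms(2,4) by auto
  then obtain L2 where 2: "L1 = add_mset y L2" by (metis mset_add)
  then have "z \<in># L2" using assms(3,4) 1 by auto
  then obtain L3 where 3: "L2 = add_mset z L3" by (metis mset_add)
  show thesis by (rule that[of L3]) (simp add: 1 2 3)
qed

lemma sum_mset_int_nonneg:
  fixes f :: "'a \<Rightarrow> int"
  assumes "\<And>x. x \<in># L \<Longrightarrow> 0 \<le> f x" "y \<in># L" "0 < f y"
  shows "0 < (\<Sum>x\<in>#L. f x)"
proof -
  obtain K where K: "L = add_mset y K" using assms(2) by (metis mset_add)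
  have "\<forall>x\<in>#K. 0 \<le> f x" using assms(1) unfolding K by simp
  then have "0 \<le> (\<Sum>x\<in>#K. f x)" by (induction K) auto
  then show ?thesis using assms(3) by (simp add: K)
qed

text \<open>
  With values 0 and 1 the sum and the size determine how often each value occurs.
\<close>

lemma same_sum_same_value:
  fixes f :: "'a \<Rightarrow> int"
  assumes L: "\<And>x. x \<in># L \<Longrightarrow> f x \<in> {0, 1}" and L': "\<And>x. x \<in># L' \<Longrightarrow> f x \<in> {0, 1}"
    and size: "size L = size L'" and sum: "(\<Sum>x\<in>#L. f x) = (\<Sum>x\<in>#L'. f x)" and y: "y \<in># L"
  shows "\<exists>y'\<in>#L'. f y' = f y"
proof (rule ccontr)
  assume no: "\<not> ?thesis"
  have fy: "f y = 0 \<or> f y = 1" using L[OF y] by simp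
  have "f x = 1 - f y" if "x \<in># L'" for x using no L'[OF that] that fy by auto
  then have s': "(\<Sum>x\<in>#L'. f x) = int (size L') * (1 - f y)"
    by (induction L') (auto simp: algebra_simps)
  from fy show False
  proof
    assume "f y = 1"
    have "0 < (\<Sum>x\<in>#L. f x)"
      by (rule sum_mset_int_nonneg[OF _ y]) (use L \<open>f y = 1\<close> in fastforce)+
    then show False using s' sum \<open>f y = 1\<close> by simp
  next
    assume "f y = 0"
    have "0 < (\<Sum>x\<in>#L. 1 - f x)"
      by (rule sum_mset_int_nonneg[OF _ y]) (use L \<open>f y = 0\<close> in fastforce)+
    moreover have "(\<Sum>x\<in>#L. 1 - f x) = int (size L) - (\<Sum>x\<in>#L. f x)"
      by (induction L) auto
    ultimately show False using s' sum size \<open>f y = 0\<close> by simp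
  qed
qed

context regular_functionals
begin

lemma sum_mset_diff_const:
  assumes "f \<in> F"
  shows "(\<Sum>x\<in>#L. f x - c) = f (sum_mset L) - int (size L) * c"
  by (induction L) (simp_all add: F_zero[OF assms] add[OF assms] algebra_simps)

text \<open>
  If the multisets share no point, then an odd matrix \<open>b\<close> in one of them forces all even matrices into
  the other: the entry that \<open>b\<close> shares with the even matrix \<open>a\<close> must be covered there, and only these
  two cover it.  So one multiset contains all even and the other all odd matrices, and an
  exchange of the three even ones creates a common point.
\<close>

lemma perm_cell:
  assumes T: "table T" and K: "K \<subseteq> F \<times> UNIV"
    and L: "set_mset L \<subseteq> solutions K" "set_mset L' \<subseteq> solutions K" "size L = size L'" "sum_mset L = sum_mset L'" "L \<noteq> {#}"
    and cell: "\<And>x i j. x \<in># L + L' \<Longrightarrow> i < 3 \<Longrightarrow> j < 3 \<Longrightarrow> T i j x - n i j \<in> {0, 1}"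
    and rows: "\<forall>i<3. n i 0 + n i 1 + n i 2 = -1" and cols: "\<forall>j<3. n 0 j + n 1 j + n 2 j = -1"
  shows "birkhoff K \<or> (\<exists>L1 L1' x. swap_equiv (solutions K) L L1 \<and> swap_equiv (solutions K) L' L1' \<and> x \<in># L1 \<and> x \<in># L1')"
proof (cases "\<exists>x. x \<in># L \<and> x \<in># L'")
  case True
  then show ?thesis by blast
next
  case False
  have TF: "T i j \<in> F" if "i < 3" "j < 3" for i j using T that unfolding table_def by meson
  define is_e where "is_e k x \<longleftrightarrow> (\<forall>i<3. \<forall>j<3. T i j x - n i j = even_perm k i j)" for k x
  define is_o where "is_o k x \<longleftrightarrow> (\<forall>i<3. \<forall>j<3. T i j x - n i j = odd_perm k i j)" for k x
  have perm: "\<exists>k<3. is_e k x \<or> is_o k x" if x: "x \<in># L + L'" for x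
    unfolding is_e_def is_o_def
  proof (rule perm_table)
    show "\<forall>i<3. \<forall>j<3. T i j x - n i j \<in> {0, 1}" using cell[OF x] by blast
    have sums: "T i 0 x + T i 1 x + T i 2 x = 0" "T 0 i x + T 1 i x + T 2 i x = 0" if "i < 3" for i
      using T that unfolding table_def by fast+
    show "\<forall>i<3. T i 0 x - n i 0 + (T i 1 x - n i 1) + (T i 2 x - n i 2) = 1"
    proof (intro allI impI)
      fix i :: nat assume "i < 3"
      then show "T i 0 x - n i 0 + (T i 1 x - n i 1) + (T i 2 x - n i 2) = 1"
        using sums(1)[of i] rows[rule_format, of i] by linarith
    qed
    show "\<forall>j<3. T 0 j x - n 0 j + (T 1 j x - n 1 j) + (T 2 j x - n 2 j) = 1"
    proof (intro allI impI)
      fix i :: nat assume "i < 3"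
      then show "T 0 i x - n 0 i + (T 1 i x - n 1 i) + (T 2 i x - n 2 i) = 1"
        using sums(2)[of i] cols[rule_format, of i] by linarith
    qed
  qed
  have eq: "x = y" if "is_e k x \<and> is_e k y \<or> is_o k x \<and> is_o k y" for k x y
  proof (rule table_inj[OF T])
    fix i j :: nat assume "i < 3" "j < 3"
    then have "T i j x - n i j = T i j y - n i j" using that unfolding is_e_def is_o_def by metis
    then show "T i j x = T i j y" by simp
  qed
  have same_entry: "\<exists>y\<in>#Y. T i j y - n i j = T i j x - n i j"
    if XY: "X = L \<and> Y = L' \<or> X = L' \<and> Y = L" and x: "x \<in># X" and ij: "i < 3" "j < 3" for X Y x i j
  proof (rule same_sum_same_value[OF _ _ _ _ x])
    show "size X = size Y" using XY L(3) by auto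
    show "(\<Sum>x\<in>#X. T i j x - n i j) = (\<Sum>x\<in>#Y. T i j x - n i j)"
      unfolding sum_mset_diff_const[OF TF[OF ij]] using XY L(3,4) by auto
  qed (use cell ij XY in auto)
  have disj: "x \<noteq> y" if "X = L \<and> Y = L' \<or> X = L' \<and> Y = L" "x \<in># X" "y \<in># Y" for X Y x y
    using that False by auto
  have evens: "\<exists>y\<in>#Y. is_e a y"
    if XY: "X = L \<and> Y = L' \<or> X = L' \<and> Y = L" and x: "x \<in># X" "is_o b x" and ab: "a < 3" "b < 3" for X Y x a b
  proof -
    obtain i j where ij: "i < 3" "j < 3" "\<And>k. even_perm k i j = (if k = a then 1 else 0)"
      "\<And>k. odd_perm k i j = (if k = b then 1 else 0)" using perm_position[OF ab] by metis
    obtain y where y: "y \<in># Y" "T i j y - n i j = T i j x - n i j" using same_entry[OF XY x(1) ij(1,2)] by blast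
    then have one: "T i j y - n i j = 1" using x(2) ij unfolding is_o_def by simp
    obtain k where k: "is_e k y \<or> is_o k y" using perm[of y] y(1) XY by auto
    have no: "\<not> is_o b y" using eq[of b x y] disj[OF XY x(1) y(1)] x(2) by blast
    have e: "is_e k y \<Longrightarrow> k = a" using one ij(1,2) ij(3)[of k] unfolding is_e_def by (auto split: if_splits)
    have o: "is_o k y \<Longrightarrow> k = b" using one ij(1,2) ij(4)[of k] unfolding is_o_def by (auto split: if_splits)
    from k e o no have "is_e a y" by blast
    with y(1) show ?thesis by blast
  qed
  have odds: "\<exists>y\<in>#Y. is_o b y"
    if XY: "X = L \<and> Y = L' \<or> X = L' \<and> Y = L" and x: "x \<in># X" "is_e a x" and ab: "a < 3" "b < 3" for X Y x a b
  proof -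
    obtain i j where ij: "i < 3" "j < 3" "\<And>k. even_perm k i j = (if k = a then 1 else 0)"
      "\<And>k. odd_perm k i j = (if k = b then 1 else 0)" using perm_position[OF ab] by metis
    obtain y where y: "y \<in># Y" "T i j y - n i j = T i j x - n i j" using same_entry[OF XY x(1) ij(1,2)] by blast
    then have one: "T i j y - n i j = 1" using x(2) ij unfolding is_e_def by simp
    obtain k where k: "is_e k y \<or> is_o k y" using perm[of y] y(1) XY by auto
    have no: "\<not> is_e a y" using eq[of a x y] disj[OF XY x(1) y(1)] x(2) by blast
    have e: "is_e k y \<Longrightarrow> k = a" using one ij(1,2) ij(3)[of k] unfolding is_e_def by (auto split: if_splits)
    have o: "is_o k y \<Longrightarrow> k = b" using one ij(1,2) ij(4)[of k] unfolding is_o_def by (auto split: if_splits)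
    from k e o no have "is_o b y" by blast
    with y(1) show ?thesis by blast
  qed
  have split: "(\<forall>a<3. \<exists>y\<in>#X. is_e a y) \<and> (\<forall>b<3. \<exists>y\<in>#Y. is_o b y)"
    if XY: "X = L \<and> Y = L' \<or> X = L' \<and> Y = L" and x: "x \<in># X" "is_e k x" "k < 3" for X Y x k
  proof -
    have o: "\<forall>b<3. \<exists>y\<in>#Y. is_o b y" using odds[OF XY x(1,2,3)] by blast
    then obtain y where y: "y \<in># Y" "is_o 0 y" by (metis zero_less_numeral)
    have YX: "Y = L \<and> X = L' \<or> Y = L' \<and> X = L" using XY by blast
    have "\<forall>a<3. \<exists>y\<in>#X. is_e a y" using evens[OF YX y] by simp
    with o show ?thesis by blast
  qed
  have "\<exists>X Y. (X = L \<and> Y = L' \<or> X = L' \<and> Y = L) \<and> (\<forall>a<3. \<exists>y\<in>#X. is_e a y) \<and> (\<forall>b<3. \<exists>y\<in>#Y. is_o b y)"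
  proof -
    obtain x where x: "x \<in># L" using L(5) by blast
    then obtain k where k: "k < 3" "is_e k x \<or> is_o k x" using perm[of x] by auto
    from k(2) show ?thesis
    proof
      assume "is_e k x"
      then show ?thesis using split[of L L' x k] x k(1) by blast
    next
      assume "is_o k x"
      then obtain y where "y \<in># L'" "is_e 0 y" using evens[of L L' x k 0] x k(1) by auto
      then show ?thesis using split[of L' L y 0] by auto
    qed
  qed
  then obtain X Y where XY: "X = L \<and> Y = L' \<or> X = L' \<and> Y = L"
    and ex: "\<forall>a<3. \<exists>y\<in>#X. is_e a y" "\<forall>b<3. \<exists>y\<in>#Y. is_o b y" by (elim exE conjE)
  obtain e where e: "\<And>a. a < 3 \<Longrightarrow> e a \<in># X \<and> is_e a (e a)" using ex(1) by metis
  obtain o' where o': "\<And>a. a < 3 \<Longrightarrow> o' a \<in># Y \<and> is_o a (o' a)" using ex(2) by metis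
  have sub: "set_mset X \<subseteq> solutions K" "set_mset Y \<subseteq> solutions K" using XY L by auto
  have e_ne: "e a \<noteq> e a'" if "a < 3" "a' < 3" "a \<noteq> a'" for a a'
  proof
    assume "e a = e a'"
    obtain i j where ij: "i < 3" "j < 3" "\<And>k. even_perm k i j = (if k = a then 1 else 0)"
      "\<And>k. odd_perm k i j = (if k = a then 1 else 0)"
      using perm_position[OF \<open>a < 3\<close> \<open>a < 3\<close>] by metis
    have "even_perm a i j = even_perm a' i j"
      using e[OF \<open>a < 3\<close>] e[OF \<open>a' < 3\<close>] \<open>e a = e a'\<close> ij(1,2) unfolding is_e_def by metis
    then show False using ij(3) \<open>a \<noteq> a'\<close> by simp
  qed
  obtain N where N: "X = N + {#e 0, e 1, e 2#}"
    by (rule three_elements_of_mset[of "e 0" X "e 1" "e 2"]) (use e e_ne in simp_all)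
  have "birkhoff K \<or> (\<forall>N. set_mset N \<subseteq> solutions K \<longrightarrow>
    swap_equiv (solutions K) (N + {#e 0, e 1, e 2#}) (N + {#o' 0, o' 1, o' 2#}))"
    by (rule birkhoff_exchange[OF T K]) (use e o' sub in \<open>auto simp: is_e_def is_o_def\<close>)
  then show ?thesis
  proof
    assume "\<forall>N. set_mset N \<subseteq> solutions K \<longrightarrow>
      swap_equiv (solutions K) (N + {#e 0, e 1, e 2#}) (N + {#o' 0, o' 1, o' 2#})"
    moreover have "set_mset N \<subseteq> solutions K" using sub(1) N by auto
    ultimately have X: "swap_equiv (solutions K) X (N + {#o' 0, o' 1, o' 2#})" using N by simp
    have mem: "o' 0 \<in># N + {#o' 0, o' 1, o' 2#}" "o' 0 \<in># Y" using o'[of 0] by simp_all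
    from XY show ?thesis
    proof
      assume "X = L \<and> Y = L'"
      with X mem show ?thesis by blast
    next
      assume "X = L' \<and> Y = L"
      with X mem show ?thesis by blast
    qed
  qed blast
qed

text \<open>
  Multisets of least weight lie in one unit cell, whose lower corner \<open>n\<close> is determined by size and sum.
  Cells with all line sums 2 become cells with all line sums 1 when the signs of the
  table are reversed.
\<close>

lemma quad_connected_or_birkhoff_if_table:
  assumes T: "table T" and K: "K \<subseteq> F \<times> UNIV"
  shows "quad_connected (solutions K) \<or> birkhoff K"
proof (rule disjCI)
  assume nb: "\<not> birkhoff K"
  let ?S = "solutions K"
  have TF: "T i j \<in> F" if "i < 3" "j < 3" for i j using T that unfolding table_def by meson
  define w where "w x = (\<Sum>i<3. \<Sum>j<3. nat ((T i j x)\<^sup>2))" for x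
  have two_values: "T i j x - T i j (sum_mset L) div int (size L) \<in> {0, 1}"
    if L: "set_mset L \<subseteq> ?S" and x: "x \<in># L" and ij: "i < 3" "j < 3" and
     min: "\<And>x y x' y'. \<lbrakk>{#x, y#} \<subseteq># L; x' \<in> ?S; y' \<in> ?S; x' + y' = x + y\<rbrakk> \<Longrightarrow> w x + w y \<le> w x' + w y'" for L x i j
  proof -
    have close: "\<bar>T i j u - T i j v\<bar> \<le> 1" if "u \<in># L" "v \<in># L" for u v
    proof (cases "u = v")
      case False
      then have "{#u, v#} \<subseteq># L" using that
        by (metis insert_subset_eq_iff mset_subset_eq_single insert_DiffM insert_noteq_member)
      then show ?thesis
        using that L min by (intro balanced_if_minimal[OF T K _ _ _ ij]) (auto simp: w_def)
    qed simp
    obtain u where u: "u \<in># L" "\<And>v. v \<in># L \<Longrightarrow> T i j u \<le> T i j v"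
    proof -
      have "L \<noteq> {#}" using x by auto
      then show ?thesis using that ex_min_if_finite[of "T i j ` set_mset L"] by (auto simp: not_less)
    qed
    have "T i j u = (\<Sum>y\<in>#L. T i j y) div int (size L)"
      by (rule sum_mset_two_values[OF u(1) refl]) (use u close in fastforce)
    also have "(\<Sum>y\<in>#L. T i j y) = T i j (sum_mset L)"
      by (rule additive_sum_mset[symmetric]) (rule add[OF TF[OF ij]])
    finally show ?thesis using u(2)[OF x] close[OF u(1) x] by auto
  qed
  show "quad_connected ?S"
  proof (rule quad_connectedI)
    fix M M' assume M: "M \<noteq> {#}" "set_mset M \<subseteq> ?S" "set_mset M' \<subseteq> ?S" "size M = size M'" "sum_mset M = sum_mset M'"
    obtain L where L: "swap_equiv ?S M L"
      "\<And>x y x' y'. \<lbrakk>{#x, y#} \<subseteq># L; x' \<in> ?S; y' \<in> ?S; x' + y' = x + y\<rbrakk> \<Longrightarrow> w x + w y \<le> w x' + w y'"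
      using swap_equiv_minimal[OF M(2), of w] by metis
    obtain L' where L': "swap_equiv ?S M' L'"
      "\<And>x y x' y'. \<lbrakk>{#x, y#} \<subseteq># L'; x' \<in> ?S; y' \<in> ?S; x' + y' = x + y\<rbrakk> \<Longrightarrow> w x + w y \<le> w x' + w y'"
      using swap_equiv_minimal[OF M(3), of w] by metis
    note inv = swap_equiv_invariants[OF L(1) M(2)] swap_equiv_invariants[OF L'(1) M(3)]
    have same: "size L = size L'" "sum_mset L = sum_mset L'" "set_mset L \<subseteq> ?S" "set_mset L' \<subseteq> ?S"
      using inv M(4,5) by auto
    have "L \<noteq> {#}" using inv M(1) by auto
    then obtain x where x: "x \<in># L" by blast
    define n where "n i j = T i j (sum_mset L) div int (size L)" for i j
    have cell: "T i j y - n i j \<in> {0, 1}" if "y \<in># L + L'" "i < 3" "j < 3" for i j y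
    proof -
      have "y \<in># L \<or> y \<in># L'" using that(1) by simp
      then show ?thesis
      proof
        assume "y \<in># L"
        then show ?thesis unfolding n_def by (rule two_values[OF same(3) _ that(2,3)]) (rule L(2))
      next
        assume "y \<in># L'"
        then show ?thesis unfolding n_def same(1,2) by (rule two_values[OF same(4) _ that(2,3)]) (rule L'(2))
      qed
    qed
    have zero: "T i 0 y + T i 1 y + T i 2 y = 0" "T 0 i y + T 1 i y + T 2 i y = 0" if "i < 3" for i y
      using T that unfolding table_def by fast+
    have "\<exists>L1 L1' x. swap_equiv ?S L L1 \<and> swap_equiv ?S L' L1' \<and> x \<in># L1 \<and> x \<in># L1'"
    proof (cases "(\<forall>i<3. T i 0 x - n i 0 + (T i 1 x - n i 1) + (T i 2 x - n i 2) = 1) \<and>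
         (\<forall>j<3. T 0 j x - n 0 j + (T 1 j x - n 1 j) + (T 2 j x - n 2 j) = 1)")
      case True
      have r: "n i 0 + n i 1 + n i 2 = -1" "n 0 i + n 1 i + n 2 i = -1" if "i < 3" for i
        using True[THEN conjunct1, rule_format, OF that] True[THEN conjunct2, rule_format, OF that] zero[OF that, of x]
        by linarith+
      have "birkhoff K \<or> ?thesis"
        by (rule perm_cell[OF T K same(3,4,1,2) \<open>L \<noteq> {#}\<close>]) (use cell r in auto)
      with nb show ?thesis by blast
    next
      case not1: False
      show ?thesis
      proof (cases "(\<forall>i<3. T i 0 x - n i 0 + (T i 1 x - n i 1) + (T i 2 x - n i 2) = 2) \<and>
         (\<forall>j<3. T 0 j x - n 0 j + (T 1 j x - n 1 j) + (T 2 j x - n 2 j) = 2)")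
        case True
        have r: "- n i 0 - 1 + (- n i 1 - 1) + (- n i 2 - 1) = -1" "- n 0 i - 1 + (- n 1 i - 1) + (- n 2 i - 1) = -1"
          if "i < 3" for i
          using True[THEN conjunct1, rule_format, OF that] True[THEN conjunct2, rule_format, OF that] zero[OF that, of x]
          by linarith+
        have cell': "- T i j y - (- n i j - 1) \<in> {0, 1}" if "y \<in># L + L'" "i < 3" "j < 3" for i j y
          using cell[OF that] by auto
        have "birkhoff K \<or> ?thesis"
          by (rule perm_cell[OF table_uminus[OF T] K same(3,4,1,2) \<open>L \<noteq> {#}\<close>, of "\<lambda>i j. - n i j - 1"])
            (use cell' r in auto)
        with nb show ?thesis by blast
      next
        case not2: False
        have xc: "\<forall>i<3. \<forall>j<3. T i j x - n i j \<in> {0, 1}" using cell[of x] x by simp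
        obtain i j where ij: "i < 3" "j < 3" and ident: "\<And>t'. (\<forall>i<3. \<forall>j<3. t' i j \<in> {0, 1}) \<Longrightarrow>
          (\<forall>i<3. t' i 0 + t' i 1 + t' i 2 = T i 0 x - n i 0 + (T i 1 x - n i 1) + (T i 2 x - n i 2)) \<Longrightarrow>
          (\<forall>j<3. t' 0 j + t' 1 j + t' 2 j = T 0 j x - n 0 j + (T 1 j x - n 1 j) + (T 2 j x - n 2 j)) \<Longrightarrow>
          t' i j = T i j x - n i j \<Longrightarrow> (\<forall>k<3. \<forall>l<3. t' k l = T k l x - n k l)"
          using identifying_entry[of "\<lambda>i j. T i j x - n i j", OF xc not1 not2] by blast
        have "\<exists>y\<in>#L'. T i j y - n i j = T i j x - n i j"
        proof (rule same_sum_same_value[OF _ _ same(1) _ x])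
          show "(\<Sum>x\<in>#L. T i j x - n i j) = (\<Sum>x\<in>#L'. T i j x - n i j)"
            unfolding sum_mset_diff_const[OF TF[OF ij]] same(1,2) ..
        qed (use cell ij in auto)
        then obtain y where y: "y \<in># L'" "T i j y - n i j = T i j x - n i j" by blast
        have margins: "\<forall>i<3. T i 0 y - n i 0 + (T i 1 y - n i 1) + (T i 2 y - n i 2)
              = T i 0 x - n i 0 + (T i 1 x - n i 1) + (T i 2 x - n i 2)"
          "\<forall>i<3. T 0 i y - n 0 i + (T 1 i y - n 1 i) + (T 2 i y - n 2 i)
              = T 0 i x - n 0 i + (T 1 i x - n 1 i) + (T 2 i x - n 2 i)"
        proof -
          have "T i 0 y - n i 0 + (T i 1 y - n i 1) + (T i 2 y - n i 2)
              = T i 0 x - n i 0 + (T i 1 x - n i 1) + (T i 2 x - n i 2)"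
            "T 0 i y - n 0 i + (T 1 i y - n 1 i) + (T 2 i y - n 2 i)
              = T 0 i x - n 0 i + (T 1 i x - n 1 i) + (T 2 i x - n 2 i)" if "i < 3" for i
            using zero[OF that, of x] zero[OF that, of y] by linarith+
          then show "\<forall>i<3. T i 0 y - n i 0 + (T i 1 y - n i 1) + (T i 2 y - n i 2)
              = T i 0 x - n i 0 + (T i 1 x - n i 1) + (T i 2 x - n i 2)"
            "\<forall>i<3. T 0 i y - n 0 i + (T 1 i y - n 1 i) + (T 2 i y - n 2 i)
              = T 0 i x - n 0 i + (T 1 i x - n 1 i) + (T 2 i x - n 2 i)" by blast+
        qed
        have yc: "\<forall>i<3. \<forall>j<3. T i j y - n i j \<in> {0, 1}" using cell[of y] y(1) by simp
        have "\<forall>k<3. \<forall>l<3. T k l y - n k l = T k l x - n k l"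
          by (rule ident[OF yc margins y(2)])
        then have "y = x" by (intro table_inj[OF T]) simp
        with x y(1) show ?thesis by blast
      qed
    qed
    then obtain L1 L1' y where "swap_equiv ?S L L1" "swap_equiv ?S L' L1'" "y \<in># L1" "y \<in># L1'" by blast
    then show "\<exists>L L' x. swap_equiv ?S M L \<and> swap_equiv ?S M' L' \<and> x \<in># L \<and> x \<in># L'"
      using L(1) L'(1) by (meson rtranclp_trans)
  qed
qed

theorem quad_connected_or_birkhoff:
  assumes "frame a b c d" and K: "K \<subseteq> F \<times> UNIV"
  shows "quad_connected (solutions K) \<or> birkhoff K"
  using graphic_or_tabular[OF assms(1)]
proof
  assume graphic
  then show ?thesis using quad_connected_if_graphic[OF _ K] by blast
next
  assume tabular
  then show ?thesis using quad_connected_or_birkhoff_if_table[OF _ K] unfolding tabular_def by blast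
qed

end

section \<open>Circulations\<close>

definition circulations :: "('v, 'e::finite) pre_digraph \<Rightarrow> 'e set \<Rightarrow> (real ^ 'e) set" where
  "circulations Q A = {y. (\<forall>a. a \<notin> A \<longrightarrow> y $ a = 0) \<and>
     (\<forall>v \<in> verts Q. (\<Sum>a | a \<in> arcs Q \<and> head Q a = v. y $ a) - (\<Sum>a | a \<in> arcs Q \<and> tail Q a = v. y $ a) = 0)}"

lemma net_flow_eq:
  fixes y :: "real ^ 'e::finite"
  shows "(\<Sum>a | a \<in> arcs Q \<and> head Q a = v. y $ a) - (\<Sum>a | a \<in> arcs Q \<and> tail Q a = v. y $ a)
    = (\<Sum>a\<in>arcs Q. y $ a * (of_bool (head Q a = v) - of_bool (tail Q a = v)))"
proof -
  have "(\<Sum>a | a \<in> arcs Q \<and> P a. y $ a) = (\<Sum>a\<in>arcs Q. y $ a * of_bool (P a))" for P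
    by (simp add: of_bool_def sum.inter_filter[symmetric] if_distrib cong: if_cong)
  then show ?thesis by (simp add: right_diff_distrib sum_subtractf)
qed

lemma subspace_circulations: "subspace (circulations Q A)"
  unfolding subspace_def circulations_def
  by (auto simp: sum.distrib scaleR_sum_right[symmetric] sum_distrib_left[symmetric] algebra_simps
      simp flip: right_diff_distrib)

text \<open>
  A smallest nonempty invariant subset is mapped onto itself.
\<close>

lemma finite_self_map_core:
  assumes "finite V" "V \<noteq> {}" "f ` V \<subseteq> V"
  obtains C where "C \<subseteq> V" "C \<noteq> {}" "f ` C = C"
proof -
  obtain C where C: "C \<subseteq> V \<and> C \<noteq> {} \<and> f ` C \<subseteq> C"
    and min: "\<And>D. D \<subseteq> V \<and> D \<noteq> {} \<and> f ` D \<subseteq> D \<Longrightarrow> card C \<le> card D"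
    using ex_has_least_nat[of "\<lambda>C. C \<subseteq> V \<and> C \<noteq> {} \<and> f ` C \<subseteq> C" V card] assms by blast
  have "finite C" using C assms(1) finite_subset by blast
  have "card C \<le> card (f ` C)" using C by (intro min) blast
  then have "f ` C = C" using C \<open>finite C\<close> by (meson card_seteq)
  with C that show thesis by blast
qed

text \<open>
  Orient the arrows in the support along the flow.  By conservation every vertex that is entered is
  also left, so choosing one leaving arrow at each vertex gives a self-map of a finite set.  On
  a subset that is mapped onto itself the chosen arrows form disjoint directed cycles.
\<close>

lemma conformal_circulation:
  fixes Q :: "('v, 'e::finite) pre_digraph"
  assumes Q: "fin_digraph Q" and A: "A \<subseteq> arcs Q" and z: "z \<in> circulations Q A" "z \<noteq> 0"
  shows "\<exists>y\<in>circulations Q A. y \<noteq> 0 \<and> (\<forall>a. y $ a \<in> {-1, 0, 1} \<and> (z $ a = 0 \<longrightarrow> y $ a = 0) \<and> 0 \<le> y $ a * z $ a)"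
proof -
  interpret fin_digraph Q by (rule Q)
  define src dst where "src a = (if z $ a > 0 then tail Q a else head Q a)"
    and "dst a = (if z $ a > 0 then head Q a else tail Q a)" for a
  define Z where "Z = {a. z $ a \<noteq> 0}"
  have ZA: "Z \<subseteq> A" using z(1) unfolding circulations_def Z_def by blast
  have net: "(\<Sum>a\<in>arcs Q. z $ a * (of_bool (head Q a = v) - of_bool (tail Q a = v))) = 0" if "v \<in> verts Q" for v
    using z(1) that unfolding circulations_def net_flow_eq by blast
  have continue: "dst a \<in> src ` Z" if "a \<in> Z" for a
  proof (rule ccontr)
    assume no: "dst a \<notin> src ` Z"
    have aQ: "a \<in> arcs Q" using that ZA A by blast
    have "dst a \<in> verts Q" using aQ unfolding dst_def by simp
    have ge: "0 \<le> z $ b * (of_bool (head Q b = dst a) - of_bool (tail Q b = dst a))" for b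
    proof (cases "b \<in> Z")
      case True
      then have "src b \<noteq> dst a" using no imageI[of b Z src] by metis
      then show ?thesis using True unfolding Z_def src_def by (auto simp: of_bool_def split: if_splits)
    qed (simp add: Z_def)
    have "src a \<noteq> dst a" using no imageI[OF that, of src] by metis
    then have "0 < z $ a * (of_bool (head Q a = dst a) - of_bool (tail Q a = dst a))"
      using that unfolding Z_def src_def dst_def by (auto simp: of_bool_def split: if_splits)
    then have "0 < (\<Sum>b\<in>arcs Q. z $ b * (of_bool (head Q b = dst a) - of_bool (tail Q b = dst a)))"
      using aQ ge by (intro sum_pos2[of _ a]) auto
    with net[OF \<open>dst a \<in> verts Q\<close>] show False by simp
  qed
  define leave where "leave v = (SOME a. a \<in> Z \<and> src a = v)" for v
  have leave: "leave v \<in> Z" "src (leave v) = v" if "v \<in> src ` Z" for v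
    using someI_ex[of "\<lambda>a. a \<in> Z \<and> src a = v"] that unfolding leave_def by auto
  have "Z \<noteq> {}" using z(2) unfolding Z_def by (auto simp: vec_eq_iff)
  then have ne: "src ` Z \<noteq> {}" by simp
  have maps: "(\<lambda>v. dst (leave v)) ` (src ` Z) \<subseteq> src ` Z"
  proof (rule image_subsetI)
    fix v assume "v \<in> src ` Z"
    then show "dst (leave v) \<in> src ` Z" by (intro continue leave(1))
  qed
  obtain C where C: "C \<subseteq> src ` Z" "C \<noteq> {}" "(\<lambda>v. dst (leave v)) ` C = C"
    by (rule finite_self_map_core[OF _ ne maps]) simp
  have "finite C" by (rule finite_subset[OF C(1)]) simp
  then have inj: "inj_on (\<lambda>v. dst (leave v)) C" by (rule finite_surj_inj) (simp add: C(3))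
  have inj': "inj_on leave C"
  proof (rule inj_on_inverseI[where g = src])
    show "src (leave v) = v" if "v \<in> C" for v by (rule leave(2)[OF subsetD[OF C(1) that]])
  qed
  have LZ: "leave ` C \<subseteq> Z" by (rule image_subsetI) (rule leave(1)[OF subsetD[OF C(1)]])
  define y :: "real ^ 'e" where "y = (\<chi> a. if a \<in> leave ` C then sgn (z $ a) else 0)"
  have "(\<Sum>a\<in>arcs Q. y $ a * (of_bool (head Q a = v) - of_bool (tail Q a = v))) = 0" for v
  proof -
    have "(\<Sum>a\<in>arcs Q. y $ a * (of_bool (head Q a = v) - of_bool (tail Q a = v)))
      = (\<Sum>a\<in>leave ` C. y $ a * (of_bool (head Q a = v) - of_bool (tail Q a = v)))"
      using LZ ZA A by (intro sum.mono_neutral_right) (auto simp: y_def)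
    also have "\<dots> = (\<Sum>a\<in>leave ` C. of_bool (dst a = v) - of_bool (src a = v))"
      using LZ by (intro sum.cong) (auto simp: y_def src_def dst_def Z_def sgn_if)
    also have "\<dots> = (\<Sum>u\<in>C. of_bool (dst (leave u) = v) - of_bool (src (leave u) = v))"
      by (simp add: sum.reindex[OF inj'])
    also have "\<dots> = (\<Sum>u\<in>C. of_bool (dst (leave u) = v)) - (\<Sum>u\<in>C. of_bool (u = v))"
      using leave(2) C(1) by (simp add: sum_subtractf subset_iff)
    also have "(\<Sum>u\<in>C. of_bool (dst (leave u) = v)) = (\<Sum>u\<in>(\<lambda>v. dst (leave v)) ` C. of_bool (u = v) :: real)"
      by (simp add: sum.reindex[OF inj])
    finally show ?thesis unfolding C(3) by simp
  qed
  then have "y \<in> circulations Q A"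
    unfolding circulations_def net_flow_eq using LZ ZA by (auto simp: y_def)
  moreover have "y \<noteq> 0"
  proof -
    obtain v where "v \<in> C" using C(2) by blast
    then have "y $ leave v \<noteq> 0" using LZ unfolding y_def Z_def by (auto simp: sgn_eq_0_iff)
    then show ?thesis by auto
  qed
  moreover have "\<forall>a. y $ a \<in> {-1, 0, 1} \<and> (z $ a = 0 \<longrightarrow> y $ a = 0) \<and> 0 \<le> y $ a * z $ a"
    unfolding y_def by (auto simp: sgn_if)
  ultimately show ?thesis by blast
qed

text \<open>
  Take a smallest set of arrows that determines all circulations.  Removing \<open>b\<close> from it admits a
  nonzero circulation that vanishes on the other arrows, and a conformal part of this one has entries
  $-1, 0, 1$ only.
\<close>

lemma circulation_basis:
  fixes Q :: "('v, 'e::finite) pre_digraph"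
  assumes Q: "fin_digraph Q" and A: "A \<subseteq> arcs Q"
  obtains B \<beta> where "B \<subseteq> A" "\<And>y. y \<in> circulations Q A \<Longrightarrow> (\<And>b. b \<in> B \<Longrightarrow> y $ b = 0) \<Longrightarrow> y = 0"
    "\<And>b. b \<in> B \<Longrightarrow> \<beta> b \<in> circulations Q A" "\<And>b a. b \<in> B \<Longrightarrow> \<beta> b $ a \<in> {-1, 0, 1}"
    "\<And>b b'. b \<in> B \<Longrightarrow> b' \<in> B \<Longrightarrow> \<beta> b $ b' = (if b' = b then 1 else 0)"
    "card B \<le> dim (circulations Q A)"
proof -
  let ?V = "circulations Q A"
  define det where "det B \<longleftrightarrow> B \<subseteq> A \<and> (\<forall>y\<in>?V. (\<forall>b\<in>B. y $ b = 0) \<longrightarrow> y = 0)" for B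
  have "det A" unfolding det_def circulations_def by (auto simp: vec_eq_iff)
  then obtain B where B: "det B" and min: "\<And>B'. det B' \<Longrightarrow> card B \<le> card B'"
    using ex_has_least_nat[of det A card] by blast
  have "\<exists>y\<in>?V. (\<forall>a. y $ a \<in> {-1, 0, 1}) \<and> (\<forall>b'\<in>B. y $ b' = (if b' = b then 1 else 0))" if b: "b \<in> B" for b
  proof -
    have "card (B - {b}) < card B" using b by (intro psubset_card_mono) auto
    then have "\<not> det (B - {b})" using min by fastforce
    then obtain z where z: "z \<in> ?V" "\<forall>b'\<in>B - {b}. z $ b' = 0" "z \<noteq> 0" using B unfolding det_def by blast
    obtain y where y: "y \<in> ?V" "y \<noteq> 0" "\<And>a. y $ a \<in> {-1, 0, 1}" "\<And>a. z $ a = 0 \<Longrightarrow> y $ a = 0"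
      using conformal_circulation[OF Q A z(1,3)] by blast
    have y0: "\<forall>b'\<in>B - {b}. y $ b' = 0" using y(4) z(2) by blast
    have "y $ b \<noteq> 0"
    proof
      assume "y $ b = 0"
      then have "\<forall>b'\<in>B. y $ b' = 0" using y0 by blast
      then show False using B y(1,2) unfolding det_def by blast
    qed
    then consider "y $ b = 1" | "y $ b = -1" using y(3)[of b] by auto
    then show ?thesis
    proof cases
      case 1
      then have "y $ b' = (if b' = b then 1 else 0)" if "b' \<in> B" for b'
        using y0 that by simp
      with y(1,3) show ?thesis by blast
    next
      case 2
      have "- y \<in> ?V" using y(1) subspace_circulations by (metis subspace_neg)
      moreover have "(- y) $ a \<in> {-1, 0, 1}" for a using y(3)[of a] by auto
      moreover have "(- y) $ b' = (if b' = b then 1 else 0)" if "b' \<in> B" for b'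
        using y0 2 that by simp
      ultimately show ?thesis by blast
    qed
  qed
  then obtain \<beta> where \<beta>: "\<And>b. b \<in> B \<Longrightarrow> \<beta> b \<in> ?V" "\<And>b a. b \<in> B \<Longrightarrow> \<beta> b $ a \<in> {-1, 0, 1}"
    "\<And>b b'. b \<in> B \<Longrightarrow> b' \<in> B \<Longrightarrow> \<beta> b $ b' = (if b' = b then 1 else 0)" by metis
  have inj: "inj_on \<beta> B"
  proof (rule inj_onI)
    fix b b' assume bb: "b \<in> B" "b' \<in> B" "\<beta> b = \<beta> b'"
    then have "\<beta> b $ b' = 1" using \<beta>(3)[OF bb(2,2)] by simp
    with \<beta>(3)[OF bb(1,2)] show "b = b'" by (simp split: if_splits)
  qed
  have "independent (\<beta> ` B)"
  proof (rule independent_if_scalars_zero)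
    show "finite (\<beta> ` B)" by simp
    fix f v assume s: "(\<Sum>v\<in>\<beta> ` B. f v *\<^sub>R v) = 0" and "v \<in> \<beta> ` B"
    then obtain b where b: "b \<in> B" "v = \<beta> b" by blast
    have "0 = (\<Sum>b'\<in>B. f (\<beta> b') *\<^sub>R \<beta> b') $ b" using s by (simp add: sum.reindex[OF inj])
    also have "\<dots> = (\<Sum>b'\<in>B. f (\<beta> b') * \<beta> b' $ b)" by simp
    also have "\<dots> = (\<Sum>b'\<in>B. if b' = b then f (\<beta> b') else 0)"
      using \<beta>(3) b(1) by (intro sum.cong) auto
    also have "\<dots> = f v" using b by simp
    finally show "f v = 0" by simp
  qed
  then have "card (\<beta> ` B) \<le> dim ?V" using \<beta>(1) by (intro independent_card_le_dim) auto
  then have "card B \<le> dim ?V" by (simp add: card_image[OF inj])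
  moreover have "B \<subseteq> A" "\<And>y. y \<in> ?V \<Longrightarrow> (\<And>b. b \<in> B \<Longrightarrow> y $ b = 0) \<Longrightarrow> y = 0"
    using B unfolding det_def by blast+
  ultimately show thesis using \<beta> that[of B \<beta>] by simp
qed

section \<open>The Birkhoff polytope is not smooth\<close>

text \<open>
  Each of these five permutation matrices spans an edge with the identity matrix, because
  two permutation matrices of size 3 are the only ones inside their joint support.
\<close>

lemma doubly_stochastic_on_two_perms:
  fixes X :: "nat \<Rightarrow> nat \<Rightarrow> real"
  assumes rows: "\<forall>i<3. X i 0 + X i 1 + X i 2 = 1" and cols: "\<forall>j<3. X 0 j + X 1 j + X 2 j = 1"
    and q: "q \<in> {even_perm 1, even_perm 2, odd_perm 0, odd_perm 1, odd_perm 2}"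
    and zero: "\<forall>i<3. \<forall>j<3. even_perm 0 i j = 0 \<and> q i j = 0 \<longrightarrow> X i j = 0"
    and nonneg: "\<forall>i<3. \<forall>j<3. 0 \<le> X i j"
  shows "\<exists>t::real. 0 \<le> t \<and> t \<le> 1 \<and> (\<forall>i<3. \<forall>j<3. X i j = (1 - t) * even_perm 0 i j + t * q i j)"
proof -
  have sums: "X 0 0 + X 0 1 + X 0 2 = 1" "X 1 0 + X 1 1 + X 1 2 = 1" "X 2 0 + X 2 1 + X 2 2 = 1"
    "X 0 0 + X 1 0 + X 2 0 = 1" "X 0 1 + X 1 1 + X 2 1 = 1" "X 0 2 + X 1 2 + X 2 2 = 1"
    using rows cols unfolding less3 by blast+
  have nn: "0 \<le> X 0 0" "0 \<le> X 0 1" "0 \<le> X 0 2" "0 \<le> X 1 0" "0 \<le> X 1 1" "0 \<le> X 1 2"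
    "0 \<le> X 2 0" "0 \<le> X 2 1" "0 \<le> X 2 2" using nonneg unfolding less3 by blast+
  let ?P = "\<lambda>t::real. 0 \<le> t \<and> t \<le> 1 \<and> (\<forall>i<3. \<forall>j<3. X i j = (1 - t) * even_perm 0 i j + t * q i j)"
  from q consider "q = even_perm 1" | "q = even_perm 2" | "q = odd_perm 0" | "q = odd_perm 1" | "q = odd_perm 2"
    by blast
  then show ?thesis
  proof cases
    case 1
    have "?P (X 0 1)" using zero sums nn unfolding less3 1 by (simp add: even_perm_def)
    then show ?thesis by blast
  next
    case 2
    have "?P (X 0 2)" using zero sums nn unfolding less3 2 by (simp add: even_perm_def)
    then show ?thesis by blast
  next
    case 3
    have "?P (X 1 2)" using zero sums nn unfolding less3 3 by (simp add: even_perm_def odd_perm_def)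
    then show ?thesis by blast
  next
    case 4
    have "?P (X 0 1)" using zero sums nn unfolding less3 4 by (simp add: even_perm_def odd_perm_def)
    then show ?thesis by blast
  next
    case 5
    have "?P (X 0 2)" using zero sums nn unfolding less3 5 by (simp add: even_perm_def odd_perm_def)
    then show ?thesis by blast
  qed
qed

text \<open>
  The sum \<open>g\<close> of the entries outside the joint support of \<open>v\<close> and \<open>u\<close> is nonnegative on the cone and
  vanishes only on the ray through \<open>u - v\<close>, which is therefore an edge.  At an entry that is 1 in \<open>u\<close>
  and 0 in \<open>v\<close> every lattice point of the ray is an integer, so none is shorter than
  \<open>u - v\<close>.
\<close>

lemma birkhoff_ray_generator:
  fixes P M :: "(real ^ 'e) set" and \<alpha> :: "nat \<Rightarrow> nat \<Rightarrow> 'e::finite"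
  assumes conv: "convex P" and M: "\<And>x y. x \<in> M \<Longrightarrow> y \<in> M \<Longrightarrow> x - y \<in> M" "\<And>x a. x \<in> M \<Longrightarrow> x $ a \<in> \<int>"
    and ds: "\<And>x i j. x \<in> P \<Longrightarrow> i < 3 \<Longrightarrow> j < 3 \<Longrightarrow> 0 \<le> x $ \<alpha> i j"
      "\<And>x i. x \<in> P \<Longrightarrow> i < 3 \<Longrightarrow> x $ \<alpha> i 0 + x $ \<alpha> i 1 + x $ \<alpha> i 2 = 1"
      "\<And>x j. x \<in> P \<Longrightarrow> j < 3 \<Longrightarrow> x $ \<alpha> 0 j + x $ \<alpha> 1 j + x $ \<alpha> 2 j = 1"
    and inj: "\<And>x y. x \<in> P \<Longrightarrow> y \<in> P \<Longrightarrow> (\<And>i j. i < 3 \<Longrightarrow> j < 3 \<Longrightarrow> x $ \<alpha> i j = y $ \<alpha> i j) \<Longrightarrow> x = y"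
    and v: "v \<in> P" "v \<in> M" "\<And>i j. i < 3 \<Longrightarrow> j < 3 \<Longrightarrow> v $ \<alpha> i j = even_perm 0 i j"
    and u: "u \<in> P" "u \<in> M" "\<And>i j. i < 3 \<Longrightarrow> j < 3 \<Longrightarrow> u $ \<alpha> i j = q i j"
    and q: "q \<in> {even_perm 1, even_perm 2, odd_perm 0, odd_perm 1, odd_perm 2}"
  shows "u - v \<in> ray_generators M (vertex_cone P v)"
proof -
  define d where "d = u - v"
  define Z where "Z = {(i, j). i < 3 \<and> j < 3 \<and> even_perm 0 i j = 0 \<and> q i j = 0}"
  have finZ: "finite Z" by (rule finite_subset[of _ "{..<3} \<times> {..<3}"]) (auto simp: Z_def)
  define g where "g x = (\<Sum>(i, j)\<in>Z. x $ \<alpha> i j)" for x :: "real ^ 'e"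
  have g_lin: "g (c *\<^sub>R x + c' *\<^sub>R y) = c * g x + c' * g y" "g (c *\<^sub>R x) = c * g x" "g (x - y) = g x - g y" for c c' x y
    unfolding g_def by (simp_all add: case_prod_unfold sum.distrib sum_distrib_left sum_subtractf)
  have gv: "g v = 0" unfolding g_def by (rule sum.neutral) (auto simp: Z_def v(3))
  have gu: "g u = 0" unfolding g_def by (rule sum.neutral) (auto simp: Z_def u(3))
  have gP: "0 \<le> g x" if "x \<in> P" for x
    unfolding g_def by (rule sum_nonneg) (auto simp: Z_def intro: ds(1)[OF that])
  let ?C = "vertex_cone P v"
  define E where "E = {t *\<^sub>R d | t. 0 \<le> t}"
  have gC: "0 \<le> g D" if "D \<in> ?C" for D
    using that gP gv unfolding vertex_cone_def by (auto simp: g_lin)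
  have gE: "D \<in> E" if D: "D \<in> ?C" "g D = 0" for D
  proof -
    obtain c x where cx: "D = c *\<^sub>R (x - v)" "0 \<le> c" "x \<in> P" using D(1) unfolding vertex_cone_def by blast
    show ?thesis
    proof (cases "c = 0")
      case True
      then have "D = 0 *\<^sub>R d" using cx by simp
      then show ?thesis unfolding E_def by blast
    next
      case False
      then have "g x = 0" using D(2) cx(1) gv by (simp add: g_lin)
      then have "\<forall>p\<in>Z. (case p of (i, j) \<Rightarrow> x $ \<alpha> i j) = 0"
        unfolding g_def using finZ by (subst (asm) sum_nonneg_eq_0_iff) (auto simp: Z_def intro: ds(1)[OF cx(3)])
      then have zero: "\<forall>i<3. \<forall>j<3. even_perm 0 i j = 0 \<and> q i j = 0 \<longrightarrow> x $ \<alpha> i j = 0"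
        unfolding Z_def by auto
      have "\<exists>t::real. 0 \<le> t \<and> t \<le> 1 \<and> (\<forall>i<3. \<forall>j<3. x $ \<alpha> i j = (1 - t) * even_perm 0 i j + t * q i j)"
        by (rule doubly_stochastic_on_two_perms[OF _ _ q zero]) (use ds[OF cx(3)] in blast)+
      then obtain t :: real where t: "0 \<le> t" "t \<le> 1"
        "\<forall>i<3. \<forall>j<3. x $ \<alpha> i j = (1 - t) * even_perm 0 i j + t * q i j" by (elim exE conjE)
      have "(1 - t) *\<^sub>R v + t *\<^sub>R u \<in> P" by (rule convexD_alt[OF conv v(1) u(1) t(1,2)])
      then have "x = (1 - t) *\<^sub>R v + t *\<^sub>R u" using t(3) v(3) u(3) by (intro inj[OF cx(3)]) simp_all
      then have "x - v = t *\<^sub>R d" unfolding d_def by (simp add: algebra_simps)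
      then have "D = (c * t) *\<^sub>R d" unfolding cx(1) by simp
      then show ?thesis unfolding E_def using cx(2) t(1) by auto
    qed
  qed
  have EC: "E \<subseteq> ?C" unfolding E_def vertex_cone_def d_def using u(1) by blast
  have gE0: "g D = 0" if "D \<in> E" for D using that gu gv unfolding E_def d_def by (auto simp: g_lin)
  have "convex E"
  proof (rule convexI)
    fix x y and c c' :: real assume "x \<in> E" "y \<in> E" "0 \<le> c" "0 \<le> c'"
    then obtain s t where "x = s *\<^sub>R d" "y = t *\<^sub>R d" "0 \<le> s" "0 \<le> t" unfolding E_def by blast
    then have "c *\<^sub>R x + c' *\<^sub>R y = (c * s + c' * t) *\<^sub>R d" "0 \<le> c * s + c' * t"
      using \<open>0 \<le> c\<close> \<open>0 \<le> c'\<close> by (simp_all add: algebra_simps)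
    then show "c *\<^sub>R x + c' *\<^sub>R y \<in> E" unfolding E_def by blast
  qed
  moreover have "x \<in> E \<and> y \<in> E" if xy: "x \<in> ?C" "y \<in> ?C" and D: "D \<in> E" "D \<in> open_segment x y" for x y D
  proof -
    obtain s where s: "0 < s" "s < 1" "D = (1 - s) *\<^sub>R x + s *\<^sub>R y" using D(2) unfolding in_segment by blast
    have "(1 - s) * g x + s * g y = 0" using gE0[OF D(1)] unfolding s(3) g_lin .
    moreover have "0 \<le> (1 - s) * g x" "0 \<le> s * g y" using s gC xy by simp_all
    ultimately have "(1 - s) * g x = 0" "s * g y = 0" by linarith+
    then have "g x = 0" "g y = 0" using s by simp_all
    then show ?thesis using gE xy by blast
  qed
  ultimately have face: "E face_of ?C" using EC unfolding face_of_def by blast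
  obtain i j where ij: "i < 3" "j < 3" "d $ \<alpha> i j = 1"
  proof -
    have "\<exists>i<3. \<exists>j<3. q i j - even_perm 0 i j = 1"
      using q unfolding less3 by (auto simp: even_perm_def odd_perm_def)
    then obtain i j where "i < 3" "j < 3" "q i j - even_perm 0 i j = 1" by blast
    then have "d $ \<alpha> i j = 1" unfolding d_def by (simp add: u(3) v(3) flip: of_int_diff)
    with that \<open>i < 3\<close> \<open>j < 3\<close> show thesis by blast
  qed
  then have "d \<noteq> 0" by auto
  have "aff_dim E = 1"
  proof -
    have sub: "{0, d} \<subseteq> E" unfolding E_def using scaleR_zero_left[of d] scaleR_one[of d] by (smt (verit, best) insert_iff mem_Collect_eq singletonD subsetI)
    have "E \<subseteq> affine hull {0, d}"
    proof
      fix x assume "x \<in> E"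
      then obtain t where "x = t *\<^sub>R d" unfolding E_def by blast
      then have "x = (1 - t) *\<^sub>R 0 + t *\<^sub>R d" by simp
      then show "x \<in> affine hull {0, d}" unfolding affine_hull_2 by (smt (verit) mem_Collect_eq)
    qed
    then have "aff_dim E \<le> aff_dim {0, d}" using aff_dim_subset aff_dim_affine_hull by metis
    moreover have "aff_dim {0, d} = 1" using aff_dim_2[of 0 d] \<open>d \<noteq> 0\<close> by simp
    ultimately show ?thesis using aff_dim_subset[OF sub] by simp
  qed
  with face have "E edge_of ?C" unfolding edge_of_def by blast
  moreover have "d \<in> E" unfolding E_def by (intro CollectI exI[of _ 1]) simp
  moreover have "d \<in> M" unfolding d_def by (intro M u v)
  moreover have "norm d \<le> norm w" if w: "w \<in> (E \<inter> M) - {0}" for w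
  proof -
    obtain t where t: "w = t *\<^sub>R d" "0 \<le> t" using w unfolding E_def by blast
    have "t \<in> \<int>" using M(2)[of w "\<alpha> i j"] w ij(3) by (simp add: t)
    moreover have "t \<noteq> 0" using w t(1) by auto
    ultimately have "1 \<le> t" using t(2) by (auto elim!: Ints_cases)
    then have "1 * norm d \<le> t * norm d" by (intro mult_right_mono) auto
    then show ?thesis using t by simp
  qed
  ultimately have "d \<in> ray_generators M ?C" unfolding ray_generators_def using \<open>d \<noteq> 0\<close> by blast
  then show ?thesis unfolding d_def .
qed

text \<open>
  The five edge generators at the vertex \<open>w 0\<close> are integrally dependent: the two that lead to even
  matrices and the three that lead to odd matrices have equal sums.
\<close>

lemma birkhoff_not_smooth:
  fixes P M :: "(real ^ 'e) set" and \<alpha> :: "nat \<Rightarrow> nat \<Rightarrow> 'e::finite" and w o' :: "nat \<Rightarrow> real ^ 'e"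
  assumes conv: "convex P" and M: "\<And>x y. x \<in> M \<Longrightarrow> y \<in> M \<Longrightarrow> x - y \<in> M" "\<And>x a. x \<in> M \<Longrightarrow> x $ a \<in> \<int>"
    and ds: "\<And>x i j. x \<in> P \<Longrightarrow> i < 3 \<Longrightarrow> j < 3 \<Longrightarrow> 0 \<le> x $ \<alpha> i j"
      "\<And>x i. x \<in> P \<Longrightarrow> i < 3 \<Longrightarrow> x $ \<alpha> i 0 + x $ \<alpha> i 1 + x $ \<alpha> i 2 = 1"
      "\<And>x j. x \<in> P \<Longrightarrow> j < 3 \<Longrightarrow> x $ \<alpha> 0 j + x $ \<alpha> 1 j + x $ \<alpha> 2 j = 1"
    and inj: "\<And>x y. x \<in> P \<Longrightarrow> y \<in> P \<Longrightarrow> (\<And>i j. i < 3 \<Longrightarrow> j < 3 \<Longrightarrow> x $ \<alpha> i j = y $ \<alpha> i j) \<Longrightarrow> x = y"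
    and w: "\<And>k. k < 3 \<Longrightarrow> w k \<in> P \<inter> M" "\<And>k i j. k < 3 \<Longrightarrow> i < 3 \<Longrightarrow> j < 3 \<Longrightarrow> w k $ \<alpha> i j = even_perm k i j"
    and o': "\<And>k. k < 3 \<Longrightarrow> o' k \<in> P \<inter> M" "\<And>k i j. k < 3 \<Longrightarrow> i < 3 \<Longrightarrow> j < 3 \<Longrightarrow> o' k $ \<alpha> i j = odd_perm k i j"
    and sum: "w 0 + w 1 + w 2 = o' 0 + o' 1 + o' 2"
  shows "\<not> smooth_polytope M P"
proof
  assume smooth: "smooth_polytope M P"
  define v where "v = w 0"
  have v: "v \<in> P" "v \<in> M" "\<And>i j. i < 3 \<Longrightarrow> j < 3 \<Longrightarrow> v $ \<alpha> i j = even_perm 0 i j"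
    using w[of 0] unfolding v_def by auto
  have eq_v: "x = v" if x: "x \<in> P" and off: "\<And>i j. i < 3 \<Longrightarrow> j < 3 \<Longrightarrow> even_perm 0 i j = 0 \<Longrightarrow> x $ \<alpha> i j = 0" for x
  proof (rule inj[OF x v(1)])
    have z: "x $ \<alpha> 0 1 = 0" "x $ \<alpha> 0 2 = 0" "x $ \<alpha> 1 0 = 0" "x $ \<alpha> 1 2 = 0" "x $ \<alpha> 2 0 = 0" "x $ \<alpha> 2 1 = 0"
      by (rule off; simp add: even_perm_def)+
    have r: "x $ \<alpha> 0 0 + x $ \<alpha> 0 1 + x $ \<alpha> 0 2 = 1" "x $ \<alpha> 1 0 + x $ \<alpha> 1 1 + x $ \<alpha> 1 2 = 1"
      "x $ \<alpha> 2 0 + x $ \<alpha> 2 1 + x $ \<alpha> 2 2 = 1" by (rule ds(2)[OF x]; simp)+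
    have "\<forall>i<3. \<forall>j<3. x $ \<alpha> i j = even_perm 0 i j"
      using z r unfolding less3 by (simp add: even_perm_def)
    then show "x $ \<alpha> i j = v $ \<alpha> i j" if "i < 3" "j < 3" for i j using that v(3) by simp
  qed
  have "v extreme_point_of P"
    unfolding extreme_point_of_def
  proof (intro conjI ballI notI)
    fix a b assume ab: "a \<in> P" "b \<in> P" "v \<in> open_segment a b"
    then obtain s where s: "0 < s" "s < 1" "v = (1 - s) *\<^sub>R a + s *\<^sub>R b" and "a \<noteq> b" unfolding in_segment by blast
    have z: "a $ \<alpha> i j = 0 \<and> b $ \<alpha> i j = 0" if ij: "i < 3" "j < 3" "even_perm 0 i j = 0" for i j
    proof -
      have "(1 - s) * a $ \<alpha> i j + s * b $ \<alpha> i j = 0" using v(3)[OF ij(1,2)] ij(3) unfolding s(3) by simp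
      moreover have "0 \<le> (1 - s) * a $ \<alpha> i j" "0 \<le> s * b $ \<alpha> i j" using s ds(1) ab ij by simp_all
      ultimately have "(1 - s) * a $ \<alpha> i j = 0" "s * b $ \<alpha> i j = 0" by linarith+
      then show ?thesis using s by simp
    qed
    have "a = v" using z by (intro eq_v ab) blast
    moreover have "b = v" using z by (intro eq_v ab) blast
    ultimately show False using \<open>a \<noteq> b\<close> by simp
  qed (rule v(1))
  then have "part_of_lattice_basis M (ray_generators M (vertex_cone P v))"
    using smooth unfolding smooth_polytope_def smooth_vertex_def by blast
  then obtain B where B: "ray_generators M (vertex_cone P v) \<subseteq> B" "int_module.independent B"
    unfolding part_of_lattice_basis_def by blast
  let ?U = "[w 1, w 2, o' 0, o' 1, o' 2]"
  have R: "u - v \<in> ray_generators M (vertex_cone P v)"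
    if "u \<in> P" "u \<in> M" "\<And>i j. i < 3 \<Longrightarrow> j < 3 \<Longrightarrow> u $ \<alpha> i j = q i j"
      "q \<in> {even_perm 1, even_perm 2, odd_perm 0, odd_perm 1, odd_perm 2}" for u q
    by (rule birkhoff_ray_generator[where P = P and M = M and \<alpha> = \<alpha> and v = v and u = u and q = q])
      (fact conv M ds inj v that)+
  have "w k - v \<in> B" if k: "k = 1 \<or> k = 2" for k
  proof -
    have "k < 3" using k by auto
    have "w k - v \<in> ray_generators M (vertex_cone P v)"
      by (rule R[of "w k" "even_perm k"]) (use w(1)[OF \<open>k < 3\<close>] w(2)[OF \<open>k < 3\<close>] k in auto)
    then show ?thesis using B(1) by blast
  qed
  moreover have "o' k - v \<in> B" if "k < 3" for k
  proof -
    have k: "k = 0 \<or> k = 1 \<or> k = 2" using that by auto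
    have "o' k - v \<in> ray_generators M (vertex_cone P v)"
      by (rule R[of "o' k" "odd_perm k"]) (use o'(1)[OF that] o'(2)[OF that] k in auto)
    then show ?thesis using B(1) by blast
  qed
  ultimately have gens: "w 1 - v \<in> B" "w 2 - v \<in> B" "o' 0 - v \<in> B" "o' 1 - v \<in> B" "o' 2 - v \<in> B"
    by simp_all
  have dist: "distinct ?U"
  proof -
    let ?f = "\<lambda>x. (x $ \<alpha> 0 0, x $ \<alpha> 0 1, x $ \<alpha> 1 2, x $ \<alpha> 1 0)"
    have "distinct (map ?f ?U)"
      by (simp add: w(2) o'(2) even_perm_def odd_perm_def)
    then show ?thesis unfolding distinct_map by blast
  qed
  \<comment> \<open>The coefficients of the relation: the even matrices count with sign 1, the odd ones with sign -1.\<close>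
  define c where "c x = (if x \<in> {w 1 - v, w 2 - v} then 1 else -1 :: int)" for x
  let ?D = "{w 1 - v, w 2 - v, o' 0 - v, o' 1 - v, o' 2 - v}"
  have "(\<Sum>x\<in>?D. real_of_int (c x) *\<^sub>R x) = (w 1 - v) + (w 2 - v) - (o' 0 - v) - (o' 1 - v) - (o' 2 - v)"
  proof -
    have "c (w 1 - v) = 1" "c (w 2 - v) = 1" "c (o' 0 - v) = -1" "c (o' 1 - v) = -1" "c (o' 2 - v) = -1"
      using dist unfolding c_def by auto
    then show ?thesis using dist by simp
  qed
  also have "\<dots> = (w 0 + w 1 + w 2) - (o' 0 + o' 1 + o' 2)" unfolding v_def by simp
  also have "\<dots> = 0" using sum by simp
  finally have "(\<Sum>x\<in>?D. real_of_int (c x) *\<^sub>R x) = 0" .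
  moreover have "?D \<subseteq> B" using gens by simp
  moreover have "c (w 1 - v) \<noteq> 0" unfolding c_def by simp
  ultimately have "int_module.dependent B"
    unfolding int_module.dependent_explicit by (intro exI[of _ ?D] exI[of _ c]) auto
  with B(2) show False by blast
qed

section \<open>Quiver polytopes\<close>

text \<open>
  The arrows that are not forced to vanish on the polytope.  Circulations supported on them are exactly
  the directions in which a point of the relative interior can be moved.
\<close>

definition moving_arrows :: "('v, 'e::finite) pre_digraph \<Rightarrow> ('v \<Rightarrow> int) \<Rightarrow> 'e set" where
  "moving_arrows Q \<theta> = {a \<in> arcs Q. \<exists>x \<in> quiver_polytope Q \<theta>. 0 < x $ a}"

lemma quiver_polytope_eq:
  "quiver_polytope Q \<theta> = {x. (\<forall>a. a \<notin> arcs Q \<longrightarrow> x $ a = 0) \<and> (\<forall>a \<in> arcs Q. 0 \<le> x $ a) \<and>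
     (\<forall>v \<in> verts Q. (\<Sum>a\<in>arcs Q. x $ a * (of_bool (head Q a = v) - of_bool (tail Q a = v))) = real_of_int (\<theta> v))}"
  unfolding quiver_polytope_def arrow_space_def net_flow_eq by auto

lemma circulations_eq:
  "circulations Q A = {y. (\<forall>a. a \<notin> A \<longrightarrow> y $ a = 0) \<and>
     (\<forall>v \<in> verts Q. (\<Sum>a\<in>arcs Q. y $ a * (of_bool (head Q a = v) - of_bool (tail Q a = v))) = 0)}"
  unfolding circulations_def net_flow_eq ..

lemma not_moving: "x \<in> quiver_polytope Q \<theta> \<Longrightarrow> a \<notin> moving_arrows Q \<theta> \<Longrightarrow> x $ a = 0"
proof (cases "a \<in> arcs Q")
  case True
  assume "x \<in> quiver_polytope Q \<theta>" "a \<notin> moving_arrows Q \<theta>"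
  then have "\<not> 0 < x $ a" "0 \<le> x $ a" using True unfolding moving_arrows_def quiver_polytope_eq by blast+
  then show ?thesis by simp
qed (simp add: quiver_polytope_eq)

lemma polytope_difference:
  assumes "x \<in> quiver_polytope Q \<theta>" "y \<in> quiver_polytope Q \<theta>"
  shows "x - y \<in> circulations Q (moving_arrows Q \<theta>)"
proof -
  have "(x - y) $ a = 0" if "a \<notin> moving_arrows Q \<theta>" for a
    using not_moving[OF assms(1) that] not_moving[OF assms(2) that] by simp
  then show ?thesis
    using assms unfolding circulations_eq quiver_polytope_eq by (simp add: left_diff_distrib sum_subtractf)
qed

lemma polytope_translate:
  assumes "x \<in> quiver_polytope Q \<theta>" "d \<in> circulations Q A" "A \<subseteq> arcs Q" "\<And>a. a \<in> A \<Longrightarrow> 0 \<le> x $ a + d $ a"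
  shows "x + d \<in> quiver_polytope Q \<theta>"
proof -
  have d: "d $ a = 0" if "a \<notin> A" for a using assms(2) that unfolding circulations_eq by blast
  have "0 \<le> (x + d) $ a" if "a \<in> arcs Q" for a
    using assms(1,4) d[of a] that unfolding quiver_polytope_eq by (cases "a \<in> A") auto
  moreover have "(x + d) $ a = 0" if "a \<notin> arcs Q" for a
    using assms(1,3) d[of a] that unfolding quiver_polytope_eq by auto
  ultimately show ?thesis
    using assms(1,2) unfolding circulations_eq quiver_polytope_eq by (simp add: distrib_right sum.distrib)
qed

lemma convex_quiver_polytope: "convex (quiver_polytope Q \<theta>)"
proof (rule convexI)
  fix x y and s t :: real
  assume xy: "x \<in> quiver_polytope Q \<theta>" "y \<in> quiver_polytope Q \<theta>" and st: "0 \<le> s" "0 \<le> t" "s + t = 1"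
  have "(\<Sum>a\<in>arcs Q. (s *\<^sub>R x + t *\<^sub>R y) $ a * (of_bool (head Q a = v) - of_bool (tail Q a = v))) = real_of_int (\<theta> v)"
    if "v \<in> verts Q" for v
  proof -
    have "(\<Sum>a\<in>arcs Q. (s *\<^sub>R x + t *\<^sub>R y) $ a * (of_bool (head Q a = v) - of_bool (tail Q a = v)))
      = s * (\<Sum>a\<in>arcs Q. x $ a * (of_bool (head Q a = v) - of_bool (tail Q a = v)))
      + t * (\<Sum>a\<in>arcs Q. y $ a * (of_bool (head Q a = v) - of_bool (tail Q a = v)))"
      by (simp add: sum_distrib_left distrib_right sum.distrib mult.assoc)
    also have "\<dots> = s * \<theta> v + t * \<theta> v" using xy that unfolding quiver_polytope_eq by simp
    also have "\<dots> = \<theta> v" using st(3) by (metis distrib_right mult_1)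
    finally show ?thesis .
  qed
  then show "s *\<^sub>R x + t *\<^sub>R y \<in> quiver_polytope Q \<theta>"
    using xy st unfolding quiver_polytope_eq by simp
qed

lemma polytope_interior_point:
  assumes "quiver_polytope Q \<theta> \<noteq> {}"
  obtains x where "x \<in> quiver_polytope Q \<theta>" "\<And>a. a \<in> moving_arrows Q \<theta> \<Longrightarrow> 0 < x $ a"
proof -
  let ?P = "quiver_polytope Q \<theta>"
  define supp :: "real ^ 'a \<Rightarrow> 'a set" where "supp x = {a. 0 < x $ a}" for x
  have bound: "\<forall>x. x \<in> ?P \<longrightarrow> card (supp x) < Suc (CARD('a))"
    by (simp add: card_mono less_Suc_eq_le)
  obtain x where x: "x \<in> ?P" "\<forall>y. y \<in> ?P \<longrightarrow> card (supp y) \<le> card (supp x)"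
    using ex_has_greatest_nat[of "\<lambda>x. x \<in> ?P" _ "\<lambda>x. card (supp x)", OF _ bound] assms by blast
  have "0 < x $ a" if a: "a \<in> moving_arrows Q \<theta>" for a
  proof (rule ccontr)
    assume "\<not> 0 < x $ a"
    obtain y where y: "y \<in> ?P" "0 < y $ a" using a unfolding moving_arrows_def by blast
    let ?z = "(1 / 2) *\<^sub>R x + (1 / 2) *\<^sub>R y"
    have "?z \<in> ?P" using convexD[OF convex_quiver_polytope x(1) y(1), of "1 / 2" "1 / 2"] by simp
    have nn: "0 \<le> x $ b" "0 \<le> y $ b" for b
      using x(1) y(1) unfolding quiver_polytope_eq by (cases "b \<in> arcs Q"; force)+
    have "supp x \<subset> supp ?z"
    proof
      show "supp x \<subseteq> supp ?z" using nn(2) unfolding supp_def by (auto intro: add_pos_nonneg)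
      have "a \<in> supp ?z" "a \<notin> supp x" using y(2) nn(1)[of a] \<open>\<not> 0 < x $ a\<close> unfolding supp_def by (auto intro: add_nonneg_pos)
      then show "supp x \<noteq> supp ?z" by blast
    qed
    then have "card (supp x) < card (supp ?z)" by (intro psubset_card_mono) simp_all
    with x(2) \<open>?z \<in> ?P\<close> show False by fastforce
  qed
  with x(1) that show thesis by blast
qed

text \<open>
  A small multiple of any circulation can be added to a point that is positive on all moving
  arrows.
\<close>

lemma dim_circulations_le:
  assumes "quiver_polytope Q \<theta> \<noteq> {}"
  shows "int (dim (circulations Q (moving_arrows Q \<theta>))) \<le> aff_dim (quiver_polytope Q \<theta>)"
proof -
  let ?P = "quiver_polytope Q \<theta>" and ?A = "moving_arrows Q \<theta>"
  obtain x where x: "x \<in> ?P" "\<And>a. a \<in> ?A \<Longrightarrow> 0 < x $ a" using polytope_interior_point[OF assms] by blast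
  let ?W = "(+) (- x) ` ?P"
  \<comment> \<open>The 1 makes the minimum meaningful when there are no moving arrows.\<close>
  define m where "m = Min (insert 1 ((\<lambda>a. x $ a) ` ?A))"
  have m: "0 < m" "\<And>a. a \<in> ?A \<Longrightarrow> m \<le> x $ a" unfolding m_def using x(2) by (subst Min_gr_iff) auto
  have "d \<in> span ?W" if d: "d \<in> circulations Q ?A" for d
  proof -
    define t where "t = m / (norm d + 1)"
    have n: "0 < norm d + 1" using norm_ge_zero[of d] by linarith
    have "0 < t" using m(1) n unfolding t_def by simp
    have "x + t *\<^sub>R d \<in> ?P"
    proof (rule polytope_translate[OF x(1)])
      show "t *\<^sub>R d \<in> circulations Q ?A" using d subspace_circulations by (metis subspace_scale)
      show "?A \<subseteq> arcs Q" unfolding moving_arrows_def by blast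
      fix a assume "a \<in> ?A"
      have "\<bar>d $ a\<bar> \<le> norm d + 1" using component_le_norm_cart[of d a] by simp
      then have "t * \<bar>d $ a\<bar> \<le> t * (norm d + 1)" using \<open>0 < t\<close> by (intro mult_left_mono) simp_all
      also have "\<dots> = m" unfolding t_def using n by simp
      finally have "\<bar>t * d $ a\<bar> \<le> m" using \<open>0 < t\<close> by (simp add: abs_mult)
      then show "0 \<le> x $ a + (t *\<^sub>R d) $ a" using m(2)[OF \<open>a \<in> ?A\<close>] by simp
    qed
    then have "- x + (x + t *\<^sub>R d) \<in> ?W" by blast
    then have "t *\<^sub>R d \<in> span ?W" by (intro span_base) simp
    then have "(1 / t) *\<^sub>R (t *\<^sub>R d) \<in> span ?W" by (rule span_scale)
    then show ?thesis using \<open>0 < t\<close> by simp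
  qed
  then have "dim (circulations Q ?A) \<le> dim (span ?W)" by (intro dim_subset) blast
  also have "\<dots> = dim ?W" by (rule dim_span)
  finally show ?thesis using aff_dim_eq_dim[of x ?P] x(1) by (simp add: hull_inc)
qed

text \<open>
  A circulation basis has at most four members, which are numbered by \<open>\<iota>\<close>.  When there are fewer, the
  unused coordinates of $\mathbb{Z}^4$ are kept in the system of functionals and constrained to be zero,
  so that the classification applies in rank exactly four.
\<close>

lemma quad_connected_smooth_quiver_polytope:
  fixes Q :: "('v, 'e::finite) pre_digraph" and \<theta> :: "'v \<Rightarrow> int"
  assumes Q: "fin_digraph Q"
    and smooth: "smooth_polytope (arrow_lattice Q) (quiver_polytope Q \<theta>)"
    and dim: "aff_dim (quiver_polytope Q \<theta>) \<le> 4"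
  shows "quad_connected (quiver_polytope Q \<theta> \<inter> arrow_lattice Q)"
proof (cases "quiver_polytope Q \<theta> \<inter> arrow_lattice Q = {}")
  case True
  then show ?thesis unfolding quad_connected_def by simp
next
  case False
  define P M A V where "P = quiver_polytope Q \<theta>" and "M = arrow_lattice Q"
    and "A = moving_arrows Q \<theta>" and "V = circulations Q (moving_arrows Q \<theta>)"
  obtain x0 where x0: "x0 \<in> P" "x0 \<in> M" using False unfolding P_def M_def by blast
  have A: "A \<subseteq> arcs Q" unfolding A_def moving_arrows_def by blast
  have subV: "subspace V" unfolding V_def by (rule subspace_circulations)
  have V0: "y $ a = 0" if "y \<in> V" "a \<notin> A" for y a
    using that unfolding V_def A_def circulations_eq by blast
  have M_int: "x $ a \<in> \<int>" if "x \<in> M" for x a using that unfolding M_def arrow_lattice_def by blast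
  have M_diff: "x - y \<in> M" if "x \<in> M" "y \<in> M" for x y
    using that unfolding M_def arrow_lattice_def arrow_space_def by simp
  define x0i where "x0i a = \<lfloor>x0 $ a\<rfloor>" for a
  have x0i: "real_of_int (x0i a) = x0 $ a" for a using M_int[OF x0(2), of a] unfolding x0i_def by (auto elim: Ints_cases)

  obtain B \<beta> where B: "B \<subseteq> A" "\<And>y. y \<in> V \<Longrightarrow> (\<And>b. b \<in> B \<Longrightarrow> y $ b = 0) \<Longrightarrow> y = 0"
    "\<And>b. b \<in> B \<Longrightarrow> \<beta> b \<in> V" "\<And>b a. b \<in> B \<Longrightarrow> \<beta> b $ a \<in> {-1, 0, 1}"
    "\<And>b b'. b \<in> B \<Longrightarrow> b' \<in> B \<Longrightarrow> \<beta> b $ b' = (if b' = b then 1 else 0)"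
    "card B \<le> dim V"
    using circulation_basis[OF Q A] unfolding V_def A_def[symmetric] by blast
  have "int (dim V) \<le> 4"
    using dim_circulations_le[of Q \<theta>] dim x0(1) unfolding V_def P_def by fastforce
  then have "card B \<le> card (UNIV :: 4 set)" using B(6) by simp
  then obtain \<iota> :: "'e \<Rightarrow> 4" where \<iota>: "inj_on \<iota> B" using card_le_inj[of B "UNIV :: 4 set"] by auto
  define I where "I = \<iota> ` B"
  define \<gamma> where "\<gamma> i = (if i \<in> I then \<beta> (inv_into B \<iota> i) else 0)" for i
  have \<gamma>\<iota>: "\<gamma> (\<iota> b) = \<beta> b" if "b \<in> B" for b using that \<iota> unfolding \<gamma>_def I_def by simp
  have \<gamma>V: "\<gamma> i \<in> V" for i
    using B(3) subspace_0[OF subV] unfolding \<gamma>_def I_def by (auto simp: inv_into_into)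
  have \<gamma>1: "\<gamma> i $ a \<in> {-1, 0, 1}" for i a
    using B(4)[of "inv_into B \<iota> i" a] unfolding \<gamma>_def I_def by (auto simp: inv_into_into)
  have \<gamma>b: "\<gamma> i $ b = (if i = \<iota> b then 1 else 0)" if b: "b \<in> B" for i b
  proof (cases "i \<in> I")
    case True
    then obtain b' where b': "b' \<in> B" "i = \<iota> b'" unfolding I_def by blast
    then show ?thesis using \<gamma>\<iota>[OF b'(1)] B(5)[OF b'(1) b] inj_on_eq_iff[OF \<iota> b'(1) b] by auto
  next
    case False
    then show ?thesis using b unfolding \<gamma>_def I_def by auto
  qed
  define c where "c i a = \<lfloor>\<gamma> i $ a\<rfloor>" for i a
  have c: "real_of_int (c i a) = \<gamma> i $ a" for i a
  proof -
    have "\<gamma> i $ a \<in> \<int>" using \<gamma>1[of i a] by auto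
    then show ?thesis unfolding c_def by (simp add: of_int_floor_cancel)
  qed
  define h :: "int ^ 4 \<Rightarrow> real ^ 'e" where "h z = (\<Sum>i\<in>UNIV. real_of_int (z $ i) *\<^sub>R \<gamma> i)" for z
  define \<phi> :: "'e \<Rightarrow> int ^ 4 \<Rightarrow> int" where "\<phi> a z = (\<Sum>i\<in>UNIV. z $ i * c i a)" for a z
  have h\<phi>: "h z $ a = real_of_int (\<phi> a z)" for z a unfolding h_def \<phi>_def by (simp add: c)
  have hV: "h z \<in> V" for z unfolding h_def by (intro subspace_sum[OF subV] subspace_scale[OF subV] \<gamma>V)
  have h_add: "h (x + y) = h x + h y" for x y unfolding h_def by (simp add: scaleR_add_left sum.distrib)
  have \<phi>_add: "\<phi> a (x + y) = \<phi> a x + \<phi> a y" for a x y unfolding \<phi>_def by (simp add: distrib_right sum.distrib)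
  have \<phi>B: "\<phi> b z = z $ \<iota> b" if "b \<in> B" for b z
  proof -
    have "c i b = (if i = \<iota> b then 1 else 0)" for i using \<gamma>b[OF that, of i] unfolding c_def by simp
    then have "z $ i * c i b = (if i = \<iota> b then z $ i else 0)" for i by simp
    then show ?thesis unfolding \<phi>_def by simp
  qed
  define G where "G = {z :: int ^ 4. \<forall>i. i \<notin> I \<longrightarrow> z $ i = 0}"
  have integral: "\<exists>z\<in>G. h z = y" if y: "y \<in> V" "\<And>b. b \<in> B \<Longrightarrow> y $ b \<in> \<int>" for y
  proof -
    define z :: "int ^ 4" where "z = (\<chi> i. if i \<in> I then \<lfloor>y $ inv_into B \<iota> i\<rfloor> else 0)"
    have "h z - y = 0"
    proof (rule B(2))
      show "h z - y \<in> V" using subV hV y(1) by (rule subspace_diff)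
      fix b assume b: "b \<in> B"
      have "real_of_int \<lfloor>y $ b\<rfloor> = y $ b" using y(2)[OF b] by (auto elim: Ints_cases)
      then show "(h z - y) $ b = 0" using b \<iota> by (simp add: h\<phi> \<phi>B[OF b] z_def I_def)
    qed
    moreover have "z \<in> G" unfolding G_def z_def by simp
    ultimately show ?thesis by auto
  qed
  have inj_h: "inj_on h G"
  proof (rule inj_onI)
    fix x y assume xy: "x \<in> G" "y \<in> G" "h x = h y"
    have "x $ i = y $ i" for i
    proof (cases "i \<in> I")
      case True
      then obtain b where b: "b \<in> B" "i = \<iota> b" unfolding I_def by blast
      have "real_of_int (\<phi> b x) = real_of_int (\<phi> b y)" using xy(3) by (metis h\<phi>)
      then show ?thesis using b \<phi>B by simp
    qed (use xy in \<open>simp add: G_def\<close>)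
    then show "x = y" by (simp add: vec_eq_iff)
  qed
  \<comment> \<open>The coordinates \<open>z $ i\<close> with \<open>i \<in> I\<close> are arrows of the basis; the others are the padding.\<close>
  define F where "F = (\<Union>a\<in>A. {\<phi> a, \<lambda>z. - \<phi> a z}) \<union> (\<Union>i. {\<lambda>z. z $ i, \<lambda>z. - z $ i})"
  interpret regular_functionals F
  proof
    fix f x y assume "f \<in> F"
    then show "f (x + y) = f x + f y" unfolding F_def by (auto simp: \<phi>_add)
  next
    fix f assume "f \<in> F"
    then show "(\<lambda>x. - f x) \<in> F" unfolding F_def by auto
  next
    fix z :: "int ^ 4" assume "z \<noteq> 0"
    have "\<exists>y. y \<noteq> 0 \<and> (\<forall>a\<in>A. \<phi> a y \<in> {-1, 0, 1} \<and> (\<phi> a z = 0 \<longrightarrow> \<phi> a y = 0) \<and> 0 \<le> \<phi> a y * \<phi> a z) \<and>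
      (\<forall>i. y $ i \<in> {-1, 0, 1} \<and> (z $ i = 0 \<longrightarrow> y $ i = 0) \<and> 0 \<le> y $ i * z $ i)"
    proof (cases "z \<in> G")
      case False
      then obtain i where i: "i \<notin> I" "z $ i \<noteq> 0" unfolding G_def by blast
      define y :: "int ^ 4" where "y = (\<chi> j. if j = i then sgn (z $ i) else 0)"
      have "c i a = 0" for a using i(1) unfolding c_def \<gamma>_def by simp
      then have "\<phi> a y = 0" for a unfolding \<phi>_def y_def by (simp add: if_distrib[of "\<lambda>x. x * _"] cong: if_cong)
      moreover have "y $ j \<in> {-1, 0, 1} \<and> (z $ j = 0 \<longrightarrow> y $ j = 0) \<and> 0 \<le> y $ j * z $ j" for j
        unfolding y_def using i(2) by (auto simp: sgn_if)
      moreover have "y \<noteq> 0" using i(2) unfolding y_def by (auto simp: vec_eq_iff sgn_eq_0_iff)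
      ultimately show ?thesis by (intro exI[of _ y] conjI ballI allI) simp_all
    next
      case True
      have "h z \<noteq> 0"
      proof
        assume "h z = 0"
        then have "h z = h 0" unfolding h_def by simp
        then show False using inj_h True \<open>z \<noteq> 0\<close> unfolding inj_on_def G_def by simp
      qed
      then obtain y' where y': "y' \<in> V" "y' \<noteq> 0"
        "\<And>a. y' $ a \<in> {-1, 0, 1} \<and> (h z $ a = 0 \<longrightarrow> y' $ a = 0) \<and> 0 \<le> y' $ a * h z $ a"
        using conformal_circulation[OF Q A, of "h z"] hV unfolding V_def A_def by blast
      have "y' $ b \<in> \<int>" for b using y'(3)[of b] by auto
      then obtain y where y: "y \<in> G" "h y = y'" using integral[OF y'(1)] by blast
      have \<phi>y: "\<phi> a y \<in> {-1, 0, 1} \<and> (\<phi> a z = 0 \<longrightarrow> \<phi> a y = 0) \<and> 0 \<le> \<phi> a y * \<phi> a z" for a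
      proof -
        have hy: "y' $ a = real_of_int (\<phi> a y)" unfolding y(2)[symmetric] h\<phi> ..
        have "\<exists>m\<in>{-1, 0, 1}. y' $ a = real_of_int m" using y'(3)[of a] by auto
        then have "\<phi> a y \<in> {-1, 0, 1}" unfolding hy by (simp only: of_int_eq_iff) blast
        moreover have "\<phi> a z = 0 \<longrightarrow> \<phi> a y = 0" using y'(3)[of a] unfolding hy h\<phi> by simp
        moreover have "0 \<le> real_of_int (\<phi> a y) * real_of_int (\<phi> a z)" using y'(3)[of a] unfolding hy h\<phi> by blast
        then have "0 \<le> \<phi> a y * \<phi> a z" by (metis of_int_0_le_iff of_int_mult)
        ultimately show ?thesis by blast
      qed
      moreover have "y $ i \<in> {-1, 0, 1} \<and> (z $ i = 0 \<longrightarrow> y $ i = 0) \<and> 0 \<le> y $ i * z $ i" for i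
      proof (cases "i \<in> I")
        case True
        then obtain b where b: "b \<in> B" "i = \<iota> b" unfolding I_def by blast
        show ?thesis unfolding b(2) using \<phi>y[of b] unfolding \<phi>B[OF b(1)] .
      next
        case False
        then show ?thesis using y(1) unfolding G_def by simp
      qed
      moreover have "y \<noteq> 0" using y(2) y'(2) unfolding h_def by auto
      ultimately show ?thesis by blast
    qed
    then obtain y where y: "y \<noteq> 0" "\<And>a. a \<in> A \<Longrightarrow> \<phi> a y \<in> {-1, 0, 1} \<and> (\<phi> a z = 0 \<longrightarrow> \<phi> a y = 0) \<and> 0 \<le> \<phi> a y * \<phi> a z"
      "\<And>i. y $ i \<in> {-1, 0, 1} \<and> (z $ i = 0 \<longrightarrow> y $ i = 0) \<and> 0 \<le> y $ i * z $ i" by blast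
    have "f y \<in> {-1, 0, 1} \<and> (f z = 0 \<longrightarrow> f y = 0) \<and> 0 \<le> f y * f z" if fF: "f \<in> F" for f
    proof -
      consider a where "a \<in> A" "f = \<phi> a \<or> f = (\<lambda>z. - \<phi> a z)" | i where "f = (\<lambda>z. z $ i) \<or> f = (\<lambda>z. - z $ i)"
        using fF unfolding F_def by blast
      then show ?thesis
      proof cases
        case 1
        from 1(2) y(2)[OF 1(1)] show ?thesis by (elim disjE) auto
      next
        case 2
        with y(3)[of i] show ?thesis by (elim disjE) auto
      qed
    qed
    with y(1) show "\<exists>y. y \<noteq> 0 \<and> (\<forall>f\<in>F. f y \<in> {-1, 0, 1} \<and> (f z = 0 \<longrightarrow> f y = 0) \<and> 0 \<le> f y * f z)" by blast
  qed
  have frame: "frame (\<lambda>z. z $ 1) (\<lambda>z. z $ 2) (\<lambda>z. z $ 3) (\<lambda>z. z $ 4)"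
    unfolding frame_def coords_def
  proof (intro conjI allI)
    fix i j k l :: int
    have "(\<chi> m. if m = 1 then i else if m = 2 then j else if m = 3 then k else l :: int ^ 4) $ 1 = i \<and>
      (\<chi> m. if m = 1 then i else if m = 2 then j else if m = 3 then k else l :: int ^ 4) $ 2 = j \<and>
      (\<chi> m. if m = 1 then i else if m = 2 then j else if m = 3 then k else l :: int ^ 4) $ 3 = k \<and>
      (\<chi> m. if m = 1 then i else if m = 2 then j else if m = 3 then k else l :: int ^ 4) $ 4 = l"
      by simp
    then show "\<exists>x :: int ^ 4. x $ 1 = i \<and> x $ 2 = j \<and> x $ 3 = k \<and> x $ 4 = l" by blast
  next
    show "x $ 1 = 0 \<and> x $ 2 = 0 \<and> x $ 3 = 0 \<and> x $ 4 = 0 \<longrightarrow> x = 0" for x :: "int ^ 4"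
      by (simp add: vec_eq_iff forall_4)
  qed (auto simp: F_def)
  define K where "K = (\<Union>a\<in>A. {(\<phi> a, - x0i a)}) \<union> (\<Union>i\<in>-I. {(\<lambda>z. z $ i, 0), (\<lambda>z. - z $ i, 0)})"
  have KF: "K \<subseteq> F \<times> UNIV" unfolding K_def F_def by auto
  have sol: "z \<in> solutions K \<longleftrightarrow> z \<in> G \<and> (\<forall>a\<in>A. 0 \<le> x0i a + \<phi> a z)" for z
  proof -
    have "z \<in> solutions K \<longleftrightarrow> (\<forall>a\<in>A. - x0i a \<le> \<phi> a z) \<and> (\<forall>i\<in>-I. 0 \<le> z $ i \<and> 0 \<le> - z $ i)"
      unfolding solutions_def K_def by (auto simp: ball_Un ball_UN)
    also have "\<dots> \<longleftrightarrow> z \<in> G \<and> (\<forall>a\<in>A. 0 \<le> x0i a + \<phi> a z)" unfolding G_def by force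
    finally show ?thesis .
  qed
  have in_PM: "x0 + h z \<in> P \<inter> M" if z: "z \<in> solutions K" for z
  proof
    have "0 \<le> x0 $ a + h z $ a" if "a \<in> A" for a
    proof -
      have "0 \<le> x0i a + \<phi> a z" using z sol that by blast
      then have "0 \<le> real_of_int (x0i a + \<phi> a z)" by (simp only: of_int_0_le_iff)
      then show ?thesis by (simp add: x0i h\<phi>)
    qed
    then show P: "x0 + h z \<in> P"
      using polytope_translate[of x0 Q \<theta> "h z" A] x0(1) hV[of z] A unfolding P_def V_def A_def by blast
    have "(x0 + h z) $ a \<in> \<int>" for a using M_int[OF x0(2), of a] by (simp add: h\<phi>)
    moreover have "x0 + h z \<in> arrow_space Q" using P unfolding P_def quiver_polytope_def by blast
    ultimately show "x0 + h z \<in> M" unfolding M_def arrow_lattice_def by blast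
  qed
  have image: "(\<lambda>z. x0 + h z) ` solutions K = P \<inter> M"
  proof
    show "(\<lambda>z. x0 + h z) ` solutions K \<subseteq> P \<inter> M" using in_PM by blast
    show "P \<inter> M \<subseteq> (\<lambda>z. x0 + h z) ` solutions K"
    proof
      fix x assume x: "x \<in> P \<inter> M"
      have "x - x0 \<in> V" using polytope_difference[of x Q \<theta> x0] x x0(1) unfolding P_def V_def by blast
      moreover have "(x - x0) $ b \<in> \<int>" for b using M_int[OF M_diff[of x x0]] x x0(2) by blast
      ultimately obtain z where z: "z \<in> G" "h z = x - x0" using integral by blast
      have "0 \<le> x0i a + \<phi> a z" if "a \<in> A" for a
      proof -
        have "0 \<le> x $ a" using x A that unfolding P_def quiver_polytope_def by blast
        also have "x $ a = real_of_int (x0i a + \<phi> a z)" using z(2) h\<phi>[of z a] by (simp add: x0i)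
        finally show ?thesis by simp
      qed
      then have "z \<in> solutions K" using sol z(1) by blast
      moreover have "x = x0 + h z" using z(2) by simp
      ultimately show "x \<in> (\<lambda>z. x0 + h z) ` solutions K" by blast
    qed
  qed
  have "\<not> birkhoff K"
  proof
    assume "birkhoff K"
    obtain T n e o' where T: "table T" and *: "\<forall>i<3. \<forall>j<3. (T i j, n i j) \<in> K"
      "\<forall>k<3. e k \<in> solutions K \<and> o' k \<in> solutions K \<and>
        (\<forall>i<3. \<forall>j<3. T i j (e k) - n i j = even_perm k i j \<and> T i j (o' k) - n i j = odd_perm k i j)"
    proof -
      from \<open>birkhoff K\<close>[unfolded birkhoff_def] show ?thesis
        by (elim exE conjE) (rule that)
    qed
    have TK: "(T i j, n i j) \<in> K" if "i < 3" "j < 3" for i j using *(1) that by blast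
    have eo: "e k \<in> solutions K" "o' k \<in> solutions K" if "k < 3" for k using *(2) that by blast+
    have te: "T i j (e k) - n i j = even_perm k i j" and to: "T i j (o' k) - n i j = odd_perm k i j"
      if "i < 3" "j < 3" "k < 3" for i j k using *(2) that by blast+
    note TF = tableD(1)[OF T] and T_rows = tableD(2)[OF T] and T_cols = tableD(3)[OF T]
    have "\<exists>a\<in>A. T i j = \<phi> a \<and> n i j = - x0i a" if ij: "i < 3" "j < 3" for i j
    proof (rule ccontr)
      assume "\<not> ?thesis"
      then obtain l where l: "l \<notin> I" "T i j = (\<lambda>z. z $ l) \<or> T i j = (\<lambda>z. - z $ l)"
        using TK[OF ij] unfolding K_def by auto
      have "T i j (e k) = 0" if "k < 3" for k
        using eo(1)[OF that] l unfolding sol G_def by auto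
      moreover obtain k where k: "k < 3" "even_perm k i j = 0" using even_perm_values by blast
      moreover obtain k' where k': "k' < 3" "even_perm k' i j = 1" using even_perm_values by blast
      ultimately show False using te[OF ij k(1)] te[OF ij k'(1)] by simp
    qed
    then obtain \<alpha> where \<alpha>: "\<And>i j. i < 3 \<Longrightarrow> j < 3 \<Longrightarrow> \<alpha> i j \<in> A \<and> T i j = \<phi> (\<alpha> i j) \<and> n i j = - x0i (\<alpha> i j)" by metis
    have span: "\<exists>\<xi>. \<forall>a. x $ a - x0 $ a = (\<Sum>k\<in>UNIV. \<xi> k * real_of_int (c k a))" if x: "x \<in> P" for x
    proof -
      have xV: "x - x0 \<in> V" using polytope_difference[of x Q \<theta> x0] x x0(1) unfolding P_def V_def by blast
      define \<xi> where "\<xi> k = (if k \<in> I then (x - x0) $ inv_into B \<iota> k else 0)" for k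
      have "(\<Sum>k\<in>UNIV. \<xi> k *\<^sub>R \<gamma> k) - (x - x0) = 0"
      proof (rule B(2))
        show "(\<Sum>k\<in>UNIV. \<xi> k *\<^sub>R \<gamma> k) - (x - x0) \<in> V"
          by (intro subspace_diff[OF subV] subspace_sum[OF subV] subspace_scale[OF subV] \<gamma>V xV)
        fix b assume b: "b \<in> B"
        have "(\<Sum>k\<in>UNIV. \<xi> k *\<^sub>R \<gamma> k) $ b = \<xi> (\<iota> b)"
          by (simp add: \<gamma>b[OF b] if_distrib[of "\<lambda>x. _ * x"] cong: if_cong)
        also have "\<dots> = (x - x0) $ b" using b \<iota> unfolding \<xi>_def I_def by simp
        finally show "((\<Sum>k\<in>UNIV. \<xi> k *\<^sub>R \<gamma> k) - (x - x0)) $ b = 0" by simp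
      qed
      then have "x - x0 = (\<Sum>k\<in>UNIV. \<xi> k *\<^sub>R \<gamma> k)" by simp
      then have "(x - x0) $ a = (\<Sum>k\<in>UNIV. \<xi> k *\<^sub>R \<gamma> k) $ a" for a by simp
      then have "\<forall>a. x $ a - x0 $ a = (\<Sum>k\<in>UNIV. \<xi> k * real_of_int (c k a))" by (simp add: c)
      then show ?thesis by blast
    qed
    have c\<phi>: "c k a = \<phi> a (axis k 1)" for k a
      unfolding \<phi>_def axis_def by (simp add: if_distrib[of "\<lambda>x. x * _"] cong: if_cong)
    have n_sums: "n i 0 + n i 1 + n i 2 = -1" "n 0 i + n 1 i + n 2 i = -1" if i: "i < 3" for i
    proof -
      have p: "even_perm 0 i 0 + even_perm 0 i 1 + even_perm 0 i 2 = 1" "even_perm 0 0 i + even_perm 0 1 i + even_perm 0 2 i = 1"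
      proof -
        have "i = 0 \<or> i = 1 \<or> i = 2" using i by auto
        then show "even_perm 0 i 0 + even_perm 0 i 1 + even_perm 0 i 2 = 1" "even_perm 0 0 i + even_perm 0 1 i + even_perm 0 2 i = 1"
          by (elim disjE; simp add: even_perm_def)+
      qed
      have lt: "0 < (3::nat)" "1 < (3::nat)" "2 < (3::nat)" by simp_all
      show "n i 0 + n i 1 + n i 2 = -1"
        using T_rows[OF i, of "e 0"] te[OF i lt(1) lt(1)] te[OF i lt(2) lt(1)] te[OF i lt(3) lt(1)] p(1) by linarith
      show "n 0 i + n 1 i + n 2 i = -1"
        using T_cols[OF i, of "e 0"] te[OF lt(1) i lt(1)] te[OF lt(2) i lt(1)] te[OF lt(3) i lt(1)] p(2) by linarith
    qed
    have line: "x $ a + x $ b + x $ d = 1"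
      if x: "x \<in> P" and z: "\<And>z. \<phi> a z + \<phi> b z + \<phi> d z = 0" and s: "x0i a + x0i b + x0i d = 1" for x a b d
    proof -
      obtain \<xi> where \<xi>: "\<forall>a. x $ a - x0 $ a = (\<Sum>k\<in>UNIV. \<xi> k * real_of_int (c k a))" using span[OF x] by blast
      have "(\<Sum>k\<in>UNIV. \<xi> k * real_of_int (c k a)) + (\<Sum>k\<in>UNIV. \<xi> k * real_of_int (c k b)) + (\<Sum>k\<in>UNIV. \<xi> k * real_of_int (c k d))
        = (\<Sum>k\<in>UNIV. \<xi> k * real_of_int (\<phi> a (axis k 1) + \<phi> b (axis k 1) + \<phi> d (axis k 1)))"
        by (simp add: c\<phi> sum.distrib distrib_left)
      also have "\<dots> = 0" by (simp only: z) simp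
      finally have "(x $ a - x0 $ a) + (x $ b - x0 $ b) + (x $ d - x0 $ d) = 0" using \<xi> by simp
      moreover have "x0 $ a + x0 $ b + x0 $ d = 1" using s by (simp flip: x0i of_int_add)
      ultimately show ?thesis by linarith
    qed
    have "\<not> smooth_polytope M P"
    proof (rule birkhoff_not_smooth[where \<alpha> = \<alpha> and w = "\<lambda>k. x0 + h (e k)" and o' = "\<lambda>k. x0 + h (o' k)"])
      show "convex P" unfolding P_def by (rule convex_quiver_polytope)
      show "x - y \<in> M" if "x \<in> M" "y \<in> M" for x y using that by (rule M_diff)
      show "x $ a \<in> \<int>" if "x \<in> M" for x a using that by (rule M_int)
      show "0 \<le> x $ \<alpha> i j" if "x \<in> P" "i < 3" "j < 3" for x i j
        using that \<alpha>[of i j] A unfolding P_def quiver_polytope_def by blast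
      show "x $ \<alpha> i 0 + x $ \<alpha> i 1 + x $ \<alpha> i 2 = 1" if x: "x \<in> P" and i: "i < 3" for x i
      proof (rule line[OF x])
        have \<alpha>i: "T i j = \<phi> (\<alpha> i j)" "n i j = - x0i (\<alpha> i j)" if "j < 3" for j using \<alpha>[OF i that] by simp_all
        show "\<phi> (\<alpha> i 0) z + \<phi> (\<alpha> i 1) z + \<phi> (\<alpha> i 2) z = 0" for z
          using T_rows[OF i, of z] \<alpha>i(1)[of 0] \<alpha>i(1)[of 1] \<alpha>i(1)[of 2] by simp
        show "x0i (\<alpha> i 0) + x0i (\<alpha> i 1) + x0i (\<alpha> i 2) = 1"
          using n_sums(1)[OF i] \<alpha>i(2)[of 0] \<alpha>i(2)[of 1] \<alpha>i(2)[of 2] by simp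
      qed
      show "x $ \<alpha> 0 i + x $ \<alpha> 1 i + x $ \<alpha> 2 i = 1" if x: "x \<in> P" and i: "i < 3" for x i
      proof (rule line[OF x])
        have \<alpha>i: "T j i = \<phi> (\<alpha> j i)" "n j i = - x0i (\<alpha> j i)" if "j < 3" for j using \<alpha>[OF that i] by simp_all
        show "\<phi> (\<alpha> 0 i) z + \<phi> (\<alpha> 1 i) z + \<phi> (\<alpha> 2 i) z = 0" for z
          using T_cols[OF i, of z] \<alpha>i(1)[of 0] \<alpha>i(1)[of 1] \<alpha>i(1)[of 2] by simp
        show "x0i (\<alpha> 0 i) + x0i (\<alpha> 1 i) + x0i (\<alpha> 2 i) = 1"
          using n_sums(2)[OF i] \<alpha>i(2)[of 0] \<alpha>i(2)[of 1] \<alpha>i(2)[of 2] by simp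
      qed
      show "x = y" if xy: "x \<in> P" "y \<in> P" and eq: "\<And>i j. i < 3 \<Longrightarrow> j < 3 \<Longrightarrow> x $ \<alpha> i j = y $ \<alpha> i j" for x y
      proof -
        obtain \<xi> where \<xi>: "\<forall>a. x $ a - x0 $ a = (\<Sum>k\<in>UNIV. \<xi> k * real_of_int (c k a))" using span[OF xy(1)] by blast
        obtain \<eta> where \<eta>: "\<forall>a. y $ a - x0 $ a = (\<Sum>k\<in>UNIV. \<eta> k * real_of_int (c k a))" using span[OF xy(2)] by blast
        have "x $ a = y $ a" for a
        proof (cases "a \<in> A")
          case False
          then show ?thesis using not_moving[of x Q \<theta> a] not_moving[of y Q \<theta> a] xy unfolding P_def A_def by simp
        next
          case True
          then have "\<phi> a \<in> F" unfolding F_def by blast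
          then have "(\<forall>z. \<phi> a z = 0) \<or> (\<exists>i<3. \<exists>j<3. (\<forall>z. \<phi> a z = T i j z) \<or> (\<forall>z. \<phi> a z = - T i j z))"
            by (rule tableD(4)[OF T])
          then show ?thesis
          proof (elim disjE exE conjE)
            assume "\<forall>z. \<phi> a z = 0"
            then have "c k a = 0" for k unfolding c\<phi> by simp
            then show ?thesis using \<xi>[rule_format, of a] \<eta>[rule_format, of a] by simp
          next
            fix i j assume ij: "i < 3" "j < 3" "\<forall>z. \<phi> a z = T i j z"
            then have "c k a = c k (\<alpha> i j)" for k using \<alpha>[OF ij(1,2)] unfolding c\<phi> by simp
            then show ?thesis
              using \<xi>[rule_format, of a] \<eta>[rule_format, of a] \<xi>[rule_format, of "\<alpha> i j"] \<eta>[rule_format, of "\<alpha> i j"] eq[OF ij(1,2)] by simp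
          next
            fix i j assume ij: "i < 3" "j < 3" "\<forall>z. \<phi> a z = - T i j z"
            then have "c k a = - c k (\<alpha> i j)" for k using \<alpha>[OF ij(1,2)] unfolding c\<phi> by simp
            then have "x $ a - x0 $ a = - (x $ \<alpha> i j - x0 $ \<alpha> i j)" "y $ a - x0 $ a = - (y $ \<alpha> i j - x0 $ \<alpha> i j)"
              using \<xi> \<eta> by (simp_all add: sum_negf)
            then show ?thesis using eq[OF ij(1,2)] by linarith
          qed
        qed
        then show ?thesis by (simp add: vec_eq_iff)
      qed
      show "x0 + h (e k) \<in> P \<inter> M" "x0 + h (o' k) \<in> P \<inter> M" if "k < 3" for k using in_PM eo that by blast+
      show "(x0 + h (e k)) $ \<alpha> i j = even_perm k i j" if "k < 3" "i < 3" "j < 3" for k i j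
      proof -
        have "x0i (\<alpha> i j) + \<phi> (\<alpha> i j) (e k) = even_perm k i j" using te[OF that(2,3,1)] \<alpha>[OF that(2,3)] by simp
        then have "real_of_int (x0i (\<alpha> i j) + \<phi> (\<alpha> i j) (e k)) = even_perm k i j" by simp
        then show ?thesis by (simp add: x0i h\<phi>)
      qed
      show "(x0 + h (o' k)) $ \<alpha> i j = odd_perm k i j" if "k < 3" "i < 3" "j < 3" for k i j
      proof -
        have "x0i (\<alpha> i j) + \<phi> (\<alpha> i j) (o' k) = odd_perm k i j" using to[OF that(2,3,1)] \<alpha>[OF that(2,3)] by simp
        then have "real_of_int (x0i (\<alpha> i j) + \<phi> (\<alpha> i j) (o' k)) = odd_perm k i j" by simp
        then show ?thesis by (simp add: x0i h\<phi>)
      qed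
      have "e 0 + e 1 + e 2 = o' 0 + o' 1 + o' 2"
      proof (rule table_inj[OF T])
        fix i j :: nat assume *: "i < 3" "j < 3"
        show "T i j (e 0 + e 1 + e 2) = T i j (o' 0 + o' 1 + o' 2)"
          using te[OF *, of 0] te[OF *, of 1] te[OF *, of 2] to[OF *, of 0] to[OF *, of 1] to[OF *, of 2] perm_sums[OF *]
          by (simp add: add[OF TF[OF *]])
      qed
      then have "h (e 0) + h (e 1) + h (e 2) = h (o' 0) + h (o' 1) + h (o' 2)" by (metis h_add)
      then show "x0 + h (e 0) + (x0 + h (e 1)) + (x0 + h (e 2)) = x0 + h (o' 0) + (x0 + h (o' 1)) + (x0 + h (o' 2))"
        by (simp add: algebra_simps)
    qed
    with smooth show False unfolding P_def M_def by blast
  qed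
  then have "quad_connected (solutions K)" using quad_connected_or_birkhoff[OF frame KF] by blast
  then have "quad_connected ((\<lambda>z. x0 + h z) ` solutions K)"
    by (rule quad_connected_image[OF _ h_add, where G = G]) (use sol inj_h in \<open>auto simp: G_def\<close>)
  then show ?thesis unfolding image P_def M_def .
qed

theorem corollary4p14:
  fixes Q :: "('v, 'e::finite) pre_digraph" and \<theta> :: "'v \<Rightarrow> int"
  assumes "acyclic_quiver Q"
    and "quiver_polytope Q \<theta> \<noteq> {}"
    and "smooth_polytope (arrow_lattice Q) (quiver_polytope Q \<theta>)"
    and "aff_dim (quiver_polytope Q \<theta>) \<le> 4"
  shows "generated_in_degree_two (quiver_polytope Q \<theta> \<inter> arrow_lattice Q) (quiver_toric_ideal Q \<theta>)"
proof -
  have "fin_digraph Q" using assms(1) unfolding acyclic_quiver_def by blast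
  from quad_connected_smooth_quiver_polytope[OF this assms(3,4)] show ?thesis
    unfolding quiver_toric_ideal_def by (rule generated_in_degree_two_if_quad_connected)
qed

end
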